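(* Let $Q=(\mathbb{R}/2\pi\mathbb{Z})^3$, $T>0$, $Q_T=Q\times[0,T)$, $\overline{Q}_T=Q\times[0,T]$. Let $G:\mathrm{Mat}^{3\times3}\to[0,\infty)$ be strictly convex and satisfy: (a1) $G\in C^3$ and $m|Z|^2\le D^2G(\hat F)[Z,Z]\le M|Z|^2$ for all $\hat F,Z$; (a2) $G(F)=g_0(F)+\tfrac12|F|^2$ with $g_0(F)/(1+|F|^2)\to0$ as $|F|\to\infty$; (a3) $|\nabla_FG(F)|/(1+|F|^2)\to0$ as $|F|\to\infty$; (a4) $|D^3G(F)|\le M$; for some constants $0<m\le M$. Consider the system $\partial_t v_i=\partial_{x_\alpha}\big(\frac{\partial G}{\partial F_{i\alpha}}(F)\big)$, $\partial_tF_{i\alpha}=\partial_{x_\alpha}v_i$, with energy $\eta(v,F)=\tfrac12|v|^2+G(F)$. Let $(v,F,\nu,\gamma)$ be a dissipative measure-valued solution with concentration associated to initial data $(v^0,F^0)\in L^2\oplus L^2$; that is: $(v,F)\in L^\infty(L^2)\oplus L^\infty(L^2)$; $\nu=(\nu_{x,t})_{(x,t)\in\overline{Q}_T}$ is a Young measure on $\mathbb{R}^3\times\mathrm{Mat}^{3\times3}$ (coordinates $(\lambda,M)$) generated by a sequence $(v^\epsilon,F^\epsilon)$ with $\sup_\epsilon\sup_{t}\int\eta(v^\epsilon,F^\epsilon)dx<\infty$ (meaning $g(v^\epsilon,F^\epsilon)\rightharpoonup\langle\nu,g\rangle$ weakly in $L^1$ for every continuous $g$ with $g(\lambda,M)/(1+|\lambda|^2+|M|^2)\to0$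 at infinity), with $v=\langle\nu,\lambda\rangle$, $F=\langle\nu,M\rangle$; $\gamma$ is a non-negative Radon measure on $Q_T$; and for $i,\alpha=1,2,3$ and all $\psi\in C^1_c(Q_T)$ $$\int\psi(0,x)v_i^0\,dx+\iint v_i\partial_t\psi\,dx\,dt=\iint\Big\langle\nu,\frac{\partial G}{\partial F_{i\alpha}}\Big\rangle\partial_\alpha\psi\,dx\,dt,$$ $$\int\psi(0,x)F^0_{i\alpha}\,dx+\iint F_{i\alpha}\partial_t\psi\,dx\,dt=\iint v_i\partial_\alpha\psi\,dx\,dt,$$ and for all $\theta\in C^1_c([0,T))$ with $\theta\ge0$ $$\iint\dot\theta(t)\big(\langle\nu_{x,t},\eta\rangle\,dx\,dt+\gamma(dx\,dt)\big)+\int\theta(0)\eta(v^0,F^0)\,dx\ge0.$$ (i) If $(\hat v,\hat F)\in W^{1,\infty}(\overline{Q}_T)$ is a Lipschitz classical solution of the system (solving it almost everywhere) with initial data $(\hat v^0,\hat F^0)$, then there exist $c_1,c_2>0$ such that for $0\le t\le T$ $$\int\langle\nu,|\lambda-\hat v|^2+|M-\hat F|^2\rangle\,dx\le c_1\Big(\int|v^0-\hat v^0|^2+|F^0-\hat F^0|^2dx\Big)e^{c_2t}.$$ (ii) If in addition $v^0=\hat v^0$ and $F^0=\hat F^0$ almost everywhere, then $(v,F)=(\hat v,\hat F)$, $\nu_{x,t}=\delta_{(\hat v(x,t),\hat F(x,t))}$ almost everywhere, and $\gamma$ is null in $Q_T$.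
   Context: Summation convention; $|F|^2=F_{i\alpha}F_{i\alpha}$; $D^2G(\hat F)[Z,\tilde Z]=\frac{\partial^2G(\hat F)}{\partial F_{i\alpha}\partial F_{j\beta}}Z_{i\alpha}\tilde Z_{j\beta}$. $C^1_c(Q_T)$ denotes $C^1$ functions on $Q\times[0,T)$ vanishing near $t=T$.
   Formalization: The estimate in (i) is asserted for almost every t in [0,T] instead of every t, because the Young measure is determined only almost everywhere: changing it on one time slice keeps all hypotheses but breaks the bound there. *)

theory Defs
  imports "HOL-Analysis.Analysis" "HOL-Probability.Probability"
begin

type_synonym vec3 = "real^3"
type_synonym mat3 = "real^3^3"

text \<open>The torus Q = (R/2 pi Z)^3 is represented by the fundamental cell [0,2pi)^3;
  functions on Q are 2pi-periodic functions on R^3 (only where periodicity matters).\<close>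

definition Qcell :: "vec3 set" where
  "Qcell = {x. \<forall>i. 0 \<le> x$i \<and> x$i < 2*pi}"

definition periodic3 :: "(vec3 \<Rightarrow> 'b) \<Rightarrow> bool" where
  "periodic3 f \<longleftrightarrow> (\<forall>x k. f (x + (2*pi) *\<^sub>R axis k 1) = f x)"

definition QT :: "real \<Rightarrow> (vec3 \<times> real) set" where
  "QT T = Qcell \<times> {0..<T}"

definition QTbar :: "real \<Rightarrow> (vec3 \<times> real) set" where
  "QTbar T = Qcell \<times> {0..T}"

definition strictly_convex :: "(mat3 \<Rightarrow> real) \<Rightarrow> bool" where
  "strictly_convex G \<longleftrightarrow>
     (\<forall>x y u. x \<noteq> y \<and> 0 < u \<and> u < 1 \<longrightarrow>
        G (u *\<^sub>R x + (1 - u) *\<^sub>R y) < u * G x + (1 - u) * G y)"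

definition eta :: "(mat3 \<Rightarrow> real) \<Rightarrow> vec3 \<Rightarrow> mat3 \<Rightarrow> real" where
  "eta G l Mt = (norm l)^2 / 2 + G Mt"

text \<open>Standing assumptions on G. DG F is the matrix of partials dG/dF_{i alpha};
  D2G F Z W = D^2G(F)[Z,W]; D3G F Z W Y = D^3G(F)[Z,W,Y]. Note that the inner product on
  real^3^3 is the Frobenius product and the norm is the Frobenius norm |F|.\<close>
definition G_hyp ::
  "(mat3 \<Rightarrow> real) \<Rightarrow> (mat3 \<Rightarrow> mat3) \<Rightarrow> (mat3 \<Rightarrow> mat3 \<Rightarrow> mat3 \<Rightarrow> real)
   \<Rightarrow> (mat3 \<Rightarrow> mat3 \<Rightarrow> mat3 \<Rightarrow> mat3 \<Rightarrow> real) \<Rightarrow> real \<Rightarrow> real \<Rightarrow> bool" where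
  "G_hyp G DG D2G D3G m M \<longleftrightarrow>
     0 < m \<and> m \<le> M \<and>
     (\<forall>F. 0 \<le> G F) \<and> strictly_convex G \<and>
     \<comment> \<open>(a1) G is C^3, with the derivatives DG, D2G, D3G\<close>
     (\<forall>F. (G has_derivative (\<lambda>Z. DG F \<bullet> Z)) (at F)) \<and>
     (\<forall>F W. ((\<lambda>F'. DG F' \<bullet> W) has_derivative (\<lambda>Z. D2G F Z W)) (at F)) \<and>
     (\<forall>F Z W. ((\<lambda>F'. D2G F' Z W) has_derivative (\<lambda>Y. D3G F Z W Y)) (at F)) \<and>
     (\<forall>Z W Y. continuous_on UNIV (\<lambda>F. D3G F Z W Y)) \<and>
     (\<forall>F Z. m * (norm Z)^2 \<le> D2G F Z Z \<and> D2G F Z Z \<le> M * (norm Z)^2) \<and>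
     \<comment> \<open>(a2) G = g0 + |F|^2/2 with g0(F)/(1+|F|^2) \<rightarrow> 0\<close>
     ((\<lambda>F. (G F - (norm F)^2 / 2) / (1 + (norm F)^2)) \<longlongrightarrow> 0) at_infinity \<and>
     \<comment> \<open>(a3)\<close>
     ((\<lambda>F. norm (DG F) / (1 + (norm F)^2)) \<longlongrightarrow> 0) at_infinity \<and>
     \<comment> \<open>(a4) |D^3G(F)| \<le> M (operator norm)\<close>
     (\<forall>F Z W Y. \<bar>D3G F Z W Y\<bar> \<le> M * norm Z * norm W * norm Y)"

definition test_QT ::
  "real \<Rightarrow> (vec3 \<Rightarrow> real \<Rightarrow> real) \<Rightarrow> (vec3 \<Rightarrow> real \<Rightarrow> real) \<Rightarrow> (vec3 \<Rightarrow> real \<Rightarrow> vec3) \<Rightarrow> bool" where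
  "test_QT T psi psit psix \<longleftrightarrow>
     (\<forall>t. periodic3 (\<lambda>x. psi x t)) \<and>
     (\<forall>x t. t \<in> {0..<T} \<longrightarrow>
        ((\<lambda>z. psi (fst z) (snd z)) has_derivative
           (\<lambda>h. psix x t \<bullet> fst h + snd h * psit x t)) (at (x, t) within (UNIV \<times> {0..<T}))) \<and>
     continuous_on (UNIV \<times> {0..<T}) (\<lambda>z. psit (fst z) (snd z)) \<and>
     continuous_on (UNIV \<times> {0..<T}) (\<lambda>z. psix (fst z) (snd z)) \<and>
     (\<exists>\<tau><T. \<forall>x t. \<tau> \<le> t \<and> t < T \<longrightarrow> psi x t = 0)"

definition test_T :: "real \<Rightarrow> (real \<Rightarrow> real) \<Rightarrow> (real \<Rightarrow> real) \<Rightarrow> bool" where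
  "test_T T \<theta> \<theta>' \<longleftrightarrow>
     (\<forall>t\<in>{0..<T}. (\<theta> has_real_derivative \<theta>' t) (at t within {0..<T})) \<and>
     continuous_on {0..<T} \<theta>' \<and>
     (\<forall>t\<in>{0..<T}. 0 \<le> \<theta> t) \<and>
     (\<exists>\<tau><T. \<forall>t. \<tau> \<le> t \<and> t < T \<longrightarrow> \<theta> t = 0)"

definition ymean :: "(vec3 \<Rightarrow> real \<Rightarrow> (vec3 \<times> mat3) measure) \<Rightarrow> vec3 \<Rightarrow> real \<Rightarrow> ((vec3 \<times> mat3) \<Rightarrow> 'b::{banach,second_countable_topology}) \<Rightarrow> 'b" where
  "ymean \<nu> x t g = integral\<^sup>L (\<nu> x t) g"

definition dmv_solution ::
  "(mat3 \<Rightarrow> real) \<Rightarrow> (mat3 \<Rightarrow> mat3) \<Rightarrow> real \<Rightarrow> (vec3 \<Rightarrow> vec3) \<Rightarrow> (vec3 \<Rightarrow> mat3)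
   \<Rightarrow> (vec3 \<Rightarrow> real \<Rightarrow> vec3) \<Rightarrow> (vec3 \<Rightarrow> real \<Rightarrow> mat3)
   \<Rightarrow> (vec3 \<Rightarrow> real \<Rightarrow> (vec3 \<times> mat3) measure) \<Rightarrow> (vec3 \<times> real) measure \<Rightarrow> bool" where
  "dmv_solution G DG T v0 F0 v F \<nu> \<gamma> \<longleftrightarrow>
     \<comment> \<open>initial data in L^2\<close>
     v0 \<in> borel_measurable lborel \<and> F0 \<in> borel_measurable lborel \<and>
     set_integrable lborel Qcell (\<lambda>x. (norm (v0 x))^2) \<and>
     set_integrable lborel Qcell (\<lambda>x. (norm (F0 x))^2) \<and>
     \<comment> \<open>(v,F) in L^\<infinity>(L^2)\<close>
     set_borel_measurable lborel (QTbar T) (\<lambda>z. v (fst z) (snd z)) \<and>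
     set_borel_measurable lborel (QTbar T) (\<lambda>z. F (fst z) (snd z)) \<and>
     (\<exists>C. AE t in lborel. t \<in> {0..T} \<longrightarrow>
        set_integrable lborel Qcell (\<lambda>x. (norm (v x t))^2 + (norm (F x t))^2) \<and>
        (LINT x:Qcell|lborel. (norm (v x t))^2 + (norm (F x t))^2) \<le> C) \<and>
     \<comment> \<open>nu is a family of probability measures on R^3 x Mat^{3x3}\<close>
     (\<forall>x t. (x, t) \<in> QTbar T \<longrightarrow> prob_space (\<nu> x t) \<and> sets (\<nu> x t) = sets borel) \<and>
     \<comment> \<open>nu is generated by a sequence (v^eps, F^eps) with uniformly bounded energy\<close>
     (\<exists>ve Fe. \<exists>C.
        (\<forall>n. set_borel_measurable lborel (QTbar T) (\<lambda>z. ve n (fst z) (snd z)) \<and>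
             set_borel_measurable lborel (QTbar T) (\<lambda>z. Fe n (fst z) (snd z))) \<and>
        (\<forall>n. \<forall>t\<in>{0..T}. set_integrable lborel Qcell (\<lambda>x. eta G (ve n x t) (Fe n x t)) \<and>
              (LINT x:Qcell|lborel. eta G (ve n x t) (Fe n x t)) \<le> C) \<and>
        (\<forall>g :: vec3 \<times> mat3 \<Rightarrow> real.
           continuous_on UNIV g \<and>
           ((\<lambda>w. g w / (1 + (norm (fst w))^2 + (norm (snd w))^2)) \<longlongrightarrow> 0) at_infinity \<longrightarrow>
             (AE z in lborel. z \<in> QTbar T \<longrightarrow> integrable (\<nu> (fst z) (snd z)) g) \<and>
             set_integrable lborel (QTbar T) (\<lambda>z. ymean \<nu> (fst z) (snd z) g) \<and>
             (\<forall>\<phi> :: vec3 \<times> real \<Rightarrow> real. \<phi> \<in> borel_measurable lborel \<and> bounded (range \<phi>) \<longrightarrow>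
                (\<lambda>n. LINT z:QTbar T|lborel. g (ve n (fst z) (snd z), Fe n (fst z) (snd z)) * \<phi> z)
                \<longlonglongrightarrow> (LINT z:QTbar T|lborel. ymean \<nu> (fst z) (snd z) g * \<phi> z)))) \<and>
     \<comment> \<open>v = <nu, lambda>, F = <nu, M>\<close>
     (AE z in lborel. z \<in> QTbar T \<longrightarrow>
        v (fst z) (snd z) = ymean \<nu> (fst z) (snd z) fst \<and>
        F (fst z) (snd z) = ymean \<nu> (fst z) (snd z) snd) \<and>
     \<comment> \<open>gamma is a non-negative Radon measure on Q_T\<close>
     sets \<gamma> = sets borel \<and> emeasure \<gamma> (UNIV - QT T) = 0 \<and>
     (\<forall>s. 0 \<le> s \<and> s < T \<longrightarrow> emeasure \<gamma> (Qcell \<times> {0..s}) < \<infinity>) \<and>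
     \<comment> \<open>weak form of the momentum equations (summation over alpha)\<close>
     (\<forall>i psi psit psix. test_QT T psi psit psix \<longrightarrow>
        (LINT x:Qcell|lborel. psi x 0 * v0 x $ i)
        + (LINT z:QT T|lborel. v (fst z) (snd z) $ i * psit (fst z) (snd z))
        = (\<Sum>\<alpha>\<in>UNIV. LINT z:QT T|lborel.
              ymean \<nu> (fst z) (snd z) (\<lambda>w. DG (snd w) $ i $ \<alpha>) * psix (fst z) (snd z) $ \<alpha>)) \<and>
     \<comment> \<open>weak form of the compatibility equations\<close>
     (\<forall>i \<alpha> psi psit psix. test_QT T psi psit psix \<longrightarrow>
        (LINT x:Qcell|lborel. psi x 0 * F0 x $ i $ \<alpha>)
        + (LINT z:QT T|lborel. F (fst z) (snd z) $ i $ \<alpha> * psit (fst z) (snd z))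
        = (LINT z:QT T|lborel. v (fst z) (snd z) $ i * psix (fst z) (snd z) $ \<alpha>)) \<and>
     \<comment> \<open>energy inequality\<close>
     (\<forall>\<theta> \<theta>'. test_T T \<theta> \<theta>' \<longrightarrow>
        (LINT z:QT T|lborel. \<theta>' (snd z) * ymean \<nu> (fst z) (snd z) (\<lambda>w. eta G (fst w) (snd w)))
        + (LINT z:QT T|\<gamma>. \<theta>' (snd z))
        + (LINT x:Qcell|lborel. \<theta> 0 * eta G (v0 x) (F0 x)) \<ge> 0)"

text \<open>Partial derivatives (used where they are asserted to exist).\<close>
definition pdt :: "(vec3 \<Rightarrow> real \<Rightarrow> real) \<Rightarrow> vec3 \<Rightarrow> real \<Rightarrow> real" where
  "pdt f x t = deriv (\<lambda>s. f x s) t"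
definition pdx :: "3 \<Rightarrow> (vec3 \<Rightarrow> real \<Rightarrow> real) \<Rightarrow> vec3 \<Rightarrow> real \<Rightarrow> real" where
  "pdx \<alpha> f x t = deriv (\<lambda>s. f (x + s *\<^sub>R axis \<alpha> 1) t) 0"
definition has_pds :: "(vec3 \<Rightarrow> real \<Rightarrow> real) \<Rightarrow> vec3 \<Rightarrow> real \<Rightarrow> bool" where
  "has_pds f x t \<longleftrightarrow> (\<lambda>s. f x s) differentiable (at t) \<and>
      (\<forall>\<alpha>. (\<lambda>s. f (x + s *\<^sub>R axis \<alpha> 1) t) differentiable (at 0))"

definition lipschitz_solution ::
  "(mat3 \<Rightarrow> mat3) \<Rightarrow> real \<Rightarrow> (vec3 \<Rightarrow> real \<Rightarrow> vec3) \<Rightarrow> (vec3 \<Rightarrow> real \<Rightarrow> mat3) \<Rightarrow> bool" where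
  "lipschitz_solution DG T vh Fh \<longleftrightarrow>
     (\<forall>t. periodic3 (\<lambda>x. vh x t) \<and> periodic3 (\<lambda>x. Fh x t)) \<and>
     (\<exists>L. L-lipschitz_on (UNIV \<times> {0..T}) (\<lambda>z. vh (fst z) (snd z)) \<and>
          L-lipschitz_on (UNIV \<times> {0..T}) (\<lambda>z. Fh (fst z) (snd z))) \<and>
     (AE z in lborel. z \<in> Qcell \<times> {0<..<T} \<longrightarrow>
        (\<forall>i. has_pds (\<lambda>x t. vh x t $ i) (fst z) (snd z)) \<and>
        (\<forall>i \<alpha>. has_pds (\<lambda>x t. Fh x t $ i $ \<alpha>) (fst z) (snd z)) \<and>
        (\<forall>i \<alpha>. has_pds (\<lambda>x t. DG (Fh x t) $ i $ \<alpha>) (fst z) (snd z)) \<and>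
        (\<forall>i. pdt (\<lambda>x t. vh x t $ i) (fst z) (snd z)
              = (\<Sum>\<alpha>\<in>UNIV. pdx \<alpha> (\<lambda>x t. DG (Fh x t) $ i $ \<alpha>) (fst z) (snd z))) \<and>
        (\<forall>i \<alpha>. pdt (\<lambda>x t. Fh x t $ i $ \<alpha>) (fst z) (snd z)
              = pdx \<alpha> (\<lambda>x t. vh x t $ i) (fst z) (snd z)))"

end

theory Submission
  imports Defs
begin

text \<open>The relative entropy |\<lambda> - vh|^2 / 2 + G(M) - G(Fh) - DG(Fh)(M - Fh), averaged over the Young measure,
  is the energy minus terms linear in (\<lambda>, M) with coefficients vh and DG(Fh). Testing the energy
  inequality with \<theta>(t) and the weak equations with \<theta> vh and \<theta> DG(Fh) yields its evolution: all terms of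
  first order in the difference cancel by the equations for the classical solution and by the symmetry
  of the second derivative of G, and what remains is bounded by |M - Fh|^2 |\<partial>t Fh|, hence by the
  relative entropy itself. As vh and DG(Fh) are only Lipschitz, they are first mollified; the
  derivatives of the mollified functions converge weakly against integrable functions because they are
  bounded and their integrals over open sets are close to those of difference quotients. The
  concentration measure enters only through a term of favourable sign, and when the relative entropy
  vanishes a strictly decreasing \<theta> forces it to be null.\<close>

section \<open>The stored energy\<close>

text \<open>The weak convergence of the generating sequence covers only integrands of less than
  quadratic growth, while the energy grows quadratically. Its mean is therefore handled separately:
  the energy bound survives truncation and passage to the limit, which gives \<nu> a finite second
  moment, and every mean in the argument is dominated by a multiple of \<open>1 + sq\<close>. Means
  must also depend measurably on (x, t), which is known only for continuous integrands until \<nu>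
  is shown to be a Borel kernel. The classical solution has partial derivatives, and these almost
  everywhere, so all calculus is done along single lines and every chain rule is one for curves. As
  the means are merely integrable, the derivatives of the mollified functions have to converge
  against arbitrary integrable functions; the common Lipschitz constant makes this possible. The
  exponential rate stems from the Taylor remainder of \<open>DG\<close>, a bound on the time
  derivative of \<open>Fh\<close> and the convexity of \<open>G\<close>; the prefactor
  \<open>max 1 M / min 1 m\<close> compares the relative entropy with the squared distance from both
  sides.\<close>

lemma taylor_second_order:
  fixes f f' f'' :: "real \<Rightarrow> real"
  assumes "\<And>t. (f has_real_derivative f' t) (at t)" and "\<And>t. (f' has_real_derivative f'' t) (at t)"
  obtains t where "0 < t" "t < 1" "f 1 = f 0 + f' 0 + f'' t / 2"
proof -
  define diff where "diff n = (if n = 0 then f else if n = 1 then f' else f'')" for n :: nat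
  have "\<forall>n t. n < 2 \<and> 0 \<le> t \<and> t \<le> 1 \<longrightarrow> DERIV (diff n) t :> diff (Suc n) t"
    using assms by (auto simp: diff_def less_2_cases_iff)
  then obtain t where "0 < t" "t < 1" "f 1 = (\<Sum>n<2. (diff n 0 / fact n) * (1 - 0) ^ n) + (diff 2 t / fact 2) * (1 - 0) ^ 2"
    using Taylor_up[of 2 diff f 0 1 0] by (auto simp: diff_def)
  moreover have "(\<Sum>n<2. (diff n 0 / fact n) * (1 - 0) ^ n) = f 0 + f' 0"
    by (simp add: diff_def numeral_2_eq_2)
  moreover have "diff 2 = f''" by (simp add: diff_def)
  ultimately show ?thesis
    by (intro that[of t]) simp_all
qed

locale stored_energy =
  fixes G :: "mat3 \<Rightarrow> real" and DG :: "mat3 \<Rightarrow> mat3"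
    and D2G :: "mat3 \<Rightarrow> mat3 \<Rightarrow> mat3 \<Rightarrow> real"
    and D3G :: "mat3 \<Rightarrow> mat3 \<Rightarrow> mat3 \<Rightarrow> mat3 \<Rightarrow> real"
    and m M :: real
  assumes G_hyp: "G_hyp G DG D2G D3G m M"
begin

section \<open>Taylor expansions of the energy and of the stress with uniform remainders\<close>

lemma m_pos: "0 < m" and M_pos: "0 < M"
  using G_hyp by (auto simp: G_hyp_def)

lemma G_nonneg: "0 \<le> G A"
  using G_hyp by (simp add: G_hyp_def)

lemma G_deriv: "(G has_derivative (\<lambda>Z. DG A \<bullet> Z)) (at A)"
  and DG_deriv: "((\<lambda>A. DG A \<bullet> W) has_derivative (\<lambda>Z. D2G A Z W)) (at A)"
  and D2G_deriv: "((\<lambda>A. D2G A Z W) has_derivative (\<lambda>Y. D3G A Z W Y)) (at A)"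
  using G_hyp by (auto simp: G_hyp_def)

lemma D2G_lower: "m * (norm Z)\<^sup>2 \<le> D2G A Z Z" and D2G_upper: "D2G A Z Z \<le> M * (norm Z)\<^sup>2"
  and D3G_bound: "\<bar>D3G A Z W Y\<bar> \<le> M * norm Z * norm W * norm Y"
  using G_hyp by (auto simp: G_hyp_def)

lemma deriv_along_line:
  fixes f :: "mat3 \<Rightarrow> real"
  assumes "\<And>A. (f has_derivative f' A) (at A)"
  shows "((\<lambda>s. f (B + s *\<^sub>R Z)) has_real_derivative f' (B + s *\<^sub>R Z) Z) (at s)"
proof -
  have "((\<lambda>s. B + s *\<^sub>R Z) has_derivative (\<lambda>h. h *\<^sub>R Z)) (at s)"
    by (auto intro!: derivative_eq_intros)
  from has_derivative_compose[OF this assms]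
  have "((\<lambda>s. f (B + s *\<^sub>R Z)) has_derivative (\<lambda>h. f' (B + s *\<^sub>R Z) (h *\<^sub>R Z))) (at s)" .
  moreover have "f' (B + s *\<^sub>R Z) (h *\<^sub>R Z) = f' (B + s *\<^sub>R Z) Z * h" for h
    using linear_cmul[OF has_derivative_linear[OF assms]] by simp
  ultimately show ?thesis
    by (simp add: has_field_derivative_def)
qed

lemma G_taylor:
  obtains t where "0 < t" "t < 1" "G A = G B + DG B \<bullet> (A - B) + D2G (B + t *\<^sub>R (A - B)) (A - B) (A - B) / 2"
proof -
  have "((\<lambda>s. G (B + s *\<^sub>R (A - B))) has_real_derivative DG (B + s *\<^sub>R (A - B)) \<bullet> (A - B)) (at s)"
    and "((\<lambda>s. DG (B + s *\<^sub>R (A - B)) \<bullet> (A - B)) has_real_derivative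
           D2G (B + s *\<^sub>R (A - B)) (A - B) (A - B)) (at s)" for s
    using deriv_along_line[OF G_deriv] deriv_along_line[OF DG_deriv] by auto
  from taylor_second_order[OF this] show ?thesis
    using that by (auto simp: algebra_simps)
qed

text \<open>The Bregman distance of \<open>G\<close>. It is not symmetric: the second argument is
  the base point of the expansion, later the classical deformation gradient.\<close>

definition G_rel :: "mat3 \<Rightarrow> mat3 \<Rightarrow> real" where
  "G_rel A B = G A - G B - DG B \<bullet> (A - B)"

lemma G_rel_lower: "m / 2 * (norm (A - B))\<^sup>2 \<le> G_rel A B"
proof -
  obtain t where "G A = G B + DG B \<bullet> (A - B) + D2G (B + t *\<^sub>R (A - B)) (A - B) (A - B) / 2"
    by (rule G_taylor)
  then show ?thesis
    using D2G_lower[of "A - B" "B + t *\<^sub>R (A - B)"] by (simp add: G_rel_def)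
qed

lemma G_rel_upper: "G_rel A B \<le> M / 2 * (norm (A - B))\<^sup>2"
proof -
  obtain t where "G A = G B + DG B \<bullet> (A - B) + D2G (B + t *\<^sub>R (A - B)) (A - B) (A - B) / 2"
    by (rule G_taylor)
  then show ?thesis
    using D2G_upper[of "B + t *\<^sub>R (A - B)" "A - B"] by (simp add: G_rel_def)
qed

text \<open>The uniform bound (a4) makes the remainder quadratic in \<open>A - B\<close> over the
  whole space of matrices, not just locally. This is what allows the relative stress to be dominated
  by the relative entropy. The stress is contracted with a fixed \<open>W\<close> so that the scalar
  Taylor formula applies.\<close>

lemma DG_taylor:
  "\<bar>(DG A - DG B) \<bullet> W - D2G B (A - B) W\<bar> \<le> M / 2 * (norm (A - B))\<^sup>2 * norm W"
proof -
  have "((\<lambda>s. DG (B + s *\<^sub>R (A - B)) \<bullet> W) has_real_derivative D2G (B + s *\<^sub>R (A - B)) (A - B) W) (at s)"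
    and "((\<lambda>s. D2G (B + s *\<^sub>R (A - B)) (A - B) W) has_real_derivative
           D3G (B + s *\<^sub>R (A - B)) (A - B) W (A - B)) (at s)" for s
    using deriv_along_line[OF DG_deriv] deriv_along_line[OF D2G_deriv] by auto
  from taylor_second_order[OF this]
  obtain t where "DG A \<bullet> W = DG B \<bullet> W + D2G B (A - B) W + D3G (B + t *\<^sub>R (A - B)) (A - B) W (A - B) / 2"
    by auto
  then show ?thesis
    using D3G_bound[of "B + t *\<^sub>R (A - B)" "A - B" W "A - B"]
    by (simp add: inner_diff_left power2_eq_square algebra_simps)
qed

section \<open>Bilinearity, symmetry and size of the second derivative\<close>

lemma D2G_linear1: "linear (\<lambda>Z. D2G A Z W)"
  using DG_deriv by (rule has_derivative_linear)

text \<open>\<open>D2G\<close> is specified as a derivative in its first slot, with \<open>W\<close>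
  as a parameter; linearity in \<open>W\<close> comes from the linearity of
  \<open>DG A \<bullet> W\<close> and uniqueness of derivatives.\<close>

lemma D2G_add2: "D2G A Z (V + W) = D2G A Z V + D2G A Z W"
proof -
  have "((\<lambda>A. DG A \<bullet> V + DG A \<bullet> W) has_derivative (\<lambda>Z. D2G A Z V + D2G A Z W)) (at A)"
    by (intro has_derivative_add DG_deriv)
  then have "(\<lambda>Z. D2G A Z V + D2G A Z W) = (\<lambda>Z. D2G A Z (V + W))"
    using DG_deriv[of "V + W" A] by (intro has_derivative_unique) (auto simp: inner_add_right)
  from fun_cong[OF this, of Z] show ?thesis by simp
qed

lemma D2G_scale2: "D2G A Z (c *\<^sub>R W) = c * D2G A Z W"
proof -
  have "((\<lambda>A. c * (DG A \<bullet> W)) has_derivative (\<lambda>Z. c * D2G A Z W)) (at A)"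
    by (intro has_derivative_mult_right DG_deriv)
  then have "(\<lambda>Z. c * D2G A Z W) = (\<lambda>Z. D2G A Z (c *\<^sub>R W))"
    using DG_deriv[of "c *\<^sub>R W" A] by (intro has_derivative_unique) auto
  from fun_cong[OF this, of Z] show ?thesis by simp
qed

lemma D2G_lipschitz: "\<bar>D2G A Z W - D2G B Z W\<bar> \<le> M * norm (A - B) * norm Z * norm W"
proof -
  have d: "((\<lambda>s. D2G (B + s *\<^sub>R (A - B)) Z W) has_real_derivative D3G (B + s *\<^sub>R (A - B)) Z W (A - B)) (at s)" for s
    by (rule deriv_along_line[OF D2G_deriv])
  obtain t where "D2G (B + 1 *\<^sub>R (A - B)) Z W - D2G (B + 0 *\<^sub>R (A - B)) Z W = (1 - 0) * D3G (B + t *\<^sub>R (A - B)) Z W (A - B)"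
    using MVT2[of 0 1, OF zero_less_one, OF d] by blast
  then show ?thesis
    using D3G_bound[of "B + t *\<^sub>R (A - B)" Z W "A - B"] by (simp add: algebra_simps)
qed

text \<open>The mean value form of the remainder evaluates \<open>D2G\<close> at an intermediate
  point; moving it back to \<open>B\<close> costs one more factor \<open>norm (A - B)\<close> by
  Lipschitz continuity. The constant is not sharp, as the factor \<open>t < 1\<close> is
  dropped.\<close>

lemma G_rel_taylor: "\<bar>G_rel A B - D2G B (A - B) (A - B) / 2\<bar> \<le> M / 2 * norm (A - B) ^ 3"
proof -
  obtain t where t: "0 < t" "t < 1"
    "G A = G B + DG B \<bullet> (A - B) + D2G (B + t *\<^sub>R (A - B)) (A - B) (A - B) / 2"
    by (rule G_taylor)
  have "\<bar>G_rel A B - D2G B (A - B) (A - B) / 2\<bar>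
      = \<bar>D2G (B + t *\<^sub>R (A - B)) (A - B) (A - B) - D2G B (A - B) (A - B)\<bar> / 2"
    unfolding G_rel_def t(3) by (simp add: abs_divide flip: diff_divide_distrib)
  also have "\<dots> \<le> M * norm (t *\<^sub>R (A - B)) * norm (A - B) * norm (A - B) / 2"
    using D2G_lipschitz[of "B + t *\<^sub>R (A - B)" "A - B" "A - B" B] by simp
  also have "\<dots> \<le> M * norm (A - B) * norm (A - B) * norm (A - B) / 2"
    using t M_pos by (intro divide_right_mono mult_right_mono mult_left_mono) (auto simp: mult_left_le_one_le)
  finally show ?thesis by (simp add: power3_eq_cube mult.assoc)
qed

text \<open>Symmetry follows by expanding G(A + sZ + sW) to third order at A, and alternatively first
  at A + sZ and then at A.\<close>

lemma D2G_commute: "D2G A Z W = D2G A W Z"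
proof -
  define N where "N = norm Z + norm W"
  have N0: "0 \<le> N" by (simp add: N_def)
  have bound: "\<bar>D2G A Z W - D2G A W Z\<bar> \<le> 10 * M * N ^ 3 * s" if s: "0 < s" for s
  proof -
    define H K where "H = s *\<^sub>R Z" and "K = s *\<^sub>R W"
    have HK: "norm H \<le> s * N" "norm K \<le> s * N" "norm (H + K) \<le> s * N"
      using s norm_triangle_ineq[of H K] by (auto simp: H_def K_def N_def algebra_simps)
    have p: "M / 2 * x * y * z \<le> M * (s * N) ^ 3 "
      if "0 \<le> x" "x \<le> s * N" "0 \<le> y" "y \<le> s * N" "0 \<le> z" "z \<le> s * N" for x y z
    proof -
      have "M / 2 * x * y * z \<le> M * (s * N) * (s * N) * (s * N)"
        using that M_pos s N0 by (intro mult_mono) auto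
      then show ?thesis by (simp add: power3_eq_cube mult.assoc)
    qed
    have lin: "D2G A (H + K) (H + K) = D2G A H H + D2G A H K + D2G A K H + D2G A K K"
      using linear_add[OF D2G_linear1] by (simp add: D2G_add2)
    have e1: "\<bar>G_rel (A + H + K) A - D2G A (H + K) (H + K) / 2\<bar> \<le> M * (s * N) ^ 3"
      using G_rel_taylor[of "A + H + K" A] p[of "norm (H + K)" "norm (H + K)" "norm (H + K)"] HK
      by (simp add: power3_eq_cube algebra_simps)
    have e2: "\<bar>G_rel (A + H + K) (A + H) - D2G (A + H) K K / 2\<bar> \<le> M * (s * N) ^ 3"
      using G_rel_taylor[of "A + H + K" "A + H"] p[of "norm K" "norm K" "norm K"] HK
      by (simp add: power3_eq_cube algebra_simps)
    have e3: "\<bar>G_rel (A + H) A - D2G A H H / 2\<bar> \<le> M * (s * N) ^ 3"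
      using G_rel_taylor[of "A + H" A] p[of "norm H" "norm H" "norm H"] HK
      by (simp add: power3_eq_cube algebra_simps)
    have e4: "\<bar>(DG (A + H) - DG A) \<bullet> K - D2G A H K\<bar> \<le> M * (s * N) ^ 3"
      using DG_taylor[of "A + H" A K] p[of "norm H" "norm H" "norm K"] HK
      by (simp add: power2_eq_square algebra_simps)
    have e5: "\<bar>D2G (A + H) K K - D2G A K K\<bar> \<le> 2 * (M * (s * N) ^ 3)"
      using D2G_lipschitz[of "A + H" K K A] p[of "norm H" "norm K" "norm K"] HK
      by (simp add: algebra_simps)
    \<comment> \<open>The expansion in one step contains half of each mixed term, the expansion in
      two steps contains \<open>D2G A H K\<close> in full, through \<open>e4\<close>. Their
      difference is half of the antisymmetric part, and the errors add up to 1 + 1 + 1 + 1 + 2 / 2 =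
      5. As the mixed terms scale like the square of \<open>s\<close> and the error like its cube, a
      factor \<open>s\<close> survives.\<close>
    have "\<bar>D2G A H K - D2G A K H\<bar> / 2 \<le> 5 * (M * (s * N) ^ 3)"
      using e1 e2 e3 e4 e5 lin unfolding G_rel_def
      by (simp add: inner_diff_left inner_add_right algebra_simps abs_le_iff) argo
    moreover have "D2G A H K - D2G A K H = s\<^sup>2 * (D2G A Z W - D2G A W Z)"
      using linear_cmul[OF D2G_linear1] by (simp add: H_def K_def D2G_scale2 power2_eq_square algebra_simps)
    ultimately have "s\<^sup>2 * \<bar>D2G A Z W - D2G A W Z\<bar> \<le> s\<^sup>2 * (10 * M * N ^ 3 * s)"
      using s by (simp add: abs_mult) (simp add: power_mult_distrib power3_eq_cube power2_eq_square algebra_simps)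
    then show ?thesis using s by simp
  qed
  have "((\<lambda>s. 10 * M * N ^ 3 * s) \<longlongrightarrow> 10 * M * N ^ 3 * 0) (at_right 0)"
    by (intro tendsto_intros)
  moreover have "eventually (\<lambda>s. \<bar>D2G A Z W - D2G A W Z\<bar> \<le> 10 * M * N ^ 3 * s) (at_right 0)"
    using bound by (auto simp: eventually_at_right_field intro!: exI[of _ 1])
  ultimately have "\<bar>D2G A Z W - D2G A W Z\<bar> \<le> 10 * M * N ^ 3 * 0"
    by (intro tendsto_lowerbound) auto
  then show ?thesis by simp
qed

text \<open>Polarisation on unit vectors: by symmetry, four times the mixed value is a difference of
  two diagonal values at vectors of norm at most 2. Both lie between 0 and \<open>4 * M\<close>, so
  positivity makes the bound \<open>M\<close> come out without loss; scaling does the rest.\<close>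

lemma D2G_bound: "\<bar>D2G A Z W\<bar> \<le> M * norm Z * norm W"
proof -
  have lin1: "D2G A (V + V') W = D2G A V W + D2G A V' W" "D2G A (c *\<^sub>R V) W = c * D2G A V W" for V V' W c
    using linear_add[OF D2G_linear1] linear_cmul[OF D2G_linear1] by auto
  have unit: "\<bar>D2G A V W\<bar> \<le> M" if "norm V = 1" "norm W = 1" for V W
  proof -
    have "4 * D2G A V W = D2G A (V + W) (V + W) - D2G A (V + (-1) *\<^sub>R W) (V + (-1) *\<^sub>R W)"
      unfolding lin1 D2G_add2 D2G_scale2 by (simp add: D2G_commute[of A W V])
    moreover have "0 \<le> D2G A Z Z" "D2G A Z Z \<le> 4 * M" if "norm Z \<le> 2" for Z
    proof -
      show "0 \<le> D2G A Z Z"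
        using D2G_lower[of Z A] m_pos by (smt (verit) mult_nonneg_nonneg zero_le_power2)
      have "(norm Z)\<^sup>2 \<le> 2\<^sup>2" using that by (intro power_mono) auto
      then have "M * (norm Z)\<^sup>2 \<le> M * 4" using M_pos by (intro mult_left_mono) auto
      then show "D2G A Z Z \<le> 4 * M" using D2G_upper[of A Z] by simp
    qed
    moreover have "norm (V + W) \<le> 2" "norm (V + (-1) *\<^sub>R W) \<le> 2"
      using that norm_triangle_ineq[of V W] norm_triangle_ineq4[of V W] by auto
    ultimately show ?thesis by (smt (verit))
  qed
  show ?thesis
  proof (cases "Z = 0 \<or> W = 0")
    case True
    then show ?thesis
      using lin1(2)[of 0 0 W] D2G_scale2[of A Z 0 0] M_pos by auto
  next
    case False
    have "D2G A Z W = norm Z * norm W * D2G A ((1 / norm Z) *\<^sub>R Z) ((1 / norm W) *\<^sub>R W)"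
      unfolding lin1 D2G_scale2 using False by simp
    moreover have "\<bar>D2G A ((1 / norm Z) *\<^sub>R Z) ((1 / norm W) *\<^sub>R W)\<bar> \<le> M"
      using False by (intro unit) auto
    ultimately have "\<bar>D2G A Z W\<bar> \<le> norm Z * norm W * M"
      by (simp add: abs_mult mult_left_mono)
    then show ?thesis by (simp add: mult_ac)
  qed
qed

text \<open>The mean value theorem is applied to the component of \<open>DG\<close> in the direction
  of the increment \<open>W = DG A - DG B\<close> itself; one factor \<open>norm W\<close> then
  cancels.\<close>

lemma DG_lipschitz: "norm (DG A - DG B) \<le> M * norm (A - B)"
proof -
  define W where "W = DG A - DG B"
  have d: "((\<lambda>s. DG (B + s *\<^sub>R (A - B)) \<bullet> W) has_real_derivative D2G (B + s *\<^sub>R (A - B)) (A - B) W) (at s)" for s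
    by (rule deriv_along_line[OF DG_deriv])
  obtain t where "DG (B + 1 *\<^sub>R (A - B)) \<bullet> W - DG (B + 0 *\<^sub>R (A - B)) \<bullet> W = (1 - 0) * D2G (B + t *\<^sub>R (A - B)) (A - B) W"
    using MVT2[of 0 1, OF zero_less_one, OF d] by blast
  then have "W \<bullet> W = D2G (B + t *\<^sub>R (A - B)) (A - B) W"
    by (simp add: W_def inner_diff_left)
  then have "norm W * norm W \<le> (M * norm (A - B)) * norm W"
    using D2G_bound[of "B + t *\<^sub>R (A - B)" "A - B" W] by (simp add: dot_square_norm power2_eq_square)
  then show ?thesis
    unfolding W_def[symmetric] by (cases "W = 0") (use M_pos in auto)
qed

section \<open>Continuity and two-sided quadratic growth of the energy\<close>

lemma continuous_on_DG: "continuous_on S DG"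
proof -
  have "M-lipschitz_on S DG"
    using DG_lipschitz M_pos by (intro lipschitz_onI) (auto simp: dist_norm)
  then show ?thesis by (rule lipschitz_on_continuous_on)
qed

lemma continuous_on_G: "continuous_on S G"
  using G_deriv by (meson continuous_at_imp_continuous_on has_derivative_continuous)

lemma G_growth: "G A \<le> G 0 + (norm (DG 0))\<^sup>2 + (1 + M) * (norm A)\<^sup>2"
proof -
  have "G A \<le> G 0 + norm (DG 0) * norm A + M / 2 * (norm A)\<^sup>2"
    using G_rel_upper[of A 0] norm_cauchy_schwarz[of "DG 0" A] by (simp add: G_rel_def)
  moreover have "norm (DG 0) * norm A \<le> (norm (DG 0))\<^sup>2 + (norm A)\<^sup>2"
    using sum_squares_bound[of "norm (DG 0)" "norm A"] mult_nonneg_nonneg[OF norm_ge_zero norm_ge_zero, of "DG 0" A]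
    by (simp only: mult.assoc)
  moreover have "0 \<le> M / 2 * (norm A)\<^sup>2" using M_pos by simp
  ultimately show ?thesis by (simp add: distrib_right)
qed

text \<open>Of the convexity bound \<open>m / 2\<close> one half is spent on absorbing the linear
  term in \<open>DG 0\<close> by Young's inequality. This converts bounds on the energy into bounds
  on the second moment.\<close>

lemma G_coercive: "m / 4 * (norm A)\<^sup>2 \<le> G A + (norm (DG 0))\<^sup>2 / m"
proof -
  have "G 0 + m / 2 * (norm A)\<^sup>2 \<le> G A + norm (DG 0) * norm A"
    using G_rel_lower[of A 0] norm_cauchy_schwarz[of "- DG 0" A] by (simp add: G_rel_def)
  moreover have "norm (DG 0) * norm A \<le> (norm (DG 0))\<^sup>2 / m + m / 4 * (norm A)\<^sup>2"
  proof -
    have "0 \<le> (norm (DG 0) - m / 2 * norm A)\<^sup>2 / m" using m_pos by simp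
    also have "\<dots> = (norm (DG 0))\<^sup>2 / m + m / 4 * (norm A)\<^sup>2 - norm (DG 0) * norm A"
      using m_pos by (simp add: power2_eq_square field_simps)
    finally show ?thesis by simp
  qed
  ultimately show ?thesis using G_nonneg[of 0] by linarith
qed

end

section \<open>Weak convergence of directional derivatives\<close>

lemma integrable_bounded_finite_support:
  fixes g :: "'a \<Rightarrow> real"
  assumes [measurable]: "g \<in> borel_measurable M" "A \<in> sets M" and "emeasure M A < \<infinity>"
    and "AE z in M. \<bar>g z\<bar> \<le> C" and "AE z in M. z \<notin> A \<longrightarrow> g z = 0"
  shows "integrable M g"
proof (rule Bochner_Integration.integrable_bound)
  show "integrable M (\<lambda>z. C * indicator A z :: real)"
    using assms by simp
  show "AE z in M. norm (g z) \<le> norm (C * indicator A z :: real)"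
    using assms(4,5) by eventually_elim (auto simp: indicator_def)
qed simp

lemma integrable_mult_bounded:
  fixes g w :: "'a \<Rightarrow> real"
  assumes [measurable]: "g \<in> borel_measurable M" and w: "integrable M w" and "AE z in M. \<bar>g z\<bar> \<le> C"
  shows "integrable M (\<lambda>z. w z * g z)"
proof (rule Bochner_Integration.integrable_bound)
  show "integrable M (\<lambda>z. C * w z)" using w by simp
  show "AE z in M. norm (w z * g z) \<le> norm (C * w z)"
    using assms(3)
  proof eventually_elim
    case (elim z)
    have "\<bar>w z\<bar> * \<bar>g z\<bar> \<le> \<bar>w z\<bar> * \<bar>C\<bar>" using elim by (intro mult_left_mono) auto
    then show ?case by (simp add: abs_mult mult.commute)
  qed
qed (use w in measurable)

lemma abs_integral_mult_le:
  fixes g w :: "'a \<Rightarrow> real"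
  assumes [measurable]: "g \<in> borel_measurable M" and w: "integrable M w" and b: "AE z in M. \<bar>g z\<bar> \<le> C"
  shows "\<bar>LINT z|M. w z * g z\<bar> \<le> C * (LINT z|M. \<bar>w z\<bar>)"
proof -
  have "\<bar>LINT z|M. w z * g z\<bar> \<le> (LINT z|M. \<bar>w z * g z\<bar>)"
    by (rule integral_abs_bound)
  also have "\<dots> \<le> (LINT z|M. C * \<bar>w z\<bar>)"
  proof (intro integral_mono_AE integrable_abs integrable_mult_bounded[OF _ w b] integrable_mult_right)
    show "AE z in M. \<bar>w z * g z\<bar> \<le> C * \<bar>w z\<bar>"
      using b by eventually_elim (simp add: abs_mult mult.commute mult_right_mono)
  qed (use w in auto)
  finally show ?thesis by simp
qed

text \<open>Outer regularity passes from open sets to Borel sets, so no monotone class argument is needed.\<close>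

lemma weak_limit_from_open_sets:
  fixes d :: "nat \<Rightarrow> 'a::euclidean_space \<Rightarrow> real"
  assumes d[measurable]: "\<And>n. d n \<in> borel_measurable lborel"
    and bound: "\<And>n. AE z in lborel. \<bar>d n z\<bar> \<le> L" and L: "0 \<le> L"
    and opn: "\<And>B. open B \<Longrightarrow> emeasure lborel B < \<infinity> \<Longrightarrow> (\<lambda>n. LINT z|lborel. indicator B z * d n z) \<longlonglongrightarrow> 0"
    and w: "integrable lborel w"
  shows "(\<lambda>n. LINT z|lborel. w z * d n z) \<longlonglongrightarrow> 0"
  using w
proof (induction w rule: integrable_induct)
  case (base A c)
  then have A[measurable]: "A \<in> sets borel" by simp
  have "(\<lambda>n. LINT z|lborel. indicator A z * d n z) \<longlonglongrightarrow> 0"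
  proof (rule LIMSEQ_I)
    fix r :: real assume "0 < r"
    \<comment> \<open>The part of the integral over \<open>U - A\<close> is at most
      \<open>L * e\<close>, hence at most \<open>r / 2\<close>; the \<open>+ 1\<close> covers the
      case \<open>L = 0\<close>.\<close>
    define e where "e = r / (2 * (L + 1))"
    have e: "0 < e" using \<open>0 < r\<close> L by (simp add: e_def)
    obtain U where U: "open U" "A \<subseteq> U" "emeasure lborel (U - A) < e"
      using outer_regular_lborel[OF A e] by auto
    have U'[measurable]: "U \<in> sets borel" using U by simp
    have fUA: "emeasure lborel (U - A) < \<infinity>" using U(3) by (auto intro: less_trans)
    have "emeasure lborel U \<le> emeasure lborel A + emeasure lborel (U - A)"
      using emeasure_subadditive[of A lborel "U - A"] U(2) by (simp add: Un_absorb1)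
    also have "\<dots> < \<infinity>" using base fUA by simp
    finally have fU: "emeasure lborel U < \<infinity>" .
    have iU: "integrable lborel (indicator U :: _ \<Rightarrow> real)" and iUA: "integrable lborel (indicator (U - A) :: _ \<Rightarrow> real)"
      using fU fUA by auto
    have small: "\<bar>LINT z|lborel. indicator (U - A) z * d n z\<bar> \<le> r / 2" for n
    proof -
      have "\<bar>LINT z|lborel. indicator (U - A) z * d n z\<bar> \<le> L * (LINT z|lborel. \<bar>indicator (U - A) z\<bar>)"
        by (rule abs_integral_mult_le[OF _ iUA bound]) simp
      also have "(LINT z|lborel. \<bar>indicator (U - A) z\<bar>) = measure lborel (U - A)"
        by simp
      also have "L * measure lborel (U - A) \<le> L * e"
      proof (intro mult_left_mono L)
        have "ennreal (measure lborel (U - A)) < ennreal e"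
          using U(3) fUA by (simp add: emeasure_eq_ennreal_measure)
        then show "measure lborel (U - A) \<le> e" using e by (simp add: ennreal_less_iff)
      qed
      also have "\<dots> \<le> r / 2" using L \<open>0 < r\<close> by (simp add: e_def field_simps)
      finally show ?thesis .
    qed
    have "eventually (\<lambda>n. \<bar>LINT z|lborel. indicator U z * d n z\<bar> < r / 2) sequentially"
      using order_tendstoD(2)[OF tendsto_rabs[OF opn[OF U(1) fU]], of "r / 2"] \<open>0 < r\<close> by simp
    then show "\<exists>no. \<forall>n\<ge>no. norm ((LINT z|lborel. indicator A z * d n z) - 0) < r"
      unfolding eventually_sequentially
    proof (elim exE, intro exI allI impI)
      fix no n assume n: "\<forall>n\<ge>no. \<bar>LINT z|lborel. indicator U z * d n z\<bar> < r / 2" "no \<le> n"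
      have "(LINT z|lborel. indicator A z * d n z) =
        (LINT z|lborel. indicator U z * d n z - indicator (U - A) z * d n z)"
        using U(2) by (intro Bochner_Integration.integral_cong) (auto simp: indicator_def)
      also have "\<dots> = (LINT z|lborel. indicator U z * d n z) - (LINT z|lborel. indicator (U - A) z * d n z)"
        by (intro Bochner_Integration.integral_diff integrable_mult_bounded[OF _ iU bound]
            integrable_mult_bounded[OF _ iUA bound]) auto
      finally have eq: "(LINT z|lborel. indicator A z * d n z) = \<dots>" .
      have "\<bar>LINT z|lborel. indicator U z * d n z\<bar> < r / 2" using n by simp
      then show "norm ((LINT z|lborel. indicator A z * d n z) - 0) < r"
        using small[of n] unfolding eq real_norm_def by linarith
    qed
  qed
  from tendsto_mult_left[OF this, of c] show ?case
    by (simp add: mult_ac flip: integral_mult_right_zero)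
next
  case (add f g)
  have "(LINT z|lborel. (f z + g z) * d n z) = (LINT z|lborel. f z * d n z) + (LINT z|lborel. g z * d n z)" for n
    unfolding distrib_right
    by (intro Bochner_Integration.integral_add integrable_mult_bounded[OF _ _ bound] add) auto
  with tendsto_add[OF add.IH] show ?case by simp
next
  case (lim f s)
  have m[measurable]: "f \<in> borel_measurable lborel" "\<And>i. s i \<in> borel_measurable lborel"
    using lim by auto
  have "(\<lambda>i. LINT z|lborel. \<bar>f z - s i z\<bar>) \<longlonglongrightarrow> (LINT z|(lborel :: 'a measure). (0 :: real))"
  proof (rule integral_dominated_convergence[where w="\<lambda>z. 3 * \<bar>f z\<bar>"])
    show "integrable lborel (\<lambda>z. 3 * \<bar>f z\<bar>)" using lim by simp
    show "AE z in lborel. (\<lambda>i. \<bar>f z - s i z\<bar>) \<longlonglongrightarrow> 0"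
    proof (rule AE_I2)
      fix z :: 'a
      have "(\<lambda>i. s i z) \<longlonglongrightarrow> f z" using lim by simp
      then have "(\<lambda>i. \<bar>f z - s i z\<bar>) \<longlonglongrightarrow> \<bar>f z - f z\<bar>" by (intro tendsto_intros)
      then show "(\<lambda>i. \<bar>f z - s i z\<bar>) \<longlonglongrightarrow> 0" by simp
    qed
    show "AE z in lborel. norm \<bar>f z - s i z\<bar> \<le> 3 * \<bar>f z\<bar>" for i
    proof (rule AE_I2)
      fix z :: 'a
      have "\<bar>s i z\<bar> \<le> 2 * \<bar>f z\<bar>" using lim.hyps(3)[of z i] by simp
      then show "norm \<bar>f z - s i z\<bar> \<le> 3 * \<bar>f z\<bar>" by simp
    qed
  qed simp_all
  then have lim0: "(\<lambda>i. L * (LINT z|lborel. \<bar>f z - s i z\<bar>)) \<longlonglongrightarrow> L * 0"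
    by (intro tendsto_mult_left) simp
  show ?case
  proof (rule LIMSEQ_I)
    fix r :: real assume "0 < r"
    obtain i where i: "L * (LINT z|lborel. \<bar>f z - s i z\<bar>) < r / 2"
      using order_tendstoD(2)[OF lim0, of "r / 2"] \<open>0 < r\<close> by (auto simp: eventually_sequentially)
    have "eventually (\<lambda>n. \<bar>LINT z|lborel. s i z * d n z\<bar> < r / 2) sequentially"
      using order_tendstoD(2)[OF tendsto_rabs[OF lim.IH[of i]], of "r / 2"] \<open>0 < r\<close> by simp
    then show "\<exists>no. \<forall>n\<ge>no. norm ((LINT z|lborel. f z * d n z) - 0) < r"
      unfolding eventually_sequentially
    proof (elim exE, intro exI allI impI)
      fix no n assume n: "\<forall>n\<ge>no. \<bar>LINT z|lborel. s i z * d n z\<bar> < r / 2" "no \<le> n"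
      have "(LINT z|lborel. (f z - s i z) * d n z) = (LINT z|lborel. f z * d n z) - (LINT z|lborel. s i z * d n z)"
        unfolding left_diff_distrib
        by (intro Bochner_Integration.integral_diff integrable_mult_bounded[OF _ _ bound] lim) auto
      moreover have "\<bar>LINT z|lborel. (f z - s i z) * d n z\<bar> \<le> L * (LINT z|lborel. \<bar>f z - s i z\<bar>)"
        by (intro abs_integral_mult_le[OF _ _ bound] Bochner_Integration.integrable_diff lim) simp
      moreover have "\<bar>LINT z|lborel. s i z * d n z\<bar> < r / 2"
        using n by simp
      ultimately have "\<bar>LINT z|lborel. f z * d n z\<bar> < r" using i by linarith
      then show "norm ((LINT z|lborel. f z * d n z) - 0) < r" by simp
    qed
  qed
qed

section \<open>Translations of open sets and difference quotients\<close>

lemma lborel_integral_translate: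
  fixes f :: "'a::euclidean_space \<Rightarrow> real"
  assumes [measurable]: "f \<in> borel_measurable borel"
  shows "(LINT z|lborel. f (z + c)) = (LINT z|lborel. f z)"
proof -
  have "(LINT z|lborel. f z) = (LINT z|distr lborel borel ((+) c). f z)"
    by (simp add: lborel_distr_plus)
  also have "\<dots> = (LINT z|lborel. f (c + z))"
    by (subst integral_distr) auto
  finally show ?thesis by (simp add: add.commute)
qed

text \<open>Since a translate has the same measure, the symmetric difference has twice the measure
  of the part of \<open>B\<close> that leaves its translate. Each point of the open set
  \<open>B\<close> stays in it under small shifts, so that part tends to 0 by dominated
  convergence.\<close>

lemma open_set_translation_continuous:
  fixes B :: "'a::euclidean_space set" and \<epsilon> :: real
  assumes B: "open B" and fin: "emeasure lborel B < \<infinity>" and "0 < \<epsilon>"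
  obtains \<delta> where "0 < \<delta>"
    "\<And>s. \<bar>s\<bar> < \<delta> \<Longrightarrow> (LINT z|lborel. \<bar>indicator B (z - s *\<^sub>R e) - indicator B z :: real\<bar>) < \<epsilon>"
proof -
  have [measurable]: "B \<in> sets borel" using B by simp
  define I where "I s = (LINT z|lborel. \<bar>indicator B (z - s *\<^sub>R e) - indicator B z :: real\<bar>)" for s
  have iB: "integrable lborel (indicator B :: 'a \<Rightarrow> real)" using fin by simp
  have iBs: "integrable lborel (\<lambda>z. indicator B (z - c) :: real)" for c
  proof -
    have "integrable (distr lborel borel ((+) (- c))) (indicator B :: 'a \<Rightarrow> real)"
      using iB by (simp add: lborel_distr_plus)
    then show ?thesis by (subst (asm) integrable_distr_eq) auto
  qed
  have I: "I s = 2 * (LINT z|lborel. indicator B z - indicator B z * indicator B (z - s *\<^sub>R e))" for s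
  proof -
    have i: "integrable lborel (\<lambda>z. indicator B z * indicator B (z - s *\<^sub>R e) :: real)"
      by (rule integrable_mult_bounded[OF _ iB, where C=1]) (auto simp: indicator_def)
    \<comment> \<open>For numbers p, q in {0, 1} the distance |p - q| equals (p - q) + 2 (q - q p);
      the first bracket integrates to zero by translation invariance.\<close>
    have "I s = (LINT z|lborel. (indicator B (z - s *\<^sub>R e) - indicator B z)
        + 2 * (indicator B z - indicator B z * indicator B (z - s *\<^sub>R e)))"
      unfolding I_def by (intro Bochner_Integration.integral_cong) (auto simp: indicator_def)
    also have "\<dots> = ((LINT z|lborel. indicator B (z - s *\<^sub>R e)) - (LINT z|lborel. indicator B z))
        + 2 * (LINT z|lborel. indicator B z - indicator B z * indicator B (z - s *\<^sub>R e))"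
      using i iB iBs by simp
    also have "(LINT z|lborel. indicator B (z - s *\<^sub>R e) :: real) = (LINT z|lborel. indicator B z)"
      using lborel_integral_translate[of "indicator B" "- s *\<^sub>R e"] by simp
    finally show ?thesis by simp
  qed
  have "(I \<longlongrightarrow> 0) (at 0)"
    unfolding tendsto_at_iff_sequentially
  proof (intro allI impI, unfold comp_def)
    fix X :: "nat \<Rightarrow> real" assume X: "\<forall>i. X i \<in> UNIV - {0}" "X \<longlonglongrightarrow> 0"
    have "(\<lambda>i. LINT z|lborel. indicator B z - indicator B z * indicator B (z - X i *\<^sub>R e) :: real) \<longlonglongrightarrow> (LINT z|(lborel :: 'a measure). 0)"
    proof (rule integral_dominated_convergence[OF _ _ iB])
      show "AE z in lborel. (\<lambda>i. indicator B z - indicator B z * indicator B (z - X i *\<^sub>R e) :: real) \<longlonglongrightarrow> 0"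
      proof (rule AE_I2)
        fix z
        show "(\<lambda>i. indicator B z - indicator B z * indicator B (z - X i *\<^sub>R e) :: real) \<longlonglongrightarrow> 0"
        proof (cases "z \<in> B")
          case True
          have "(\<lambda>i. z - X i *\<^sub>R e) \<longlonglongrightarrow> z - 0 *\<^sub>R e" by (intro tendsto_intros X)
          then have "eventually (\<lambda>i. z - X i *\<^sub>R e \<in> B) sequentially"
            using B True by (intro topological_tendstoD) auto
          then show ?thesis
            using True by (intro tendsto_eventually) (auto elim: eventually_mono)
        qed simp
      qed
    qed (auto simp: indicator_def)
    then have "(\<lambda>i. 2 * (LINT z|lborel. indicator B z - indicator B z * indicator B (z - X i *\<^sub>R e) :: real)) \<longlonglongrightarrow> 2 * 0"
      by (intro tendsto_mult_left) simp
    then show "(\<lambda>i. I (X i)) \<longlonglongrightarrow> 0" by (simp add: I)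
  qed
  from order_tendstoD(2)[OF this \<open>0 < \<epsilon>\<close>]
  obtain \<delta> where "0 < \<delta>" "\<And>s. s \<noteq> 0 \<Longrightarrow> \<bar>s\<bar> < \<delta> \<Longrightarrow> I s < \<epsilon>"
    by (auto simp: eventually_at)
  moreover have "I 0 < \<epsilon>" using \<open>0 < \<epsilon>\<close> by (simp add: I_def)
  ultimately have "I s < \<epsilon>" if "\<bar>s\<bar> < \<delta>" for s using that by (cases "s = 0") auto
  with \<open>0 < \<delta>\<close> show ?thesis by (intro that[of \<delta>]) (auto simp: I_def)
qed

definition diff_quot :: "real \<Rightarrow> 'a::real_vector \<Rightarrow> ('a \<Rightarrow> real) \<Rightarrow> 'a \<Rightarrow> real" where
  "diff_quot h e f z = (f (z + h *\<^sub>R e) - f z) / h"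

lemma borel_measurable_diff_quot [measurable]:
  fixes e :: "'a::euclidean_space"
  assumes [measurable]: "f \<in> borel_measurable borel"
  shows "diff_quot h e f \<in> borel_measurable borel"
  unfolding diff_quot_def[abs_def] by measurable

lemma diff_quot_bound:
  assumes "\<And>z s. 0 \<le> s \<Longrightarrow> \<bar>f (z + s *\<^sub>R e) - f z\<bar> \<le> L * s" and "0 < h"
  shows "\<bar>diff_quot h e f z\<bar> \<le> L"
  using assms(1)[of h z] assms(2) by (simp add: diff_quot_def abs_divide field_simps)

text \<open>This compares two step sizes without any differentiability: the coarse quotient is an
  average of translates of the fine one.\<close>

lemma diff_quot_telescope:
  assumes "0 < h" "0 < k"
  shows "diff_quot h e f z = (\<Sum>j<k. diff_quot (h / real k) e f (z + (real j * (h / real k)) *\<^sub>R e)) / real k"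
proof -
  let ?g = "\<lambda>j. f (z + (real j * (h / real k)) *\<^sub>R e)"
  have "(\<Sum>j<k. ?g (Suc j) - ?g j) = ?g k - ?g 0"
    by (rule sum_lessThan_telescope)
  also have "\<dots> = h * diff_quot h e f z"
    using assms by (simp add: diff_quot_def)
  finally have "h * diff_quot h e f z = (\<Sum>j<k. ?g (Suc j) - ?g j)" by simp
  also have "\<dots> = (\<Sum>j<k. (h / real k) * diff_quot (h / real k) e f (z + (real j * (h / real k)) *\<^sub>R e))"
  proof (intro sum.cong refl)
    fix j
    have "z + (real (Suc j) * (h / real k)) *\<^sub>R e = (z + (real j * (h / real k)) *\<^sub>R e) + (h / real k) *\<^sub>R e"
      by (simp only: of_nat_Suc distrib_right scaleR_add_left mult_1 ac_simps)
    then show "?g (Suc j) - ?g j = (h / real k) * diff_quot (h / real k) e f (z + (real j * (h / real k)) *\<^sub>R e)"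
      using assms by (simp only: diff_quot_def) simp
  qed
  also have "\<dots> = (h / real k) * (\<Sum>j<k. diff_quot (h / real k) e f (z + (real j * (h / real k)) *\<^sub>R e))"
    by (simp add: sum_distrib_left)
  finally show ?thesis using assms by (simp add: field_simps)
qed

text \<open>After telescoping, each translation of the fine quotient is moved onto the indicator of
  \<open>B\<close>. All shifts are at most \<open>h\<close>, hence below \<open>\<delta>\<close>,
  and each costs at most \<open>L * \<epsilon>\<close>; so does their average. The bound does not
  involve \<open>k\<close>.\<close>

lemma diff_quot_integral_stable:
  fixes f :: "'a::euclidean_space \<Rightarrow> real"
  assumes f[measurable]: "f \<in> borel_measurable borel"
    and lip: "\<And>z s. 0 \<le> s \<Longrightarrow> \<bar>f (z + s *\<^sub>R e) - f z\<bar> \<le> L * s"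
    and B: "open B" "emeasure lborel B < \<infinity>"
    and \<delta>: "\<And>s. \<bar>s\<bar> < \<delta> \<Longrightarrow> (LINT z|lborel. \<bar>indicator B (z - s *\<^sub>R e) - indicator B z :: real\<bar>) < \<epsilon>"
    and h: "0 < h" "h < \<delta>" and k: "0 < k"
  shows "\<bar>(LINT z|lborel. indicator B z * diff_quot h e f z) - (LINT z|lborel. indicator B z * diff_quot (h / real k) e f z)\<bar> \<le> L * \<epsilon>"
proof -
  define q where "q = diff_quot (h / real k) e f"
  define c where "c j = (real j * (h / real k)) *\<^sub>R e" for j :: nat
  have L: "0 \<le> L" using lip[of 1] by (smt (verit))
  have [measurable]: "B \<in> sets borel" using B by simp
  have qm[measurable]: "q \<in> borel_measurable borel" by (simp add: q_def)
  have qb: "\<bar>q z\<bar> \<le> L" for z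
    unfolding q_def by (rule diff_quot_bound[OF lip]) (use h k in auto)
  have iB: "integrable lborel (indicator B :: 'a \<Rightarrow> real)" using B by simp
  have iBs: "integrable lborel (\<lambda>z. indicator B (z - c) :: real)" for c
  proof -
    have "integrable (distr lborel borel ((+) (- c))) (indicator B :: 'a \<Rightarrow> real)"
      using iB by (simp add: lborel_distr_plus)
    then show ?thesis by (subst (asm) integrable_distr_eq) auto
  qed
  have iq: "integrable lborel (\<lambda>z. indicator B z * q (z + d))" for d
    by (rule integrable_mult_bounded[OF _ iB]) (auto intro: qb)
  have shift: "\<bar>(LINT z|lborel. indicator B z * q (z + c j)) - (LINT z|lborel. indicator B z * q z)\<bar> \<le> L * \<epsilon>"
    if "j < k" for j
  proof -
    have "(LINT z|lborel. indicator B z * q (z + c j)) = (LINT z|lborel. indicator B (z - c j) * q z)"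
      using lborel_integral_translate[of "\<lambda>z. indicator B (z - c j) * q z" "c j"] by simp
    also have "\<dots> - (LINT z|lborel. indicator B z * q z)
        = (LINT z|lborel. (indicator B (z - c j) - indicator B z) * q z)"
      unfolding left_diff_distrib
      by (subst Bochner_Integration.integral_diff)
        (auto intro!: integrable_mult_bounded[where C=L] iB iBs simp: qb)
    also have "\<bar>\<dots>\<bar> \<le> L * (LINT z|lborel. \<bar>indicator B (z - c j) - indicator B z\<bar>)"
      by (intro abs_integral_mult_le) (auto simp: qb intro!: Bochner_Integration.integrable_diff iB iBs)
    also have "\<dots> \<le> L * \<epsilon>"
    proof (intro mult_left_mono L less_imp_le)
      have "real j * (h / real k) \<le> h" using that h k
        by (simp add: field_simps)
      then show "(LINT z|lborel. \<bar>indicator B (z - c j) - indicator B z :: real\<bar>) < \<epsilon>"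
        unfolding c_def using h by (intro \<delta>) auto
    qed
    finally show ?thesis .
  qed
  have "(LINT z|lborel. indicator B z * diff_quot h e f z)
      = (LINT z|lborel. (\<Sum>j<k. indicator B z * q (z + c j)) / real k)"
    by (intro Bochner_Integration.integral_cong refl)
      (simp add: diff_quot_telescope[OF h(1) k] q_def c_def sum_distrib_left)
  also have "\<dots> = (\<Sum>j<k. LINT z|lborel. indicator B z * q (z + c j)) / real k"
    unfolding integral_divide_zero by (subst Bochner_Integration.integral_sum) (rule iq refl)+
  finally have "(LINT z|lborel. indicator B z * diff_quot h e f z) - (LINT z|lborel. indicator B z * q z)
      = (\<Sum>j<k. (LINT z|lborel. indicator B z * q (z + c j)) - (LINT z|lborel. indicator B z * q z)) / real k"
    using k by (simp add: sum_subtractf field_simps)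
  also have "\<bar>\<dots>\<bar> \<le> (\<Sum>j<k. L * \<epsilon>) / real k"
    unfolding abs_divide abs_of_nat
    by (intro divide_right_mono order_trans[OF sum_abs] sum_mono shift) auto
  also have "\<dots> = L * \<epsilon>" using k by simp
  finally show ?thesis by (simp add: q_def)
qed

lemma diff_quot_tendsto:
  assumes "((\<lambda>s. f (z + s *\<^sub>R e)) has_real_derivative g) (at 0)"
    and "h \<longlonglongrightarrow> 0" and "\<And>n. h n \<noteq> 0"
  shows "(\<lambda>n. diff_quot (h n) e f z) \<longlonglongrightarrow> g"
proof -
  have "((\<lambda>h. diff_quot h e f z) \<longlongrightarrow> g) (at 0)"
    using assms(1) by (simp add: DERIV_def diff_quot_def)
  moreover have "filterlim h (at 0) sequentially"
    using assms by (simp add: filterlim_at)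
  ultimately show ?thesis by (rule filterlim_compose)
qed

lemma directional_derivative_bound:
  fixes z e :: "'a::real_vector"
  assumes "((\<lambda>s. f (z + s *\<^sub>R e)) has_real_derivative g) (at 0)"
    and "\<And>z s. 0 \<le> s \<Longrightarrow> \<bar>f (z + s *\<^sub>R e) - f z\<bar> \<le> L * s"
  shows "\<bar>g\<bar> \<le> L"
proof -
  have "(\<lambda>n. \<bar>diff_quot (1 / real (Suc n)) e f z\<bar>) \<longlonglongrightarrow> \<bar>g\<bar>"
    by (intro tendsto_rabs diff_quot_tendsto[OF assms(1)] LIMSEQ_Suc lim_1_over_n) simp
  then show ?thesis
    by (rule LIMSEQ_le_const2) (auto intro!: diff_quot_bound assms(2))
qed

text \<open>The limit of infinitely fine steps in the stability estimate: the fine quotients are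
  bounded by \<open>L\<close> and converge almost everywhere on \<open>B\<close> to the derivative.
  No primitive along lines has to be recovered from the derivative.\<close>

lemma diff_quot_integral_near_derivative:
  fixes f :: "'a::euclidean_space \<Rightarrow> real"
  assumes f[measurable]: "f \<in> borel_measurable borel" and g[measurable]: "g \<in> borel_measurable borel"
    and lip: "\<And>z s. 0 \<le> s \<Longrightarrow> \<bar>f (z + s *\<^sub>R e) - f z\<bar> \<le> L * s"
    and der: "AE z in lborel. z \<in> B \<longrightarrow> ((\<lambda>s. f (z + s *\<^sub>R e)) has_real_derivative g z) (at 0)"
    and B: "open B" "emeasure lborel B < \<infinity>"
    and \<delta>: "\<And>s. \<bar>s\<bar> < \<delta> \<Longrightarrow> (LINT z|lborel. \<bar>indicator B (z - s *\<^sub>R e) - indicator B z :: real\<bar>) < \<epsilon>"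
    and h: "0 < h" "h < \<delta>"
  shows "\<bar>(LINT z|lborel. indicator B z * diff_quot h e f z) - (LINT z|lborel. indicator B z * g z)\<bar> \<le> L * \<epsilon>"
proof -
  have [measurable]: "B \<in> sets borel" using B by simp
  have iB: "integrable lborel (indicator B :: 'a \<Rightarrow> real)" using B by simp
  let ?h = "\<lambda>n. h / real (Suc n)"
  have h0: "?h \<longlonglongrightarrow> 0" by (intro LIMSEQ_Suc lim_const_over_n)
  have "(\<lambda>n. LINT z|lborel. indicator B z * diff_quot (?h n) e f z) \<longlonglongrightarrow> (LINT z|lborel. indicator B z * g z)"
  proof (rule integral_dominated_convergence[where w="\<lambda>z. L * indicator B z"])
    show "integrable lborel (\<lambda>z. L * indicator B z :: real)" using iB by simp
    show "AE z in lborel. (\<lambda>n. indicator B z * diff_quot (?h n) e f z) \<longlonglongrightarrow> indicator B z * g z"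
      using der
    proof eventually_elim
      case (elim z)
      then show ?case
        using h by (cases "z \<in> B") (auto intro!: diff_quot_tendsto h0 simp del: of_nat_Suc)
    qed
    show "AE z in lborel. norm (indicator B z * diff_quot (?h n) e f z) \<le> L * indicator B z" for n
      using h diff_quot_bound[OF lip] by (auto simp: indicator_def simp del: of_nat_Suc)
  qed simp_all
  then have "(\<lambda>n. \<bar>(LINT z|lborel. indicator B z * diff_quot h e f z) - (LINT z|lborel. indicator B z * diff_quot (?h n) e f z)\<bar>)
     \<longlonglongrightarrow> \<bar>(LINT z|lborel. indicator B z * diff_quot h e f z) - (LINT z|lborel. indicator B z * g z)\<bar>"
    by (intro tendsto_intros)
  then show ?thesis
    by (rule LIMSEQ_le_const2)
      (intro exI[of _ 0] allI impI diff_quot_integral_stable[OF f lip B \<delta> h], auto)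
qed

text \<open>The error between a difference quotient and the derivative, integrated over an open set, is
  controlled by the Lipschitz constant and the modulus of translation of the set alone, hence
  uniformly along the sequence.\<close>

lemma directional_derivatives_converge_weakly:
  fixes f :: "'a::euclidean_space \<Rightarrow> real"
  assumes f[measurable]: "f \<in> borel_measurable borel" "\<And>n. fn n \<in> borel_measurable borel"
    and g[measurable]: "g \<in> borel_measurable borel" "\<And>n. gn n \<in> borel_measurable borel"
    and lip: "\<And>z s. 0 \<le> s \<Longrightarrow> \<bar>f (z + s *\<^sub>R e) - f z\<bar> \<le> L * s"
      "\<And>n z s. 0 \<le> s \<Longrightarrow> \<bar>fn n (z + s *\<^sub>R e) - fn n z\<bar> \<le> L * s"
    and der: "AE z in lborel. z \<in> S \<longrightarrow> ((\<lambda>s. f (z + s *\<^sub>R e)) has_real_derivative g z) (at 0)"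
      "\<And>n. AE z in lborel. z \<in> S \<longrightarrow> ((\<lambda>s. fn n (z + s *\<^sub>R e)) has_real_derivative gn n z) (at 0)"
    and conv: "\<And>z. (\<lambda>n. fn n z) \<longlonglongrightarrow> f z"
    and S: "open S" "emeasure lborel S < \<infinity>"
    and w: "integrable lborel w"
  shows "(\<lambda>n. LINT z|lborel. w z * (indicator S z * gn n z)) \<longlonglongrightarrow> (LINT z|lborel. w z * (indicator S z * g z))"
proof -
  have L: "0 \<le> L" using lip(1)[of 1] by (smt (verit))
  have [measurable]: "S \<in> sets borel" using S by simp
  have bg: "AE z in lborel. \<bar>indicator S z * g z\<bar> \<le> L"
    using der(1) by eventually_elim (use L in \<open>auto simp: indicator_def intro: directional_derivative_bound[OF _ lip(1)]\<close>)
  have bgn: "AE z in lborel. \<bar>indicator S z * gn n z\<bar> \<le> L" for n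
    using der(2)[of n] by eventually_elim (use L in \<open>auto simp: indicator_def intro: directional_derivative_bound[OF _ lip(2)]\<close>)
  define d where "d n z = indicator S z * gn n z - indicator S z * g z" for n z
  have dm[measurable]: "d n \<in> borel_measurable lborel" for n
    unfolding d_def[abs_def] by measurable
  have "(\<lambda>n. LINT z|lborel. w z * d n z) \<longlonglongrightarrow> 0"
  proof (rule weak_limit_from_open_sets[where L="2 * L", OF dm _ _ _ w])
    show "AE z in lborel. \<bar>d n z\<bar> \<le> 2 * L" for n
      using bg bgn[of n] by eventually_elim (auto simp: d_def)
    show "0 \<le> 2 * L" using L by simp
    fix B :: "'a set" assume B: "open B" "emeasure lborel B < \<infinity>"
    have [measurable]: "B \<in> sets borel" using B by simp
    \<comment> \<open>Derivatives are known only inside \<open>S\<close>, and the estimates for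
      quotients need an open set; the intersection provides both.\<close>
    define C where "C = B \<inter> S"
    have C: "open C" "emeasure lborel C < \<infinity>"
      using B S emeasure_mono[of C B lborel] by (auto simp: C_def intro: le_less_trans)
    have [measurable]: "C \<in> sets borel" using C by simp
    have iC: "integrable lborel (indicator C :: 'a \<Rightarrow> real)" using C by simp
    have derC: "AE z in lborel. z \<in> C \<longrightarrow> ((\<lambda>s. f (z + s *\<^sub>R e)) has_real_derivative g z) (at 0)"
      using der(1) by eventually_elim (auto simp: C_def)
    have derCn: "AE z in lborel. z \<in> C \<longrightarrow> ((\<lambda>s. fn n (z + s *\<^sub>R e)) has_real_derivative gn n z) (at 0)" for n
      using der(2)[of n] by eventually_elim (auto simp: C_def)
    have eq: "(LINT z|lborel. indicator B z * d n z) = (LINT z|lborel. indicator C z * gn n z) - (LINT z|lborel. indicator C z * g z)" for n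
    proof -
      have "(LINT z|lborel. indicator B z * d n z) = (LINT z|lborel. indicator C z * (indicator S z * gn n z) - indicator C z * (indicator S z * g z))"
        by (intro Bochner_Integration.integral_cong) (auto simp: d_def C_def indicator_def)
      also have "\<dots> = (LINT z|lborel. indicator C z * (indicator S z * gn n z)) - (LINT z|lborel. indicator C z * (indicator S z * g z))"
        by (intro Bochner_Integration.integral_diff integrable_mult_bounded[OF _ iC bg] integrable_mult_bounded[OF _ iC bgn]) auto
      also have "\<dots> = (LINT z|lborel. indicator C z * gn n z) - (LINT z|lborel. indicator C z * g z)"
        by (intro arg_cong2[where f="(-)"] Bochner_Integration.integral_cong) (auto simp: C_def indicator_def)
      finally show ?thesis .
    qed
    show "(\<lambda>n. LINT z|lborel. indicator B z * d n z) \<longlonglongrightarrow> 0"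
    proof (rule LIMSEQ_I)
      fix r :: real assume "0 < r"
      \<comment> \<open>Three errors are added: quotient against derivative for \<open>f\<close> and
        for \<open>fn n\<close>, at most \<open>r / 4\<close> each, and less than
        \<open>r / 2\<close> between the quotients of \<open>fn n\<close> and \<open>f\<close>. The
        step \<open>h\<close> is fixed before \<open>n\<close> is sent to infinity, so pointwise
        convergence of \<open>fn\<close> is enough for the last one.\<close>
      define \<epsilon> where "\<epsilon> = r / (4 * (L + 1))"
      have \<epsilon>: "0 < \<epsilon>" "L * \<epsilon> \<le> r / 4" using \<open>0 < r\<close> L by (auto simp: \<epsilon>_def field_simps)
      obtain \<delta> where \<delta>: "0 < \<delta>"
        "\<And>s. \<bar>s\<bar> < \<delta> \<Longrightarrow> (LINT z|lborel. \<bar>indicator C (z - s *\<^sub>R e) - indicator C z :: real\<bar>) < \<epsilon>"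
        using open_set_translation_continuous[OF C \<epsilon>(1), of e] by blast
      define h where "h = \<delta> / 2"
      have h: "0 < h" "h < \<delta>" using \<delta> by (auto simp: h_def)
      have "(\<lambda>n. LINT z|lborel. indicator C z * diff_quot h e (fn n) z) \<longlonglongrightarrow> (LINT z|lborel. indicator C z * diff_quot h e f z)"
      proof (rule integral_dominated_convergence[where w="\<lambda>z. L * indicator C z"])
        show "integrable lborel (\<lambda>z. L * indicator C z :: real)" using iC by simp
        show "AE z in lborel. (\<lambda>n. indicator C z * diff_quot h e (fn n) z) \<longlonglongrightarrow> indicator C z * diff_quot h e f z"
          unfolding diff_quot_def using h by (auto intro!: AE_I2 tendsto_intros conv)
        show "AE z in lborel. norm (indicator C z * diff_quot h e (fn n) z) \<le> L * indicator C z" for n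
          using h diff_quot_bound[of "fn n" e L h, OF lip(2)] by (auto simp: indicator_def)
      qed simp_all
      then have "(\<lambda>n. \<bar>(LINT z|lborel. indicator C z * diff_quot h e (fn n) z) - (LINT z|lborel. indicator C z * diff_quot h e f z)\<bar>)
          \<longlonglongrightarrow> \<bar>(LINT z|lborel. indicator C z * diff_quot h e f z) - (LINT z|lborel. indicator C z * diff_quot h e f z)\<bar>"
        by (intro tendsto_intros)
      then have "eventually (\<lambda>n. \<bar>(LINT z|lborel. indicator C z * diff_quot h e (fn n) z) - (LINT z|lborel. indicator C z * diff_quot h e f z)\<bar> < r / 2) sequentially"
        using \<open>0 < r\<close> by (intro order_tendstoD(2)) auto
      then have "eventually (\<lambda>n. norm ((LINT z|lborel. indicator B z * d n z) - 0) < r) sequentially"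
      proof eventually_elim
        case (elim n)
        have "\<bar>(LINT z|lborel. indicator C z * diff_quot h e f z) - (LINT z|lborel. indicator C z * g z)\<bar> \<le> L * \<epsilon>"
          by (rule diff_quot_integral_near_derivative[OF f(1) g(1) lip(1) derC C \<delta>(2) h])
        moreover have "\<bar>(LINT z|lborel. indicator C z * diff_quot h e (fn n) z) - (LINT z|lborel. indicator C z * gn n z)\<bar> \<le> L * \<epsilon>"
          by (rule diff_quot_integral_near_derivative[OF f(2) g(2) lip(2) derCn C \<delta>(2) h])
        ultimately show ?case
          using elim \<epsilon>(2) unfolding eq real_norm_def by linarith
      qed
      then show "\<exists>no. \<forall>n\<ge>no. norm ((LINT z|lborel. indicator B z * d n z) - 0) < r"
        by (simp add: eventually_sequentially)
    qed
  qed
  moreover have "(LINT z|lborel. w z * d n z) = (LINT z|lborel. w z * (indicator S z * gn n z)) - (LINT z|lborel. w z * (indicator S z * g z))" for n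
    unfolding d_def right_diff_distrib
    by (intro Bochner_Integration.integral_diff integrable_mult_bounded[OF _ w bg] integrable_mult_bounded[OF _ w bgn]) auto
  ultimately show ?thesis by (simp add: LIM_zero_iff)
qed

section \<open>Mollification\<close>

lemma has_real_derivative_pos_part_square:
  "((\<lambda>u. (max 0 u)\<^sup>2) has_real_derivative 2 * max 0 u) (at (u::real))"
proof -
  consider "u < 0" | "u = 0" | "0 < u" by linarith
  then show ?thesis
  proof cases
    case 1
    have "((\<lambda>u. 0) has_real_derivative 2 * max 0 u) (at u)" using 1 by simp
    then show ?thesis
      by (rule has_field_derivative_transform_within_open[where S="{..<0}"]) (use 1 in auto)
  next
    case 2
    have "norm ((max 0 h)\<^sup>2 / h) \<le> \<bar>h\<bar>" for h :: real
      by (cases "h \<le> 0") (auto simp: power2_eq_square)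
    then have "eventually (\<lambda>h::real. norm ((max 0 h)\<^sup>2 / h) \<le> \<bar>h\<bar>) (at 0)"
      by (intro always_eventually allI)
    from Lim_null_comparison[OF this tendsto_rabs_zero[OF tendsto_ident_at]]
    have "((\<lambda>h. (max 0 h)\<^sup>2 / h) \<longlongrightarrow> 0) (at (0::real))" .
    then show ?thesis using 2 by (simp add: DERIV_def)
  next
    case 3
    have "((\<lambda>u. u\<^sup>2) has_real_derivative 2 * max 0 u) (at u)"
      using 3 by (auto intro!: derivative_eq_intros)
    then show ?thesis
      by (rule has_field_derivative_transform_within_open[where S="{0<..}"]) (use 3 in auto)
  qed
qed

text \<open>Once continuously differentiable is all that test functions have to be, so the square of
  a positive part suffices. The total mass is not normalised; the mollifier divides by it.\<close>

definition bump :: "real \<Rightarrow> 'a::euclidean_space \<Rightarrow> real" where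
  "bump \<delta> y = (max 0 (\<delta>\<^sup>2 - y \<bullet> y))\<^sup>2"

text \<open>The sign is opposite to that of the gradient of \<open>bump\<close>: this is the
  gradient in \<open>z\<close> of \<open>bump \<delta> (y - z)\<close>, the form in which it appears
  under the convolution integral.\<close>

definition bump_grad :: "real \<Rightarrow> 'a::euclidean_space \<Rightarrow> 'a" where
  "bump_grad \<delta> y = (4 * max 0 (\<delta>\<^sup>2 - y \<bullet> y)) *\<^sub>R y"

lemma bump_nonneg: "0 \<le> bump \<delta> y" by (simp add: bump_def)

lemma bump_eq_0: "bump \<delta> y = 0" and bump_grad_eq_0: "bump_grad \<delta> y = 0"
  if "0 < \<delta>" "\<delta> < norm y"
proof -
  have "\<delta>\<^sup>2 \<le> (norm y)\<^sup>2" using that by (intro power_mono) auto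
  then show "bump \<delta> y = 0" "bump_grad \<delta> y = 0"
    by (auto simp: bump_def bump_grad_def power2_norm_eq_inner)
qed

lemma bump_has_derivative:
  "((\<lambda>z. bump \<delta> (y - z)) has_derivative (\<lambda>h. bump_grad \<delta> (y - z) \<bullet> h)) (at z within S)"
proof -
  have "((\<lambda>z. \<delta>\<^sup>2 - (y - z) \<bullet> (y - z)) has_derivative (\<lambda>h. 2 * ((y - z) \<bullet> h))) (at z within S)"
    by (auto intro!: derivative_eq_intros simp: inner_commute)
  from has_derivative_compose[OF this has_real_derivative_pos_part_square[unfolded has_field_derivative_def]]
  show ?thesis
    by (simp add: bump_def bump_grad_def mult_ac)
qed

lemma continuous_on_bump [continuous_intros]:
  "continuous_on S g \<Longrightarrow> continuous_on S (\<lambda>x. bump \<delta> (g x))"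
  unfolding bump_def by (intro continuous_intros)

lemma continuous_on_bump_grad [continuous_intros]:
  "continuous_on S g \<Longrightarrow> continuous_on S (\<lambda>x. bump_grad \<delta> (g x))"
  unfolding bump_grad_def by (intro continuous_intros)

lemma borel_measurable_bump [measurable]: "bump \<delta> \<in> borel_measurable borel"
  by (intro borel_measurable_continuous_onI continuous_on_bump continuous_on_id)

lemma integrable_bump: "integrable lborel (bump \<delta> :: 'a::euclidean_space \<Rightarrow> real)" if "0 < \<delta>"
proof -
  have "integrable lborel (\<lambda>x::'a. indicator (cball 0 \<delta>) x *\<^sub>R bump \<delta> x)"
    by (intro borel_integrable_compact continuous_intros) auto
  moreover have "(\<lambda>x::'a. indicator (cball 0 \<delta>) x *\<^sub>R bump \<delta> x) = bump \<delta>"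
    using bump_eq_0[OF that] by (force simp: indicator_def)
  ultimately show ?thesis by simp
qed

lemma integral_bump_pos: "0 < (LINT y|lborel. bump \<delta> (y :: 'a::euclidean_space))" if "0 < \<delta>"
proof -
  define k where "k = (\<delta>\<^sup>2 - (\<delta> / 2)\<^sup>2)\<^sup>2"
  have k: "0 < k" using that by (simp add: k_def power2_eq_square)
  have fin: "emeasure lborel (cball (0::'a) (\<delta> / 2)) < \<infinity>"
    by (rule emeasure_lborel_cball_finite)
  have "0 < k * measure lborel (cball (0::'a) (\<delta> / 2))"
    using k that content_cball_pos[of "\<delta> / 2" "0::'a"] by simp
  also have "\<dots> = (LINT y|lborel. k * indicator (cball (0::'a) (\<delta> / 2)) y)"
    by simp
  also have "\<dots> \<le> (LINT y|lborel. bump \<delta> (y :: 'a))"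
  proof (intro integral_mono integrable_bump that)
    show "integrable lborel (\<lambda>y. k * indicator (cball (0::'a) (\<delta> / 2)) y)"
      using fin by simp
    fix y :: 'a
    have "k \<le> bump \<delta> y" if "norm y \<le> \<delta> / 2"
    proof -
      have "(norm y)\<^sup>2 \<le> (\<delta> / 2)\<^sup>2" using that by (intro power_mono) auto
      moreover have "(\<delta> / 2)\<^sup>2 \<le> \<delta>\<^sup>2" using \<open>0 < \<delta>\<close> by (intro power_mono) auto
      ultimately show ?thesis
        unfolding k_def bump_def dot_square_norm by (intro power_mono) auto
    qed
    then show "k * indicator (cball (0::'a) (\<delta> / 2)) y \<le> bump \<delta> y"
      using bump_nonneg[of \<delta> y] by (auto simp: indicator_def)
  qed
  finally show ?thesis .
qed

text \<open>The bridge between the Lebesgue integral over the whole space, which is used for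
  estimates, and the gauge integral over a box, for which the Leibniz rule is available.\<close>

lemma integral_local_support_eq:
  fixes q :: "'a::euclidean_space \<Rightarrow> 'b::euclidean_space"
  assumes "continuous_on UNIV q" and "\<And>y. y \<notin> cbox a b \<Longrightarrow> q y = 0"
  shows "(LINT y|lborel. q y) = integral (cbox a b) q" "integrable lborel q"
proof -
  have i: "integrable lborel (\<lambda>x. indicator (cbox a b) x *\<^sub>R q x)"
    using assms(1) by (intro borel_integrable_compact) (auto intro: continuous_on_subset)
  have eq: "(\<lambda>x. indicator (cbox a b) x *\<^sub>R q x) = q"
    using assms(2) by (force simp: indicator_def)
  show "integrable lborel q" using i by (simp add: eq)
  have "(LINT y:cbox a b|lborel. q y) = integral (cbox a b) q"
    using i by (intro set_borel_integral_eq_integral) (simp add: set_integrable_def)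
  then show "(LINT y|lborel. q y) = integral (cbox a b) q"
    by (simp add: set_lebesgue_integral_def eq)
qed

text \<open>Convolution with a normalised bump. An average of translates of \<open>f\<close> keeps
  its Lipschitz constant and its periods, vanishes where \<open>f\<close> vanishes nearby, and moves
  by at most \<open>L * \<delta>\<close>. These facts are read off the form with translated
  \<open>f\<close>; the derivative is taken in the form where \<open>z\<close> sits in the
  bump.\<close>

lemma lipschitz_mollifier:
  fixes f :: "'a::euclidean_space \<Rightarrow> real"
  assumes lip: "L-lipschitz_on UNIV f" and \<delta>: "0 < \<delta>"
  obtains g D where
    "\<And>z. (g has_derivative (\<lambda>h. D z \<bullet> h)) (at z)" "continuous_on UNIV D" "L-lipschitz_on UNIV g"
    "\<And>z. \<bar>g z - f z\<bar> \<le> L * \<delta>"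
    "\<And>c z. \<forall>z. f (z + c) = f z \<Longrightarrow> g (z + c) = g z"
    "\<And>z. \<forall>y. norm (y - z) \<le> \<delta> \<longrightarrow> f y = 0 \<Longrightarrow> g z = 0"
proof -
  define c where "c = (LINT y|lborel. bump \<delta> (y :: 'a))"
  have c: "0 < c" using integral_bump_pos[OF \<delta>] by (simp add: c_def)
  have ib: "integrable lborel (bump \<delta> :: 'a \<Rightarrow> real)" by (rule integrable_bump[OF \<delta>])
  have L: "0 \<le> L" using lip by (rule lipschitz_on_nonneg)
  have cf: "continuous_on S f" for S
    using lipschitz_on_continuous_on[OF lip] by (rule continuous_on_subset) simp
  have cfc[continuous_intros]: "continuous_on S (\<lambda>x. f (h x))" if "continuous_on S h" for S :: "'b::topological_space set" and h
    using continuous_on_compose2[OF cf that] by blast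
  have [measurable]: "f \<in> borel_measurable borel" by (intro borel_measurable_continuous_onI cf)
  have lipf: "\<bar>f x - f y\<bar> \<le> L * norm (x - y)" for x y
    using lipschitz_onD[OF lip, of x y] by (simp add: dist_norm)
  have i: "integrable lborel (\<lambda>y. f (z + y) * bump \<delta> y)" for z
  proof -
    have "bounded (cball (0::'a) \<delta>)" by simp
    then obtain a where a: "cball (0::'a) \<delta> \<subseteq> cbox (-a) a" using bounded_subset_cbox_symmetric by metis
    show ?thesis
    proof (rule integral_local_support_eq(2)[where a="-a" and b=a])
      show "continuous_on UNIV (\<lambda>y. f (z + y) * bump \<delta> y)" by (intro continuous_intros)
      show "f (z + y) * bump \<delta> y = 0" if "y \<notin> cbox (-a) a" for y
        using that a bump_eq_0[OF \<delta>, of y] by (cases "norm y \<le> \<delta>") auto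
    qed
  qed
  define g where "g z = (LINT y|lborel. f (z + y) * bump \<delta> y) / c" for z
  define D where "D z = (LINT y|lborel. f y *\<^sub>R bump_grad \<delta> (y - z)) /\<^sub>R c" for z
  \<comment> \<open>For all \<open>z\<close> in a unit ball the supports of the shifted bumps lie in
    one box, so differentiation under the integral takes place over a fixed compact domain.\<close>
  have box: "\<exists>a b. \<forall>z\<in>ball z0 1. \<forall>y. y \<notin> cbox a b \<longrightarrow> \<delta> < norm (y - z)" for z0 :: 'a
  proof -
    have "bounded (cball z0 (1 + \<delta>))" by simp
    then obtain a where a: "cball z0 (1 + \<delta>) \<subseteq> cbox (-a) a" using bounded_subset_cbox_symmetric by metis
    have "\<delta> < norm (y - z)" if "z \<in> ball z0 1" "y \<notin> cbox (-a) a" for z y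
    proof -
      have "1 + \<delta> < dist z0 y" using that(2) a by (auto simp: subset_iff not_le)
      also have "\<dots> \<le> dist z0 z + norm (y - z)" using dist_triangle[of z0 y z] by (simp add: dist_norm norm_minus_commute)
      finally show ?thesis using that(1) by simp
    qed
    then show ?thesis by blast
  qed
  have der: "(g has_derivative (\<lambda>h. D z0 \<bullet> h)) (at z0) \<and> isCont D z0" for z0 :: 'a
  proof -
    obtain a b where ab: "\<And>z y. z \<in> ball z0 1 \<Longrightarrow> y \<notin> cbox a b \<Longrightarrow> \<delta> < norm (y - z)" using box[of z0] by blast
    define I where "I z = integral (cbox a b) (\<lambda>y. f y * bump \<delta> (y - z))" for z
    have gI: "g z = I z / c" if "z \<in> ball z0 1" for z
    proof -
      have "(LINT y|lborel. f (z + y) * bump \<delta> y) = (LINT y|lborel. f (z + (y + - z)) * bump \<delta> (y + - z))"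
        by (rule lborel_integral_translate[symmetric]) measurable
      also have "\<dots> = (LINT y|lborel. f y * bump \<delta> (y - z))" by simp
      also have "\<dots> = I z"
        unfolding I_def
        by (rule integral_local_support_eq) (auto intro!: continuous_intros simp: bump_eq_0[OF \<delta> ab[OF that]])
      finally show ?thesis by (simp add: g_def)
    qed
    have DI: "D z = integral (cbox a b) (\<lambda>y. f y *\<^sub>R bump_grad \<delta> (y - z)) /\<^sub>R c" if "z \<in> ball z0 1" for z
      unfolding D_def
      by (subst integral_local_support_eq(1)[where a=a and b=b])
        (auto intro!: continuous_intros simp: bump_grad_eq_0[OF \<delta> ab[OF that]])
    let ?fx = "\<lambda>z y. blinfun_inner_right (f y *\<^sub>R bump_grad \<delta> (y - z))"
    have cont: "continuous_on (ball z0 1 \<times> cbox a b) (\<lambda>(z, y). f y *\<^sub>R bump_grad \<delta> (y - z))"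
      unfolding split_beta by (intro continuous_intros)
    have "(I has_derivative integral (cbox a b) (?fx z0)) (at z0 within ball z0 1)"
      unfolding I_def
    proof (rule leibniz_rule)
      show "((\<lambda>z. f y * bump \<delta> (y - z)) has_derivative blinfun_apply (?fx z y)) (at z within ball z0 1)" for z y
        by (rule has_derivative_eq_rhs[OF has_derivative_mult_right[OF bump_has_derivative]]) (simp add: fun_eq_iff)
      show "(\<lambda>y. f y * bump \<delta> (y - z)) integrable_on cbox a b" for z
        by (intro integrable_continuous continuous_intros)
      show "continuous_on (ball z0 1 \<times> cbox a b) (\<lambda>(z, y). ?fx z y)"
        using bounded_linear.continuous_on[OF bounded_linear_blinfun_inner_right cont]
        by (simp add: split_beta)
    qed auto
    moreover have "blinfun_apply (integral (cbox a b) (?fx z0)) h = (c *\<^sub>R D z0) \<bullet> h" for h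
    proof -
      have int: "(\<lambda>y. f y *\<^sub>R bump_grad \<delta> (y - z0)) integrable_on cbox a b"
        by (intro integrable_continuous continuous_intros)
      have "blinfun_apply (integral (cbox a b) (?fx z0)) h
          = integral (cbox a b) (\<lambda>y. (f y *\<^sub>R bump_grad \<delta> (y - z0)) \<bullet> h)"
        by (subst blinfun_apply_integral) (auto intro!: integrable_continuous continuous_intros
          bounded_linear.continuous_on[OF bounded_linear_blinfun_inner_right])
      also have "\<dots> = integral (cbox a b) (\<lambda>y. f y *\<^sub>R bump_grad \<delta> (y - z0)) \<bullet> h"
        using integral_linear[OF int bounded_linear_inner_left[of h]] by (simp add: o_def)
      finally show ?thesis using DI[of z0] c by simp
    qed
    then have "blinfun_apply (integral (cbox a b) (?fx z0)) = (\<lambda>h. (c *\<^sub>R D z0) \<bullet> h)" by (rule ext)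
    ultimately have "(I has_derivative (\<lambda>h. (c *\<^sub>R D z0) \<bullet> h)) (at z0)"
      by (simp add: at_within_open[of z0 "ball z0 1"])
    then have "((\<lambda>z. I z / c) has_derivative (\<lambda>h. D z0 \<bullet> h)) (at z0)"
      using c by (auto intro!: derivative_eq_intros)
    then have "(g has_derivative (\<lambda>h. D z0 \<bullet> h)) (at z0)"
      by (rule has_derivative_transform_within_open[OF _ open_ball, of _ _ _ _ z0 1]) (auto simp: gI)
    moreover
    have "continuous_on (ball z0 1) (\<lambda>z. integral (cbox a b) (\<lambda>y. f y *\<^sub>R bump_grad \<delta> (y - z)) /\<^sub>R c)"
      by (intro continuous_intros integral_continuous_on_param cont)
    then have "continuous_on (ball z0 1) D"
      by (rule continuous_on_eq) (simp add: DI)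
    then have "isCont D z0" by (simp add: continuous_on_eq_continuous_at)
    ultimately show ?thesis by simp
  qed
  \<comment> \<open>One estimate serves twice: with \<open>h\<close> a translate of \<open>f\<close>
    it gives the Lipschitz constant of \<open>g\<close>, with \<open>h\<close> the constant
    \<open>f z\<close> it gives the distance to \<open>f\<close>.\<close>
  have diff_le: "\<bar>g x - r\<bar> \<le> K" if "\<And>y. norm y \<le> \<delta> \<Longrightarrow> \<bar>f (x + y) - h y\<bar> \<le> K"
    and r: "r = (LINT y|lborel. h y * bump \<delta> y) / c" and ih: "integrable lborel (\<lambda>y. h y * bump \<delta> y)" for x r K h
  proof -
    have "(LINT y|lborel. f (x + y) * bump \<delta> y) - (LINT y|lborel. h y * bump \<delta> y)
       = (LINT y|lborel. f (x + y) * bump \<delta> y - h y * bump \<delta> y)"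
      by (rule Bochner_Integration.integral_diff[symmetric, OF i ih])
    also have "\<bar>\<dots>\<bar> \<le> (LINT y|lborel. \<bar>f (x + y) * bump \<delta> y - h y * bump \<delta> y\<bar>)"
      by (rule integral_abs_bound)
    also have "\<dots> \<le> (LINT y|lborel. K * bump \<delta> (y :: 'a))"
    proof (intro integral_mono integrable_abs Bochner_Integration.integrable_diff i ih integrable_mult_right ib)
      fix y
      show "\<bar>f (x + y) * bump \<delta> y - h y * bump \<delta> y\<bar> \<le> K * bump \<delta> y"
        using that(1)[of y] bump_nonneg[of \<delta> y] bump_eq_0[OF \<delta>, of y]
        by (cases "norm y \<le> \<delta>") (auto simp: abs_mult mult_right_mono simp flip: left_diff_distrib)
    qed
    also have "(LINT y|lborel. K * bump \<delta> (y :: 'a)) = K * c"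
      unfolding c_def by (rule integral_mult_right_zero)
    finally have le: "\<bar>(LINT y|lborel. f (x + y) * bump \<delta> y) - (LINT y|lborel. h y * bump \<delta> y)\<bar> \<le> K * c" .
    have eq: "g x - r = ((LINT y|lborel. f (x + y) * bump \<delta> y) - (LINT y|lborel. h y * bump \<delta> y)) / c"
      unfolding g_def r by (rule diff_divide_distrib[symmetric])
    show ?thesis
      unfolding eq abs_divide abs_of_pos[OF c] pos_divide_le_eq[OF c] by (rule le)
  qed
  have per: "g (z + d) = g z" if "\<forall>z. f (z + d) = f z" for d z
  proof -
    have "f (z + d + y) = f (z + y)" for y
      using spec[OF that, of "z + y"] by (simp add: ac_simps)
    then show ?thesis by (simp add: g_def)
  qed
  have van: "g z = 0" if "\<forall>y. norm (y - z) \<le> \<delta> \<longrightarrow> f y = 0" for z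
  proof -
    have "f (z + y) * bump \<delta> y = 0" for y
      using spec[OF that, of "z + y"] bump_eq_0[OF \<delta>, of y] by (cases "norm y \<le> \<delta>") auto
    then have "(LINT y|lborel. f (z + y) * bump \<delta> y) = 0" by (simp only: integral_zero)
    then show ?thesis by (simp add: g_def)
  qed
  show ?thesis
  proof (rule that[of g D])
    show "(g has_derivative (\<lambda>h. D z \<bullet> h)) (at z)" for z using der by blast
    show "continuous_on UNIV D" using der by (simp add: continuous_on_eq_continuous_at)
    show "L-lipschitz_on UNIV g"
    proof (rule lipschitz_onI[OF _ L])
      fix x y
      have "\<bar>f (x + z) - f (y + z)\<bar> \<le> L * norm (x - y)" for z
        using lipf[of "x + z" "y + z"] by simp
      then have "\<bar>g x - g y\<bar> \<le> L * norm (x - y)"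
        by (intro diff_le[of x "\<lambda>z. f (y + z)" "L * norm (x - y)" "g y", OF _ g_def i])
      then show "dist (g x) (g y) \<le> L * dist x y" by (simp add: dist_norm)
    qed
    show "\<bar>g z - f z\<bar> \<le> L * \<delta>" for z
    proof -
      have 1: "\<bar>f (z + y) - f z\<bar> \<le> L * \<delta>" if "norm y \<le> \<delta>" for y
        using lipf[of "z + y" z] mult_left_mono[OF that L] by simp
      have 2: "f z = (LINT y|lborel. f z * bump \<delta> (y :: 'a)) / c"
        using c by (simp add: c_def[symmetric])
      have 3: "integrable lborel (\<lambda>y::'a. f z * bump \<delta> y)"
        using ib by (rule integrable_mult_right)
      show ?thesis
        by (rule diff_le[of z "\<lambda>_. f z" "L * \<delta>" "f z", OF 1 2 3])
    qed
  qed (fact per van)+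
qed

section \<open>Lipschitz test functions\<close>

text \<open>The interior of the space-time cylinder. It differs from \<open>QT\<close> and
  \<open>QTbar\<close> by subsets of finitely many hyperplanes, so derivatives need only be known
  here, and it is open as the weak convergence of derivatives demands.\<close>

definition QO :: "real \<Rightarrow> (vec3 \<times> real) set" where
  "QO T = {z. (\<forall>i. 0 < fst z $ i \<and> fst z $ i < 2 * pi) \<and> 0 < snd z \<and> snd z < T}"

lemma open_QO: "open (QO T)"
proof -
  have "z \<in> QO T \<longleftrightarrow> z \<in> box 0 (\<chi> i. 2 * pi) \<times> {0<..<T}" for z
    by (cases z) (simp add: QO_def mem_box_cart)
  then have "QO T = box 0 (\<chi> i. 2 * pi) \<times> {0<..<T}" by blast
  then show ?thesis by (simp only: open_Times open_box open_greaterThanLessThan)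
qed

lemma Qcell_subset_cbox: "Qcell \<subseteq> cbox 0 (\<chi> i. 2 * pi)"
  by (auto simp: Qcell_def mem_box_cart less_imp_le)

lemma Qcell_borel [measurable]: "Qcell \<in> sets borel"
proof -
  have "{x \<in> space borel. \<forall>i. 0 \<le> x $ i \<and> x $ i < 2 * pi} \<in> sets (borel :: vec3 measure)"
    by measurable
  then show ?thesis by (simp add: Qcell_def)
qed

lemma emeasure_Qcell_finite: "emeasure lborel Qcell < \<infinity>"
  using emeasure_mono[OF Qcell_subset_cbox, of lborel] emeasure_lborel_cbox_finite
  by (auto intro: le_less_trans)

lemma Times_borel:
  assumes "A \<in> sets borel" "B \<in> sets borel"
  shows "A \<times> B \<in> sets (borel :: ('a::second_countable_topology \<times> 'b::second_countable_topology) measure)"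
  using pair_measureI[OF assms] unfolding borel_prod .

lemma QT_borel [measurable]: "QT T \<in> sets borel" and QTbar_borel [measurable]: "QTbar T \<in> sets borel"
  unfolding QT_def QTbar_def by (intro Times_borel; simp)+

lemma QT_subset_QTbar: "QT T \<subseteq> QTbar T"
  unfolding QT_def QTbar_def by (intro Sigma_mono order_refl subsetI) simp

lemma QO_subset_QT: "QO T \<subseteq> QT T"
proof
  fix z assume "z \<in> QO T"
  then have "fst z \<in> Qcell" "snd z \<in> {0..<T}"
    by (simp_all add: QO_def Qcell_def less_imp_le)
  then show "z \<in> QT T" by (cases z) (simp add: QT_def)
qed

lemma emeasure_QTbar_finite: "emeasure lborel (QTbar T) < \<infinity>"
proof -
  have "QTbar T \<subseteq> cbox (0, 0) ((\<chi> i. 2 * pi), T)"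
    using Qcell_subset_cbox by (auto simp: QTbar_def cbox_Pair_eq)
  then show ?thesis
    by (intro le_less_trans[OF emeasure_mono emeasure_lborel_cbox_finite]) auto
qed

lemma emeasure_QT_finite: "emeasure lborel (QT T) < \<infinity>"
  by (intro le_less_trans[OF emeasure_mono[OF QT_subset_QTbar] emeasure_QTbar_finite]) auto

lemma emeasure_QO_finite: "emeasure lborel (QO T) < \<infinity>"
  by (intro le_less_trans[OF emeasure_mono[OF QO_subset_QT] emeasure_QT_finite]) auto

lemma AE_hyperplane: "k \<noteq> 0 \<Longrightarrow> AE z in lborel. z \<bullet> k \<noteq> c" for k :: "'a::euclidean_space"
proof -
  assume "k \<noteq> 0"
  then have "negligible {x. k \<bullet> x = c}" by (intro negligible_hyperplane) simp
  then have "{x. k \<bullet> x = c} \<in> null_sets lebesgue" by (simp add: negligible_iff_null_sets)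
  moreover have "{x. k \<bullet> x = c} \<in> sets borel" by (intro borel_closed closed_hyperplane)
  ultimately have "{x. k \<bullet> x = c} \<in> null_sets lborel"
    by (simp add: null_sets_def)
  then show ?thesis by (rule AE_I') (auto simp: inner_commute)
qed

lemma AE_QTbar_QO: "AE z in lborel. z \<in> QTbar T \<longleftrightarrow> z \<in> QO T"
proof -
  have "AE z in lborel. \<forall>i\<in>(UNIV :: 3 set). z \<bullet> (axis i 1 :: vec3, 0 :: real) \<noteq> 0"
    by (rule AE_finite_allI) (auto intro!: AE_hyperplane simp: zero_prod_def axis_eq_0_iff)
  moreover have "AE z in lborel. z \<bullet> (0 :: vec3, 1 :: real) \<noteq> 0" "AE z in lborel. z \<bullet> (0 :: vec3, 1 :: real) \<noteq> T"
    by (auto intro!: AE_hyperplane simp: zero_prod_def)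
  ultimately show ?thesis
  proof eventually_elim
    case (elim z)
    have "fst z $ i = z \<bullet> (axis i 1, 0)" for i by (cases z) (simp add: inner_axis)
    then have x: "0 \<le> fst z $ i \<longleftrightarrow> 0 < fst z $ i" for i using elim(1) by (simp add: less_le)
    have "snd z = z \<bullet> (0, 1)" by (cases z) simp
    then have t: "0 \<le> snd z \<and> snd z \<le> T \<longleftrightarrow> 0 < snd z \<and> snd z < T" using elim(2,3) by linarith
    show ?case
      unfolding QTbar_def QO_def mem_Times_iff Qcell_def mem_Collect_eq atLeastAtMost_iff x t by (rule refl)
  qed
qed

lemma AE_QT_QO: "AE z in lborel. z \<in> QT T \<longleftrightarrow> z \<in> QO T"
  using AE_QTbar_QO by eventually_elim (use QT_subset_QTbar QO_subset_QT in blast)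

lemma AE_QTbar_QT: "AE z in lborel. z \<in> QTbar T \<longleftrightarrow> z \<in> QT T"
  using AE_QTbar_QO AE_QT_QO by eventually_elim blast

section \<open>Directional derivatives and the approximation of Lipschitz test functions\<close>

definition xdir :: "3 \<Rightarrow> vec3 \<times> real" where "xdir \<alpha> = (axis \<alpha> 1, 0)"
definition tdir :: "vec3 \<times> real" where "tdir = (0, 1)"

lemma norm_xdir: "norm (xdir \<alpha>) = 1" and norm_tdir: "norm tdir = 1"
  by (simp_all add: xdir_def tdir_def norm_Pair)

text \<open>A two-sided derivative along one line. Treating (x, t) as a single Euclidean variable
  puts space and time derivatives on the same footing.\<close>

definition has_dir_deriv :: "((vec3 \<times> real) \<Rightarrow> real) \<Rightarrow> (vec3 \<times> real) \<Rightarrow> (vec3 \<times> real) \<Rightarrow> real \<Rightarrow> bool" where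
  "has_dir_deriv f e z d \<longleftrightarrow> ((\<lambda>s. f (z + s *\<^sub>R e)) has_real_derivative d) (at 0)"

lemma has_dir_deriv_gradient:
  assumes "(f has_derivative (\<lambda>h. D \<bullet> h)) (at z)"
  shows "has_dir_deriv f e z (D \<bullet> e)"
proof -
  have "((\<lambda>s. z + s *\<^sub>R e) has_derivative (\<lambda>h. h *\<^sub>R e)) (at 0)"
    by (auto intro!: derivative_eq_intros)
  from has_derivative_compose[OF this, of f "\<lambda>h. D \<bullet> h"] assms
  show ?thesis by (simp add: has_dir_deriv_def has_field_derivative_def mult_commute_abs)
qed

lemma lipschitz_direction_bound:
  fixes f :: "'a::euclidean_space \<Rightarrow> real"
  assumes "L-lipschitz_on UNIV f" "norm e = 1" "0 \<le> s"
  shows "\<bar>f (z + s *\<^sub>R e) - f z\<bar> \<le> L * s"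
  using lipschitz_onD[OF assms(1), of "z + s *\<^sub>R e" z] assms(2,3) by (simp add: dist_norm)

lemma lipschitz_borel: "L-lipschitz_on UNIV f \<Longrightarrow> f \<in> borel_measurable borel"
  for f :: "'a::metric_space \<Rightarrow> 'b::metric_space"
  by (intro borel_measurable_continuous_onI lipschitz_on_continuous_on)

text \<open>Mollification in space and time together. The common Lipschitz constant is the essential
  part of the conclusion: without it the derivatives would not converge weakly.\<close>

lemma lipschitz_test_approximation:
  fixes \<psi> :: "(vec3 \<times> real) \<Rightarrow> real"
  assumes lip: "L-lipschitz_on UNIV \<psi>"
    and per: "\<And>z k. \<psi> (z + (2 * pi) *\<^sub>R xdir k) = \<psi> z"
    and \<tau>: "\<tau> < T" "\<And>x t. \<tau> \<le> t \<Longrightarrow> \<psi> (x, t) = 0"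
  obtains \<phi> D where
    "\<And>n. test_QT T (\<lambda>x t. \<phi> n (x, t)) (\<lambda>x t. D n (x, t) \<bullet> tdir) (\<lambda>x t. fst (D n (x, t)))"
    "\<And>n e z. has_dir_deriv (\<phi> n) e z (D n z \<bullet> e)"
    "\<And>n. continuous_on UNIV (D n)" "\<And>n. L-lipschitz_on UNIV (\<phi> n)" "\<And>z. (\<lambda>n. \<phi> n z) \<longlonglongrightarrow> \<psi> z"
proof -
  \<comment> \<open>Radii of at most half the gap between \<tau> and \<open>T\<close>: the mollified
    functions then still vanish from the midpoint of \<tau> and \<open>T\<close> onwards.\<close>
  define \<delta> where "\<delta> n = (T - \<tau>) / 2 / real (Suc n)" for n
  have \<delta>: "0 < \<delta> n" "\<delta> n \<le> (T - \<tau>) / 2" for n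
  proof -
    show "0 < \<delta> n" using \<tau>(1) by (simp add: \<delta>_def)
    have "(T - \<tau>) / 2 / real (Suc n) \<le> (T - \<tau>) / 2 / 1"
      using \<tau>(1) by (intro divide_left_mono) auto
    then show "\<delta> n \<le> (T - \<tau>) / 2" by (simp add: \<delta>_def)
  qed
  have \<delta>0: "\<delta> \<longlonglongrightarrow> 0" unfolding \<delta>_def by (intro LIMSEQ_Suc lim_const_over_n)
  define P where "P n p \<longleftrightarrow> (\<forall>z. (fst p has_derivative (\<lambda>h. snd p z \<bullet> h)) (at z)) \<and> continuous_on UNIV (snd p) \<and>
      L-lipschitz_on UNIV (fst p) \<and> (\<forall>z. \<bar>fst p z - \<psi> z\<bar> \<le> L * \<delta> n) \<and>
      (\<forall>c z. (\<forall>z. \<psi> (z + c) = \<psi> z) \<longrightarrow> fst p (z + c) = fst p z) \<and>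
      (\<forall>z. (\<forall>y. norm (y - z) \<le> \<delta> n \<longrightarrow> \<psi> y = 0) \<longrightarrow> fst p z = 0)" for n p
  have "\<exists>p. P n p" for n
  proof (rule lipschitz_mollifier[OF lip \<delta>(1)[of n]])
    fix g D
    assume gD: "\<And>z. (g has_derivative (\<lambda>h. D z \<bullet> h)) (at z)" "continuous_on UNIV D" "L-lipschitz_on UNIV g"
      "\<And>z. \<bar>g z - \<psi> z\<bar> \<le> L * \<delta> n" "\<And>c z. \<forall>z. \<psi> (z + c) = \<psi> z \<Longrightarrow> g (z + c) = g z"
      "\<And>z. \<forall>y. norm (y - z) \<le> \<delta> n \<longrightarrow> \<psi> y = 0 \<Longrightarrow> g z = 0"
    have "P n (g, D)"
      unfolding P_def fst_conv snd_conv
      by (intro conjI allI impI) (rule gD(1), rule gD(2), rule gD(3), rule gD(4), erule gD(5), erule gD(6))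
    then show "\<exists>p. P n p" by (rule exI)
  qed
  then obtain p where p: "\<And>n. P n (p n)" using choice[of P] by blast
  define \<phi> D where "\<phi> n = fst (p n)" and "D n = snd (p n)" for n
  have \<phi>: "\<And>n z. (\<phi> n has_derivative (\<lambda>h. D n z \<bullet> h)) (at z)"
    "\<And>n. continuous_on UNIV (D n)" "\<And>n. L-lipschitz_on UNIV (\<phi> n)" "\<And>n z. \<bar>\<phi> n z - \<psi> z\<bar> \<le> L * \<delta> n"
    "\<And>n c z. \<forall>z. \<psi> (z + c) = \<psi> z \<Longrightarrow> \<phi> n (z + c) = \<phi> n z"
    "\<And>n z. \<forall>y. norm (y - z) \<le> \<delta> n \<longrightarrow> \<psi> y = 0 \<Longrightarrow> \<phi> n z = 0"
    using p unfolding P_def \<phi>_def D_def by blast+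
  show ?thesis
  proof (rule that[of \<phi> D])
    fix n
    show "test_QT T (\<lambda>x t. \<phi> n (x, t)) (\<lambda>x t. D n (x, t) \<bullet> tdir) (\<lambda>x t. fst (D n (x, t)))"
      unfolding test_QT_def
    proof (intro conjI allI impI)
      show "periodic3 (\<lambda>x. \<phi> n (x, t))" for t
        using \<phi>(5)[of "(2 * pi) *\<^sub>R xdir k" n "(x, t)" for k x] per
        by (auto simp: periodic3_def xdir_def)
      show "((\<lambda>z. \<phi> n (fst z, snd z)) has_derivative (\<lambda>h. fst (D n (x, t)) \<bullet> fst h + snd h * (D n (x, t) \<bullet> tdir)))
          (at (x, t) within UNIV \<times> {0..<T})" for x t
        using has_derivative_at_withinI[OF \<phi>(1)[of n "(x, t)"]]
        by (simp add: inner_prod_def tdir_def mult.commute)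
      show "continuous_on (UNIV \<times> {0..<T}) (\<lambda>z. D n (fst z, snd z) \<bullet> tdir)"
        "continuous_on (UNIV \<times> {0..<T}) (\<lambda>z. fst (D n (fst z, snd z)))"
        using continuous_on_subset[OF \<phi>(2)[of n], of "UNIV \<times> {0..<T}"] by (auto intro!: continuous_intros)
      show "\<exists>\<tau><T. \<forall>x t. \<tau> \<le> t \<and> t < T \<longrightarrow> \<phi> n (x, t) = 0"
      proof (intro exI conjI allI impI)
        show "(\<tau> + T) / 2 < T" using \<tau>(1) by simp
        fix x t assume t: "(\<tau> + T) / 2 \<le> t \<and> t < T"
        show "\<phi> n (x, t) = 0"
        proof (rule \<phi>(6), intro allI impI)
          fix y :: "vec3 \<times> real" assume "norm (y - (x, t)) \<le> \<delta> n"
          then have "\<bar>snd y - t\<bar> \<le> (T - \<tau>) / 2"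
            using norm_snd_le[of "snd y - t" "fst y - x"] \<delta>(2)[of n] by (cases y) simp
          then have "t - snd y \<le> (T - \<tau>) / 2" by linarith
          moreover have "(\<tau> + T) / 2 \<le> t" using t by simp
          ultimately have "\<tau> \<le> snd y" by argo
          then show "\<psi> y = 0" using \<tau>(2)[of "snd y" "fst y"] by simp
        qed
      qed
    qed
    show "has_dir_deriv (\<phi> n) e z (D n z \<bullet> e)" for e z
      by (rule has_dir_deriv_gradient[OF \<phi>(1)])
    show "continuous_on UNIV (D n)" "L-lipschitz_on UNIV (\<phi> n)" by (rule \<phi>)+
  next
    fix z
    have "(\<lambda>n. L * \<delta> n) \<longlonglongrightarrow> 0" using tendsto_mult_left[OF \<delta>0, of L] by simp
    then have "(\<lambda>n. \<phi> n z - \<psi> z) \<longlonglongrightarrow> 0"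
      by (rule Lim_null_comparison[OF always_eventually, rotated]) (simp add: \<phi>(4))
    then show "(\<lambda>n. \<phi> n z) \<longlonglongrightarrow> \<psi> z" by (simp add: LIM_zero_iff)
  qed
qed

lemma set_integral_QT_as_QO:
  fixes w g :: "vec3 \<times> real \<Rightarrow> real"
  assumes w: "set_integrable lborel (QT T) w" and [measurable]: "g \<in> borel_measurable borel"
  shows "(LINT z:QT T|lborel. w z * g z) = (LINT z|lborel. (indicator (QT T) z * w z) * (indicator (QO T) z * g z))"
  unfolding set_lebesgue_integral_def
proof (rule integral_cong_AE)
  have w[measurable]: "(\<lambda>z. indicator (QT T) z * w z) \<in> borel_measurable lborel"
    using w by (simp add: set_integrable_def)
  have [measurable]: "QO T \<in> sets borel" using open_QO by simp
  have "(\<lambda>z. (indicator (QT T) z * w z) * g z) \<in> borel_measurable lborel" by measurable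
  then show "(\<lambda>z. indicator (QT T) z *\<^sub>R (w z * g z)) \<in> borel_measurable lborel" by (simp add: mult.assoc)
  show "(\<lambda>z. (indicator (QT T) z * w z) * (indicator (QO T) z * g z)) \<in> borel_measurable lborel" by measurable
  show "AE z in lborel. indicator (QT T) z *\<^sub>R (w z * g z) = (indicator (QT T) z * w z) * (indicator (QO T) z * g z)"
    using AE_QT_QO[of T] by eventually_elim (auto simp: indicator_def)
qed

text \<open>Both volume terms pass to the limit by weak convergence of directional derivatives, as
  \<open>w0\<close> and \<open>w \<alpha>\<close> are integrable; the initial term passes by
  dominated convergence. The flux is an arbitrary family \<open>w\<close>, so that the momentum and
  the compatibility equations are both instances.\<close>

lemma weak_form_lipschitz_test:
  assumes "0 < T" and a: "set_integrable lborel Qcell a"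
    and w0: "set_integrable lborel (QT T) w0" and w: "\<And>\<alpha>. set_integrable lborel (QT T) (w \<alpha>)"
    and wf: "\<And>psi psit psix. test_QT T psi psit psix \<Longrightarrow>
        (LINT x:Qcell|lborel. psi x 0 * a x) + (LINT z:QT T|lborel. w0 z * psit (fst z) (snd z))
        = (\<Sum>\<alpha>\<in>UNIV. LINT z:QT T|lborel. w \<alpha> z * psix (fst z) (snd z) $ \<alpha>)"
    and lip: "L-lipschitz_on UNIV \<psi>"
    and per: "\<And>z k. \<psi> (z + (2 * pi) *\<^sub>R xdir k) = \<psi> z"
    and \<tau>: "\<tau> < T" "\<And>x t. \<tau> \<le> t \<Longrightarrow> \<psi> (x, t) = 0"
    and meas: "pt \<in> borel_measurable borel" "\<And>\<alpha>. px \<alpha> \<in> borel_measurable borel"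
    and dt: "AE z in lborel. z \<in> QO T \<longrightarrow> has_dir_deriv \<psi> tdir z (pt z)"
    and dx: "\<And>\<alpha>. AE z in lborel. z \<in> QO T \<longrightarrow> has_dir_deriv \<psi> (xdir \<alpha>) z (px \<alpha> z)"
  shows "(LINT x:Qcell|lborel. \<psi> (x, 0) * a x) + (LINT z:QT T|lborel. w0 z * pt z)
        = (\<Sum>\<alpha>\<in>UNIV. LINT z:QT T|lborel. w \<alpha> z * px \<alpha> z)"
proof (rule lipschitz_test_approximation[OF lip per \<tau>])
  fix \<phi> D assume \<phi>:
    "\<And>n. test_QT T (\<lambda>x t. \<phi> n (x, t)) (\<lambda>x t. D n (x, t) \<bullet> tdir) (\<lambda>x t. fst (D n (x, t)))"
    "\<And>n e z. has_dir_deriv (\<phi> n) e z (D n z \<bullet> e)"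
    "\<And>n. continuous_on UNIV (D n)" "\<And>n. L-lipschitz_on UNIV (\<phi> n)" "\<And>z. (\<lambda>n. \<phi> n z) \<longlonglongrightarrow> \<psi> z"
  have [measurable]: "\<psi> \<in> borel_measurable borel" "\<phi> n \<in> borel_measurable borel" for n
    using lipschitz_borel[OF lip] lipschitz_borel[OF \<phi>(4)] by blast+
  have Dm: "(\<lambda>z. D n z \<bullet> e) \<in> borel_measurable borel" for n e
    by (intro borel_measurable_continuous_onI continuous_intros \<phi>)
  have conv: "(\<lambda>n. LINT z:QT T|lborel. u z * (D n z \<bullet> e)) \<longlonglongrightarrow> (LINT z:QT T|lborel. u z * p z)"
    if u: "set_integrable lborel (QT T) u" and p: "p \<in> borel_measurable borel" and e: "norm e = 1"
      and der: "AE z in lborel. z \<in> QO T \<longrightarrow> has_dir_deriv \<psi> e z (p z)" for u p e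
    unfolding set_integral_QT_as_QO[OF u Dm] set_integral_QT_as_QO[OF u p]
  proof (rule directional_derivatives_converge_weakly[where f=\<psi> and fn=\<phi> and e=e and L=L])
    show "AE z in lborel. z \<in> QO T \<longrightarrow> ((\<lambda>s. \<psi> (z + s *\<^sub>R e)) has_real_derivative p z) (at 0)"
      using der by (simp add: has_dir_deriv_def)
    show "AE z in lborel. z \<in> QO T \<longrightarrow> ((\<lambda>s. \<phi> n (z + s *\<^sub>R e)) has_real_derivative D n z \<bullet> e) (at 0)" for n
      using \<phi>(2) by (simp add: has_dir_deriv_def)
    show "integrable lborel (\<lambda>z. indicator (QT T) z * u z)" using u by (simp add: set_integrable_def)
    show "\<bar>\<psi> (z + s *\<^sub>R e) - \<psi> z\<bar> \<le> L * s" if "0 \<le> s" for z s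
      by (rule lipschitz_direction_bound[OF lip e that])
    show "\<bar>\<phi> n (z + s *\<^sub>R e) - \<phi> n z\<bar> \<le> L * s" if "0 \<le> s" for n z s
      by (rule lipschitz_direction_bound[OF \<phi>(4) e that])
  qed (rule p Dm \<phi>(5) open_QO emeasure_QO_finite lipschitz_borel[OF lip] lipschitz_borel[OF \<phi>(4)])+
  have ia: "integrable lborel (\<lambda>x. indicator Qcell x * a x)" using a by (simp add: set_integrable_def)
  \<comment> \<open>A bound uniform in \<open>n\<close>: the values at the origin converge and hence
    are bounded, and the common Lipschitz constant carries this over the bounded cell.\<close>
  obtain B where B: "\<And>n x. x \<in> Qcell \<Longrightarrow> \<bar>\<phi> n (x, 0)\<bar> \<le> B"
  proof -
    obtain K where K: "\<And>n. \<bar>\<phi> n (0, 0)\<bar> \<le> K"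
      using BseqE[OF convergent_imp_Bseq[OF convergentI[OF \<phi>(5)[of "(0, 0)"]]]] by (metis real_norm_def)
    obtain R where R: "\<And>x. x \<in> Qcell \<Longrightarrow> norm x \<le> R"
      using bounded_subset[OF bounded_cbox Qcell_subset_cbox] by (auto simp: bounded_iff)
    have "\<bar>\<phi> n (x, 0)\<bar> \<le> K + L * R" if "x \<in> Qcell" for n x
    proof -
      have "\<bar>\<phi> n (x, 0) - \<phi> n (0, 0)\<bar> \<le> L * norm x"
        using lipschitz_onD[OF \<phi>(4)[of n], of "(x, 0)" "(0, 0)"] by (simp add: dist_norm norm_Pair)
      also have "\<dots> \<le> L * R" using R[OF that] lipschitz_on_nonneg[OF lip] by (rule mult_left_mono)
      finally show ?thesis using K[of n] by linarith
    qed
    then show ?thesis by (rule that)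
  qed
  have "(\<lambda>n. LINT x|lborel. (indicator Qcell x * a x) * \<phi> n (x, 0)) \<longlonglongrightarrow> (LINT x|lborel. (indicator Qcell x * a x) * \<psi> (x, 0))"
  proof (rule integral_dominated_convergence)
    show "(\<lambda>x. (indicator Qcell x * a x) * \<psi> (x, 0)) \<in> borel_measurable lborel"
      "(\<lambda>x. (indicator Qcell x * a x) * \<phi> n (x, 0)) \<in> borel_measurable lborel" for n
      using borel_measurable_integrable[OF ia] by measurable
    show "integrable lborel (\<lambda>x. B * \<bar>indicator Qcell x * a x\<bar>)" using ia by auto
    show "AE x in lborel. (\<lambda>n. (indicator Qcell x * a x) * \<phi> n (x, 0)) \<longlonglongrightarrow> (indicator Qcell x * a x) * \<psi> (x, 0)"
      by (intro AE_I2 tendsto_mult_left \<phi>(5))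
    show "AE x in lborel. norm ((indicator Qcell x * a x) * \<phi> n (x, 0)) \<le> B * \<bar>indicator Qcell x * a x\<bar>" for n
    proof (rule AE_I2)
      fix x
      show "norm ((indicator Qcell x * a x) * \<phi> n (x, 0)) \<le> B * \<bar>indicator Qcell x * a x\<bar>"
        using mult_right_mono[OF B[of x n], of "\<bar>a x\<bar>"] by (cases "x \<in> Qcell") (simp_all add: abs_mult mult.commute)
    qed
  qed
  then have "(\<lambda>n. LINT x:Qcell|lborel. \<phi> n (x, 0) * a x) \<longlonglongrightarrow> (LINT x:Qcell|lborel. \<psi> (x, 0) * a x)"
    by (simp add: set_lebesgue_integral_def mult_ac)
  then have "(\<lambda>n. (LINT x:Qcell|lborel. \<phi> n (x, 0) * a x) + (LINT z:QT T|lborel. w0 z * (D n z \<bullet> tdir)))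
      \<longlonglongrightarrow> (LINT x:Qcell|lborel. \<psi> (x, 0) * a x) + (LINT z:QT T|lborel. w0 z * pt z)"
    by (intro tendsto_add conv[OF w0 meas(1) norm_tdir dt])
  moreover have "(\<lambda>n. (LINT x:Qcell|lborel. \<phi> n (x, 0) * a x) + (LINT z:QT T|lborel. w0 z * (D n z \<bullet> tdir)))
      \<longlonglongrightarrow> (\<Sum>\<alpha>\<in>UNIV. LINT z:QT T|lborel. w \<alpha> z * px \<alpha> z)"
  proof -
    have "fst (D n z) $ \<alpha> = D n z \<bullet> xdir \<alpha>" for n z \<alpha>
      by (simp add: xdir_def inner_prod_def inner_axis)
    then show ?thesis
      using wf[OF \<phi>(1)] by (simp add: tendsto_sum conv[OF w meas(2) norm_xdir dx])
  qed
  ultimately show ?thesis by (rule LIMSEQ_unique)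
qed

section \<open>Integrals of derivatives over the cylinder: periodicity in space, initial values in
  time\<close>

lemma borel_measurable_fst_borel [measurable]:
    "fst \<in> borel_measurable (borel :: ('a::second_countable_topology \<times> 'b::second_countable_topology) measure)"
  and borel_measurable_snd_borel [measurable]:
    "snd \<in> borel_measurable (borel :: ('a::second_countable_topology \<times> 'b::second_countable_topology) measure)"
  by (intro borel_measurable_continuous_onI continuous_on_fst continuous_on_snd continuous_on_id)+

text \<open>A shift of the cylinder by \<open>h\<close> uncovers a layer at one face and sticks out
  by an equal layer at the opposite face. The two layers differ by one full period, under which
  \<open>p\<close> is invariant.\<close>

lemma integral_periodic_translate:
  fixes p :: "vec3 \<times> real \<Rightarrow> real"
  assumes p: "p \<in> borel_measurable borel" and bnd: "\<And>z. \<bar>p z\<bar> \<le> B"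
    and per: "\<And>z. p (z + (2 * pi) *\<^sub>R xdir \<alpha>) = p z" and h: "0 < h" "h < 2 * pi"
  shows "(LINT z|lborel. indicator (QT T) z * p (z + h *\<^sub>R xdir \<alpha>)) = (LINT z|lborel. indicator (QT T) z * p z)"
proof -
  note [measurable] = p
  \<comment> \<open>The uncovered layer; its translate by one period is the part of the shifted
    cylinder that leaves the cell.\<close>
  define A where "A = {z \<in> QT T. fst z $ \<alpha> < h}"
  have [measurable]: "A \<in> sets borel"
  proof -
    have "A = QT T \<inter> {z \<in> space borel. fst z $ \<alpha> < h}" by (auto simp: A_def)
    also have "\<dots> \<in> sets borel" by measurable
    finally show ?thesis .
  qed
  have iQ: "integrable lborel (indicator (QT T) :: _ \<Rightarrow> real)" using emeasure_QT_finite by simp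
  have iA: "integrable lborel (indicator A :: _ \<Rightarrow> real)"
  proof -
    have "A \<subseteq> QT T" by (auto simp: A_def)
    then have "emeasure lborel A < \<infinity>"
      by (intro le_less_trans[OF emeasure_mono emeasure_QT_finite]) auto
    then show ?thesis by simp
  qed
  have bnd': "AE z in lborel. \<bar>p z\<bar> \<le> B" using bnd by simp
  have shift: "indicator (QT T) (z - h *\<^sub>R xdir \<alpha>)
      = indicator (QT T) z - indicator A z + (indicator A (z - (2 * pi) *\<^sub>R xdir \<alpha>) :: real)" for z
  proof (cases z)
    case (Pair x t)
    define others where "others \<longleftrightarrow> (\<forall>i. i \<noteq> \<alpha> \<longrightarrow> 0 \<le> x $ i \<and> x $ i < 2 * pi) \<and> 0 \<le> t \<and> t < T"
    have mem: "(x - s *\<^sub>R axis \<alpha> 1, t) \<in> QT T \<longleftrightarrow> others \<and> 0 \<le> x $ \<alpha> - s \<and> x $ \<alpha> - s < 2 * pi" for s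
    proof -
      have "(x - s *\<^sub>R axis \<alpha> 1) $ i = (if i = \<alpha> then x $ i - s else x $ i)" for i
        by (simp add: axis_def)
      then have "(x - s *\<^sub>R axis \<alpha> 1, t) \<in> QT T \<longleftrightarrow>
          (\<forall>i. 0 \<le> (if i = \<alpha> then x $ i - s else x $ i) \<and> (if i = \<alpha> then x $ i - s else x $ i) < 2 * pi) \<and> 0 \<le> t \<and> t < T"
        unfolding QT_def Qcell_def mem_Times_iff fst_conv snd_conv mem_Collect_eq atLeastLessThan_iff by (simp only:)
      moreover have "(\<forall>i. 0 \<le> (if i = \<alpha> then x $ i - s else x $ i) \<and> (if i = \<alpha> then x $ i - s else x $ i) < 2 * pi)
          \<longleftrightarrow> (\<forall>i. i \<noteq> \<alpha> \<longrightarrow> 0 \<le> x $ i \<and> x $ i < 2 * pi) \<and> 0 \<le> x $ \<alpha> - s \<and> x $ \<alpha> - s < 2 * pi"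
        (is "(\<forall>i. ?L i) \<longleftrightarrow> ?R")
      proof
        assume L: "\<forall>i. ?L i"
        show ?R
        proof (intro conjI allI impI)
          fix i assume "i \<noteq> \<alpha>"
          then show "0 \<le> x $ i" "x $ i < 2 * pi" using spec[OF L, of i] by simp_all
        qed (use spec[OF L, of \<alpha>] in simp_all)
      next
        assume R: ?R
        show "\<forall>i. ?L i"
        proof
          fix i show "?L i" using R by (cases "i = \<alpha>") simp_all
        qed
      qed
      ultimately show ?thesis unfolding others_def by blast
    qed
    have memA: "(x - s *\<^sub>R axis \<alpha> 1, t) \<in> A \<longleftrightarrow> others \<and> 0 \<le> x $ \<alpha> - s \<and> x $ \<alpha> - s < h" for s
      unfolding A_def mem_Collect_eq mem using h by (auto simp: axis_def)
    have e: "z - s *\<^sub>R xdir \<alpha> = (x - s *\<^sub>R axis \<alpha> 1, t)" for s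
      by (simp add: Pair xdir_def)
    have z0: "z = (x - 0 *\<^sub>R axis \<alpha> 1, t)" by (simp add: Pair)
    have "z \<in> QT T \<longleftrightarrow> others \<and> 0 \<le> x $ \<alpha> \<and> x $ \<alpha> < 2 * pi" "z \<in> A \<longleftrightarrow> others \<and> 0 \<le> x $ \<alpha> \<and> x $ \<alpha> < h"
      using mem[of 0] memA[of 0] unfolding z0 by simp_all
    note QA = this
    have "others \<Longrightarrow> 0 \<le> x $ \<alpha> - h \<and> x $ \<alpha> - h < 2 * pi \<Longrightarrow> ?thesis" if "x $ \<alpha> < 2 * pi"
      unfolding indicator_def e mem memA QA using h that by simp
    moreover have "others \<Longrightarrow> 0 \<le> x $ \<alpha> - h \<and> x $ \<alpha> - h < 2 * pi \<Longrightarrow> ?thesis" if "\<not> x $ \<alpha> < 2 * pi"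
      unfolding indicator_def e mem memA QA using h that by simp
    moreover have "others \<Longrightarrow> \<not> (0 \<le> x $ \<alpha> - h \<and> x $ \<alpha> - h < 2 * pi) \<Longrightarrow> ?thesis"
      unfolding indicator_def e mem memA QA using h by force
    moreover have "\<not> others \<Longrightarrow> ?thesis"
      unfolding indicator_def e mem memA QA by simp
    ultimately show ?thesis by blast
  qed
  have i2: "integrable lborel (\<lambda>z. indicator A (z - (2 * pi) *\<^sub>R xdir \<alpha>) * p z)"
    and e2: "(LINT z|lborel. indicator A (z - (2 * pi) *\<^sub>R xdir \<alpha>) * p z) = (LINT z|lborel. indicator A z * p z)"
  proof -
    let ?f = "\<lambda>z. indicator A (z - (2 * pi) *\<^sub>R xdir \<alpha>) * p z"
    have s: "(\<lambda>z. ?f (z + (2 * pi) *\<^sub>R xdir \<alpha>)) = (\<lambda>z. indicator A z * p z)"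
      by (simp add: per)
    have "integrable lborel (\<lambda>z. ?f (z + (2 * pi) *\<^sub>R xdir \<alpha>))"
      unfolding s by (rule integrable_mult_bounded[OF _ iA bnd']) measurable
    then have "integrable (distr lborel borel ((+) ((2 * pi) *\<^sub>R xdir \<alpha>))) ?f"
      by (subst integrable_distr_eq) (auto simp: add.commute)
    then show "integrable lborel ?f" by (simp add: lborel_distr_plus)
    show "(LINT z|lborel. ?f z) = (LINT z|lborel. indicator A z * p z)"
      using lborel_integral_translate[of ?f "(2 * pi) *\<^sub>R xdir \<alpha>"] unfolding s by simp
  qed
  have "(LINT z|lborel. indicator (QT T) z * p (z + h *\<^sub>R xdir \<alpha>))
      = (LINT z|lborel. indicator (QT T) (z - h *\<^sub>R xdir \<alpha>) * p z)"
    using lborel_integral_translate[of "\<lambda>z. indicator (QT T) (z - h *\<^sub>R xdir \<alpha>) * p z" "h *\<^sub>R xdir \<alpha>"] by simp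
  also have "\<dots> = (LINT z|lborel. (indicator (QT T) z * p z - indicator A z * p z) + indicator A (z - (2 * pi) *\<^sub>R xdir \<alpha>) * p z)"
    by (simp only: shift distrib_right left_diff_distrib)
  also have "\<dots> = (LINT z|lborel. indicator (QT T) z * p z)"
    using i2 e2 integrable_mult_bounded[OF _ iA bnd'] integrable_mult_bounded[OF _ iQ bnd'] by simp
  finally show ?thesis .
qed

lemma diff_quot_QT_tendsto:
  assumes lip: "L-lipschitz_on UNIV p" and e: "norm e = 1" and g: "g \<in> borel_measurable borel"
    and der: "AE z in lborel. z \<in> QO T \<longrightarrow> has_dir_deriv p e z (g z)"
    and h: "h \<longlonglongrightarrow> 0" "\<And>n. 0 < h n"
  shows "(\<lambda>n. LINT z|lborel. indicator (QT T) z * diff_quot (h n) e p z) \<longlonglongrightarrow> (LINT z|lborel. indicator (QT T) z * g z)"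
proof (rule integral_dominated_convergence[where w="\<lambda>z. L * indicator (QT T) z"])
  note [measurable] = g lipschitz_borel[OF lip]
  show "integrable lborel (\<lambda>z. L * indicator (QT T) z)" using emeasure_QT_finite[of T] by simp
  show "AE z in lborel. (\<lambda>n. indicator (QT T) z * diff_quot (h n) e p z) \<longlonglongrightarrow> indicator (QT T) z * g z"
    using der AE_QT_QO[of T]
  proof eventually_elim
    case (elim z)
    show ?case
    proof (cases "z \<in> QT T")
      case True
      then have "has_dir_deriv p e z (g z)" using elim by blast
      moreover have "h n \<noteq> 0" for n using h(2)[of n] by simp
      ultimately have "(\<lambda>n. diff_quot (h n) e p z) \<longlonglongrightarrow> g z"
        unfolding has_dir_deriv_def by (intro diff_quot_tendsto h(1))
      then show ?thesis by (rule tendsto_mult_left)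
    qed simp
  qed
  show "AE z in lborel. norm (indicator (QT T) z * diff_quot (h n) e p z) \<le> L * indicator (QT T) z" for n
  proof (rule AE_I2)
    fix z
    have "\<bar>diff_quot (h n) e p z\<bar> \<le> L"
      by (rule diff_quot_bound[OF lipschitz_direction_bound[OF lip e] h(2)])
    then show "norm (indicator (QT T) z * diff_quot (h n) e p z) \<le> L * indicator (QT T) z"
      by (cases "z \<in> QT T") auto
  qed
  show "(\<lambda>z. indicator (QT T) z * g z) \<in> borel_measurable lborel"
    "(\<lambda>z. indicator (QT T) z * diff_quot (h n) e p z) \<in> borel_measurable lborel" for n
    by measurable
qed

lemma bounded_on_borel_set_integrable:
  assumes "p \<in> borel_measurable borel" and "A \<in> sets borel" "emeasure lborel A < \<infinity>" and "\<And>z. \<bar>p z\<bar> \<le> B"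
  shows "integrable lborel (\<lambda>z. indicator A z * p z :: real)"
  using assms by (intro integrable_mult_bounded[where C=B]) auto

text \<open>Every difference quotient integrates to zero by periodic translation, and dominated
  convergence hands this on to the derivative. It replaces the divergence theorem on the
  torus.\<close>

lemma integral_spatial_derivative_periodic:
  assumes lip: "L-lipschitz_on UNIV p" and bnd: "\<And>z. \<bar>p z\<bar> \<le> B"
    and per: "\<And>z. p (z + (2 * pi) *\<^sub>R xdir \<alpha>) = p z" and g: "g \<in> borel_measurable borel"
    and der: "AE z in lborel. z \<in> QO T \<longrightarrow> has_dir_deriv p (xdir \<alpha>) z (g z)"
  shows "(LINT z|lborel. indicator (QT T) z * g z) = 0"
proof -
  note [measurable] = g lipschitz_borel[OF lip]
  let ?h = "\<lambda>n. 1 / real (Suc n)"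
  have h0: "?h \<longlonglongrightarrow> 0" by (intro LIMSEQ_Suc lim_1_over_n)
  have "(\<lambda>n. LINT z|lborel. indicator (QT T) z * diff_quot (?h n) (xdir \<alpha>) p z) \<longlonglongrightarrow> (LINT z|lborel. indicator (QT T) z * g z)"
    by (rule diff_quot_QT_tendsto[OF lip norm_xdir g der h0]) simp
  moreover have "(LINT z|lborel. indicator (QT T) z * diff_quot (?h n) (xdir \<alpha>) p z) = 0" for n
  proof -
    have hn: "0 < ?h n" "?h n < 2 * pi"
    proof -
      have "?h n \<le> 1" by simp
      also have "1 < 2 * pi" using pi_gt3 by simp
      finally show "?h n < 2 * pi" .
    qed simp
    have i: "integrable lborel (\<lambda>z. indicator (QT T) z * p z)"
      "integrable lborel (\<lambda>z. indicator (QT T) z * p (z + ?h n *\<^sub>R xdir \<alpha>))"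
      by (rule bounded_on_borel_set_integrable[OF _ _ emeasure_QT_finite bnd], measurable)+
    have "(LINT z|lborel. indicator (QT T) z * diff_quot (?h n) (xdir \<alpha>) p z)
       = (LINT z|lborel. (indicator (QT T) z * p (z + ?h n *\<^sub>R xdir \<alpha>) - indicator (QT T) z * p z) / ?h n)"
      by (intro Bochner_Integration.integral_cong refl) (simp add: diff_quot_def right_diff_distrib del: of_nat_Suc)
    also have "\<dots> = ((LINT z|lborel. indicator (QT T) z * p (z + ?h n *\<^sub>R xdir \<alpha>)) - (LINT z|lborel. indicator (QT T) z * p z)) / ?h n"
      unfolding integral_divide_zero by (subst Bochner_Integration.integral_diff[OF i(2,1)]) (rule refl)
    also have "(LINT z|lborel. indicator (QT T) z * p (z + ?h n *\<^sub>R xdir \<alpha>)) = (LINT z|lborel. indicator (QT T) z * p z)"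
      by (rule integral_periodic_translate[OF lipschitz_borel[OF lip] bnd per hn])
    finally show ?thesis by simp
  qed
  ultimately have "(\<lambda>n::nat. 0) \<longlonglongrightarrow> (LINT z|lborel. indicator (QT T) z * g z)" by (simp only:)
  then show ?thesis by (rule LIMSEQ_unique[OF _ tendsto_const])
qed

lemma lborel_integral_Times:
  fixes f :: "vec3 \<Rightarrow> real"
  assumes f: "f \<in> borel_measurable borel" "\<And>x. \<bar>f x\<bar> \<le> B" and h: "0 \<le> h"
  shows "(LINT z|lborel. indicator (Qcell \<times> {0..<h}) z * f (fst z)) = h * (LINT x|lborel. indicator Qcell x * f x)"
proof -
  note [measurable] = f(1)
  have ind: "indicator (Qcell \<times> {0..<h}) (x, t) = (indicator Qcell x * indicator {0..<h} t :: real)" for x t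
    by (simp add: indicator_times)
  have i: "integrable lborel (\<lambda>z. indicator (Qcell \<times> {0..<h}) z * f (fst z))"
    using emeasure_QT_finite[of h]
    by (intro bounded_on_borel_set_integrable[where B=B] f(2)) (auto simp: QT_def[symmetric])
  have "(LINT z|lborel. indicator (Qcell \<times> {0..<h}) z * f (fst z))
     = (LINT z|(lborel \<Otimes>\<^sub>M lborel). indicator (Qcell \<times> {0..<h}) z * f (fst z))"
    by (simp add: lborel_prod)
  also have "\<dots> = (LINT x|lborel. LINT t|lborel. indicator (Qcell \<times> {0..<h}) (x, t) * f (fst (x, t)))"
    using i by (intro lborel_pair.integral_fst'[symmetric]) (simp add: lborel_prod)
  also have "\<dots> = (LINT x|lborel. indicator Qcell x * f x * h)"
    using h by (simp add: ind mult_ac)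
  finally show ?thesis by (simp add: mult.commute)
qed

text \<open>A shift in time by \<open>h\<close> loses only the initial layer of thickness
  \<open>h\<close>, as \<open>p\<close> vanishes near the final time. The quotient therefore
  integrates to minus the average of \<open>p\<close> over that layer, and the Lipschitz constant
  replaces this by the value at time 0 with an error of order \<open>h\<close>.\<close>

lemma integral_time_derivative:
  assumes "0 < T" and lip: "L-lipschitz_on UNIV p" and bnd: "\<And>z. \<bar>p z\<bar> \<le> B"
    and \<tau>: "\<tau> < T" "\<And>x t. \<tau> \<le> t \<Longrightarrow> p (x, t) = 0" and g: "g \<in> borel_measurable borel"
    and der: "AE z in lborel. z \<in> QO T \<longrightarrow> has_dir_deriv p tdir z (g z)"
  shows "(LINT z|lborel. indicator (QT T) z * g z) = - (LINT x|lborel. indicator Qcell x * p (x, 0))"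
proof -
  note [measurable] = g lipschitz_borel[OF lip]
  define R where "R = min T (T - \<tau>)"
  have R: "0 < R" using \<open>0 < T\<close> \<tau>(1) by (simp add: R_def)
  let ?h = "\<lambda>n. R / real (Suc n)"
  have h0: "?h \<longlonglongrightarrow> 0" by (intro LIMSEQ_Suc lim_const_over_n)
  have hpos: "0 < ?h n" for n using R by simp
  have hR: "?h n \<le> T" "?h n \<le> T - \<tau>" for n
  proof -
    have "R / real (Suc n) \<le> R / 1" using R by (intro divide_left_mono) auto
    then show "?h n \<le> T" "?h n \<le> T - \<tau>" by (auto simp: R_def)
  qed
  define J where "J = (LINT x|lborel. indicator Qcell x * p (x, 0))"
  define C where "C = measure lborel Qcell"
  have lim1: "(\<lambda>n. LINT z|lborel. indicator (QT T) z * diff_quot (?h n) tdir p z) \<longlonglongrightarrow> (LINT z|lborel. indicator (QT T) z * g z)"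
    by (rule diff_quot_QT_tendsto[OF lip norm_tdir g der h0 hpos])
  have near: "\<bar>(LINT z|lborel. indicator (QT T) z * diff_quot (?h n) tdir p z) + J\<bar> \<le> L * C * ?h n" for n
  proof -
    define h where "h = ?h n"
    have h: "0 < h" "h \<le> T" "h \<le> T - \<tau>" using hpos hR by (simp_all add: h_def)
    define I where "I = (LINT z|lborel. indicator (QT h) z * p z)"
    have i: "integrable lborel (\<lambda>z. indicator (QT T) z * p z)"
      "integrable lborel (\<lambda>z. indicator (QT h) z * p z)"
      "integrable lborel (\<lambda>z. indicator (QT T) z * p (z + h *\<^sub>R tdir))"
      by (rule bounded_on_borel_set_integrable[OF _ _ emeasure_QT_finite bnd], measurable)+
    have shift: "indicator (QT T) (z - h *\<^sub>R tdir) * p z = indicator (QT T) z * p z - indicator (QT h) z * p z" for z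
    proof (cases z)
      case (Pair x t)
      have e: "z - h *\<^sub>R tdir = (x, t - h)" by (simp add: Pair tdir_def)
      show ?thesis
      proof (cases "\<tau> \<le> t")
        case True
        then show ?thesis using \<tau>(2)[of t x] by (simp add: Pair)
      next
        case False
        then have "t < T" "t - h < T" using \<tau>(1) h by simp_all
        then have "(x, t - h) \<in> QT T \<longleftrightarrow> x \<in> Qcell \<and> h \<le> t" "(x, t) \<in> QT T \<longleftrightarrow> x \<in> Qcell \<and> 0 \<le> t"
           "(x, t) \<in> QT h \<longleftrightarrow> x \<in> Qcell \<and> 0 \<le> t \<and> t < h"
          by (simp_all add: QT_def)
        then show ?thesis
          unfolding e unfolding Pair indicator_def using h(1) by (auto simp: not_le not_less)
      qed
    qed
    have "(LINT z|lborel. indicator (QT T) z * p (z + h *\<^sub>R tdir)) = (LINT z|lborel. indicator (QT T) (z - h *\<^sub>R tdir) * p z)"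
      using lborel_integral_translate[of "\<lambda>z. indicator (QT T) (z - h *\<^sub>R tdir) * p z" "h *\<^sub>R tdir"] by simp
    also have "\<dots> = (LINT z|lborel. indicator (QT T) z * p z) - I"
      unfolding shift I_def by (rule Bochner_Integration.integral_diff[OF i(1,2)])
    finally have tr: "(LINT z|lborel. indicator (QT T) z * p (z + h *\<^sub>R tdir)) - (LINT z|lborel. indicator (QT T) z * p z) = - I"
      by simp
    have "(LINT z|lborel. indicator (QT T) z * diff_quot h tdir p z)
       = (LINT z|lborel. (indicator (QT T) z * p (z + h *\<^sub>R tdir) - indicator (QT T) z * p z) / h)"
      by (intro Bochner_Integration.integral_cong refl) (simp add: diff_quot_def right_diff_distrib)
    also have "\<dots> = - I / h"
      unfolding integral_divide_zero by (subst Bochner_Integration.integral_diff[OF i(3,1)]) (simp only: tr)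
    finally have dq: "(LINT z|lborel. indicator (QT T) z * diff_quot h tdir p z) = - I / h" .
    have hJ: "(LINT z|lborel. indicator (QT h) z * p (fst z, 0)) = h * J"
      unfolding J_def QT_def by (rule lborel_integral_Times[where B=B]) (use h bnd in \<open>simp_all\<close>)
    have i4: "integrable lborel (\<lambda>z. indicator (QT h) z * p (fst z, 0))"
      by (rule bounded_on_borel_set_integrable[OF _ _ emeasure_QT_finite bnd], measurable)
    have iC: "integrable lborel (\<lambda>z. (L * h) * indicator (QT h) z)" using emeasure_QT_finite[of h] by simp
    have "\<bar>I - h * J\<bar> = \<bar>LINT z|lborel. indicator (QT h) z * p z - indicator (QT h) z * p (fst z, 0)\<bar>"
      unfolding I_def hJ[symmetric] by (subst Bochner_Integration.integral_diff[OF i(2) i4]) (rule refl)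
    also have "\<dots> \<le> (LINT z|lborel. \<bar>indicator (QT h) z * p z - indicator (QT h) z * p (fst z, 0)\<bar>)"
      by (rule integral_abs_bound)
    also have "\<dots> \<le> (LINT z|lborel. (L * h) * indicator (QT h) z)"
    proof (intro integral_mono iC integrable_abs Bochner_Integration.integrable_diff i(2) i4)
      fix z
      show "\<bar>indicator (QT h) z * p z - indicator (QT h) z * p (fst z, 0)\<bar> \<le> (L * h) * indicator (QT h) z"
      proof (cases "z \<in> QT h")
        case True
        then have t: "0 \<le> snd z" "snd z \<le> h" by (auto simp: QT_def)
        have "\<bar>p z - p (fst z, 0)\<bar> \<le> L * snd z"
          using lipschitz_onD[OF lip, of z "(fst z, 0)"] t by (cases z) (simp add: dist_Pair_Pair dist_norm)
        also have "\<dots> \<le> L * h" using t lipschitz_on_nonneg[OF lip] by (intro mult_left_mono)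
        finally show ?thesis using True by simp
      qed simp
    qed
    also have "\<dots> = (L * h) * (LINT z|lborel. indicator (Qcell \<times> {0..<h}) z * 1)"
      by (simp add: QT_def)
    also have "(LINT z|lborel. indicator (Qcell \<times> {0..<h}) z * 1) = h * C"
      using lborel_integral_Times[of "\<lambda>_. 1" 1 h] h by (simp add: C_def)
    finally have "\<bar>I - h * J\<bar> / h \<le> L * C * h"
      using h by (simp add: field_simps)
    moreover have "(- I / h) + J = - ((I - h * J) / h)" using h by (simp add: field_simps)
    ultimately show ?thesis
      unfolding h_def[symmetric] dq using h by (simp add: abs_divide)
  qed
  have "(\<lambda>n. L * C * ?h n) \<longlonglongrightarrow> 0" using tendsto_mult_left[OF h0, of "L * C"] by simp
  then have "(\<lambda>n. (LINT z|lborel. indicator (QT T) z * diff_quot (?h n) tdir p z) + J) \<longlonglongrightarrow> 0"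
    by (rule Lim_null_comparison[OF always_eventually, rotated]) (use near in simp)
  then have "(LINT z|lborel. indicator (QT T) z * g z) + J = 0"
    using tendsto_add[OF lim1 tendsto_const[of J]] LIMSEQ_unique by blast
  then show ?thesis by (simp add: J_def)
qed

section \<open>Young measures with finite second moment\<close>

definition sq :: "vec3 \<times> mat3 \<Rightarrow> real" where
  "sq w = (norm (fst w))\<^sup>2 + (norm (snd w))\<^sup>2"

lemma sq_nonneg: "0 \<le> sq w" by (simp add: sq_def)

lemma continuous_on_sq [continuous_intros]: "continuous_on S g \<Longrightarrow> continuous_on S (\<lambda>x. sq (g x))"
  unfolding sq_def by (intro continuous_intros)

lemma sq_borel [measurable]: "sq \<in> borel_measurable borel"
  by (intro borel_measurable_continuous_onI continuous_on_sq continuous_on_id)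

lemma filterlim_sq_at_infinity: "filterlim (\<lambda>w. 1 + sq w) at_top at_infinity"
proof -
  have "(norm w)\<^sup>2 = sq w" for w by (cases w) (simp add: sq_def norm_Pair)
  moreover have "filterlim (\<lambda>w :: vec3 \<times> mat3. 1 + (norm w)\<^sup>2) at_top at_infinity"
    by (intro filterlim_tendsto_add_at_top[OF tendsto_const] filterlim_pow_at_top filterlim_norm_at_top) simp
  ultimately show ?thesis by simp
qed

text \<open>The minimal input for measurability: means of bounded continuous functions are
  measurable on the closed cylinder. This is what a generating sequence provides directly.\<close>

locale young_kernel =
  fixes N :: "vec3 \<Rightarrow> real \<Rightarrow> (vec3 \<times> mat3) measure" and T :: real
  assumes N_prob: "(x, t) \<in> QTbar T \<Longrightarrow> prob_space (N x t)"
    and N_sets: "(x, t) \<in> QTbar T \<Longrightarrow> sets (N x t) = sets borel"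
    and N_bounded_measurable: "\<And>g :: vec3 \<times> mat3 \<Rightarrow> real. continuous_on UNIV g \<Longrightarrow> bounded (range g) \<Longrightarrow>
      (\<lambda>z. indicator (QTbar T) z * ymean N (fst z) (snd z) g) \<in> borel_measurable borel"
begin

text \<open>A family of measures specified on the closed cylinder is completed by an arbitrary Dirac
  mass elsewhere, so that all means are Borel functions on the whole of space-time and no domain has
  to be carried along.\<close>

definition K :: "vec3 \<times> real \<Rightarrow> (vec3 \<times> mat3) measure" where
  "K z = (if z \<in> QTbar T then N (fst z) (snd z) else return borel (0, 0))"

lemma prob_space_K: "prob_space (K z)"
  unfolding K_def using N_prob[of "fst z" "snd z"] by (auto intro: prob_space_return)

lemma sets_K [measurable_cong]: "sets (K z) = sets borel"
  unfolding K_def using N_sets[of "fst z" "snd z"] by auto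

lemma space_K: "space (K z) = UNIV"
  using sets_eq_imp_space_eq[OF sets_K[of z]] by simp

lemma mean_bounded_measurable:
  assumes g: "continuous_on UNIV g" "\<And>w. \<bar>g w\<bar> \<le> (B :: real)"
  shows "(\<lambda>z. integral\<^sup>L (K z) g) \<in> borel_measurable borel"
proof -
  have "bounded (range g)" using g(2) by (auto simp: bounded_iff)
  note [measurable] = N_bounded_measurable[OF g(1) this]
  have [measurable]: "g \<in> borel_measurable borel" by (intro borel_measurable_continuous_onI g)
  have "integral\<^sup>L (K z) g = indicator (QTbar T) z * ymean N (fst z) (snd z) g + (1 - indicator (QTbar T) z) * g (0, 0)" for z
    by (cases "z \<in> QTbar T") (simp_all add: K_def ymean_def integral_return)
  then have "(\<lambda>z. integral\<^sup>L (K z) g) = (\<lambda>z. indicator (QTbar T) z * ymean N (fst z) (snd z) g + (1 - indicator (QTbar T) z) * g (0, 0))"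
    by (rule ext)
  also have "\<dots> \<in> borel_measurable borel" by measurable
  finally show ?thesis .
qed

text \<open>Open sets form an intersection-stable generator of the Borel sets, so measurability of
  the mass of an open set is enough. That mass is the limit of means of bounded continuous functions
  built from the distance to the complement.\<close>

lemma K_measurable: "K \<in> measurable borel (subprob_algebra borel)"
proof (rule measurable_prob_algebraD, rule measurable_prob_algebra_generated[where \<Omega>=UNIV and G="{S. open S}"])
  show "sets borel = sigma_sets UNIV {S :: (vec3 \<times> mat3) set. open S}"
    by (simp add: borel_def)
  show "Int_stable {S :: (vec3 \<times> mat3) set. open S}"
    by (auto simp: Int_stable_def)
  show "prob_space (K z)" "sets (K z) = sets borel" for z
    by (rule prob_space_K sets_K)+
  fix A :: "(vec3 \<times> mat3) set" assume "A \<in> {S. open S}"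
  then have A: "open A" and Am[measurable]: "A \<in> sets borel" by simp_all
  show "(\<lambda>z. emeasure (K z) A) \<in> borel_measurable borel"
  \<comment> \<open>The whole space is treated apart, since the distance to the empty complement is
    0 by convention and the approximating functions would vanish.\<close>
  proof (cases "A = UNIV")
    case True
    have "emeasure (K z) UNIV = 1" for z
      using prob_space.emeasure_space_1[OF prob_space_K[of z]] by (simp add: space_K)
    then show ?thesis by (simp add: True)
  next
    case False
    define g where "g k w = min 1 (real k * infdist w (- A))" for k :: nat and w :: "vec3 \<times> mat3"
    have g: "continuous_on UNIV (g k)" "\<bar>g k w\<bar> \<le> 1" for k w
      unfolding g_def by (auto intro!: continuous_intros simp: infdist_nonneg)
    have gm[measurable]: "g k \<in> borel_measurable borel" for k by (intro borel_measurable_continuous_onI g)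
    have lim: "(\<lambda>k. g k w) \<longlonglongrightarrow> indicator A w" for w
    proof (cases "w \<in> A")
      case True
      have "w \<notin> closure (- A)" using A True by (simp add: closure_closed open_closed)
      then have d: "0 < infdist w (- A)"
        using in_closure_iff_infdist_zero[of "- A" w] False infdist_nonneg[of w "- A"] by (auto simp: less_le)
      obtain n where n: "1 < real n * infdist w (- A)" using reals_Archimedean3[OF d] by blast
      have "eventually (\<lambda>k. g k w = 1) sequentially"
      proof (rule eventually_sequentiallyI[of n])
        fix k assume "n \<le> k"
        then have "real n * infdist w (- A) \<le> real k * infdist w (- A)" using d by (intro mult_right_mono) auto
        then show "g k w = 1" using n by (simp add: g_def)
      qed
      then show ?thesis using True by (simp add: tendsto_eventually)
    next
      case False
      then have "g k w = 0" for k by (simp add: g_def)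
      then show ?thesis using False by simp
    qed
    have "(\<lambda>k. integral\<^sup>L (K z) (g k)) \<longlonglongrightarrow> measure (K z) A" for z
    proof -
      interpret prob_space "K z" by (rule prob_space_K)
      have "(\<lambda>k. integral\<^sup>L (K z) (g k)) \<longlonglongrightarrow> integral\<^sup>L (K z) (indicator A)"
        by (rule integral_dominated_convergence[where w="\<lambda>_. 1"]) (use lim g(2) in \<open>auto simp del: real_norm_def simp add: real_norm_def\<close>)
      then show ?thesis by (simp add: space_K)
    qed
    then have "(\<lambda>z. measure (K z) A) \<in> borel_measurable borel"
      by (rule borel_measurable_LIMSEQ_real) (rule mean_bounded_measurable[OF g])
    moreover have "emeasure (K z) A = ennreal (measure (K z) A)" for z
    proof -
      interpret prob_space "K z" by (rule prob_space_K)
      show ?thesis by (rule emeasure_eq_measure)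
    qed
    ultimately show ?thesis by simp
  qed
qed auto

lemma mean_measurable [measurable]:
  fixes g :: "vec3 \<times> mat3 \<Rightarrow> real"
  assumes "g \<in> borel_measurable borel"
  shows "(\<lambda>z. integral\<^sup>L (K z) g) \<in> borel_measurable borel"
  by (rule measurable_compose[OF K_measurable integral_measurable_subprob_algebra[OF assms]])

lemma nn_mean_measurable:
  assumes [measurable]: "(\<lambda>(z, w). g z w) \<in> borel_measurable (borel \<Otimes>\<^sub>M borel)"
  shows "(\<lambda>z. \<integral>\<^sup>+ w. g z w \<partial>K z) \<in> borel_measurable borel"
  by (rule nn_integral_measurable_subprob_algebra2[OF assms K_measurable])

end

text \<open>The moment is a non-negative extended integral, so the condition presupposes no
  integrability; integrability of \<open>sq\<close> under almost every \<open>K z\<close> is a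
  consequence.\<close>

locale young_second_moment = young_kernel +
  assumes second_moment: "(\<integral>\<^sup>+ z. indicator (QTbar T) z * (\<integral>\<^sup>+ w. ennreal (sq w) \<partial>K z) \<partial>lborel) < \<infinity>"
begin

lemma AE_integrable_sq: "AE z in lborel. z \<in> QTbar T \<longrightarrow> integrable (K z) sq"
proof -
  have m: "(\<lambda>z. \<integral>\<^sup>+ w. ennreal (sq w) \<partial>K z) \<in> borel_measurable borel"
    by (rule nn_mean_measurable) measurable
  note [measurable] = m
  have "AE z in lborel. indicator (QTbar T) z * (\<integral>\<^sup>+ w. ennreal (sq w) \<partial>K z) \<noteq> \<infinity>"
    using second_moment by (intro nn_integral_noteq_infinite) auto
  then show ?thesis
  proof eventually_elim
    case (elim z)
    show ?case
    proof
      assume "z \<in> QTbar T"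
      then have "(\<integral>\<^sup>+ w. ennreal (sq w) \<partial>K z) < \<infinity>" using elim by (simp add: less_top)
      then show "integrable (K z) sq"
        by (intro integrableI_nonneg) (auto simp: sq_nonneg)
    qed
  qed
qed

lemma AE_integrable_quadratic:
  fixes g :: "vec3 \<times> mat3 \<Rightarrow> real"
  assumes [measurable]: "g \<in> borel_measurable borel" and "\<And>w. \<bar>g w\<bar> \<le> A + B * sq w"
  shows "AE z in lborel. z \<in> QTbar T \<longrightarrow> integrable (K z) g"
  using AE_integrable_sq
proof eventually_elim
  case (elim z)
  show ?case
  proof
    assume "z \<in> QTbar T"
    then have i: "integrable (K z) sq" using elim by simp
    interpret prob_space "K z" by (rule prob_space_K)
    show "integrable (K z) g"
    proof (rule Bochner_Integration.integrable_bound)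
      show "integrable (K z) (\<lambda>w. A + B * sq w)" using i by simp
      show "AE w in K z. norm (g w) \<le> norm (A + B * sq w)"
        using assms(2) by (intro AE_I2) (smt (verit) real_norm_def)
    qed measurable
  qed
qed

lemma set_integrable_mean:
  fixes g :: "vec3 \<times> mat3 \<Rightarrow> real"
  assumes g: "g \<in> borel_measurable borel" and b: "\<And>w. \<bar>g w\<bar> \<le> A + B * sq w"
  shows "integrable lborel (\<lambda>z. indicator (QTbar T) z * integral\<^sup>L (K z) g)"
proof -
  note [measurable] = g
  have msq: "(\<lambda>z. \<integral>\<^sup>+ w. ennreal (sq w) \<partial>K z) \<in> borel_measurable borel"
    by (rule nn_mean_measurable) measurable
  note [measurable] = msq
  have isq: "integrable lborel (\<lambda>z. indicator (QTbar T) z * integral\<^sup>L (K z) sq)"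
  proof (rule integrableI_nonneg)
    show "(\<lambda>z. indicator (QTbar T) z * integral\<^sup>L (K z) sq) \<in> borel_measurable lborel"
      using mean_measurable[OF sq_borel] by measurable
    show "AE z in lborel. 0 \<le> indicator (QTbar T) z * integral\<^sup>L (K z) sq"
      by (intro AE_I2 mult_nonneg_nonneg Bochner_Integration.integral_nonneg) (auto simp: sq_nonneg)
    have "(\<integral>\<^sup>+ z. ennreal (indicator (QTbar T) z * integral\<^sup>L (K z) sq) \<partial>lborel)
        = (\<integral>\<^sup>+ z. indicator (QTbar T) z * (\<integral>\<^sup>+ w. ennreal (sq w) \<partial>K z) \<partial>lborel)"
    proof (rule nn_integral_cong_AE)
      show "AE z in lborel. ennreal (indicator (QTbar T) z * integral\<^sup>L (K z) sq)
          = indicator (QTbar T) z * (\<integral>\<^sup>+ w. ennreal (sq w) \<partial>K z)"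
        using AE_integrable_sq
      proof eventually_elim
        case (elim z)
        then show ?case
          by (cases "z \<in> QTbar T") (simp_all add: nn_integral_eq_integral sq_nonneg)
      qed
    qed
    then show "(\<integral>\<^sup>+ z. ennreal (indicator (QTbar T) z * integral\<^sup>L (K z) sq) \<partial>lborel) < \<infinity>"
      using second_moment by simp
  qed
  show ?thesis
  proof (rule Bochner_Integration.integrable_bound)
    show "integrable lborel (\<lambda>z. A * indicator (QTbar T) z + B * (indicator (QTbar T) z * integral\<^sup>L (K z) sq))"
      using isq emeasure_QTbar_finite[of T] by simp
    show "(\<lambda>z. indicator (QTbar T) z * integral\<^sup>L (K z) g) \<in> borel_measurable lborel"
      using mean_measurable[OF g] by measurable
    show "AE z in lborel. norm (indicator (QTbar T) z * integral\<^sup>L (K z) g)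
        \<le> norm (A * indicator (QTbar T) z + B * (indicator (QTbar T) z * integral\<^sup>L (K z) sq))"
      using AE_integrable_sq AE_integrable_quadratic[OF g b]
    proof eventually_elim
      case (elim z)
      show ?case
      proof (cases "z \<in> QTbar T")
        case True
        then have i: "integrable (K z) sq" "integrable (K z) g" using elim by simp_all
        interpret prob_space "K z" by (rule prob_space_K)
        have "\<bar>integral\<^sup>L (K z) g\<bar> \<le> (LINT w|K z. \<bar>g w\<bar>)" by (rule integral_abs_bound)
        also have "\<dots> \<le> (LINT w|K z. A + B * sq w)"
          using i b by (intro integral_mono integrable_abs) auto
        also have "\<dots> = A + B * integral\<^sup>L (K z) sq"
          using i by (simp add: prob_space)
        finally show ?thesis using True by simp
      qed simp
    qed
  qed
qed

end

lemma nn_integral_QTbar: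
  assumes [measurable]: "f \<in> borel_measurable borel"
  shows "(\<integral>\<^sup>+ z. indicator (QTbar T) z * f z \<partial>lborel)
    = (\<integral>\<^sup>+ t. indicator {0..T} t * (\<integral>\<^sup>+ x. indicator Qcell x * f (x, t) \<partial>lborel) \<partial>lborel)"
proof -
  have "(\<integral>\<^sup>+ z. indicator (QTbar T) z * f z \<partial>lborel) = (\<integral>\<^sup>+ z. indicator (QTbar T) z * f z \<partial>(lborel \<Otimes>\<^sub>M lborel))"
    by (simp add: lborel_prod)
  also have "\<dots> = (\<integral>\<^sup>+ t. (\<integral>\<^sup>+ x. indicator (QTbar T) (x, t) * f (x, t) \<partial>lborel) \<partial>lborel)"
    by (rule lborel_pair.nn_integral_snd[symmetric]) (simp add: lborel_prod)
  also have "\<dots> = (\<integral>\<^sup>+ t. indicator {0..T} t * (\<integral>\<^sup>+ x. indicator Qcell x * f (x, t) \<partial>lborel) \<partial>lborel)"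
  proof (intro nn_integral_cong)
    fix t :: real
    have "(\<integral>\<^sup>+ x. indicator (QTbar T) (x, t) * f (x, t) \<partial>lborel)
        = (\<integral>\<^sup>+ x. indicator {0..T} t * (indicator Qcell x * f (x, t)) \<partial>lborel)"
      by (intro nn_integral_cong) (auto simp: QTbar_def indicator_def)
    also have "\<dots> = indicator {0..T} t * (\<integral>\<^sup>+ x. indicator Qcell x * f (x, t) \<partial>lborel)"
    proof (rule nn_integral_cmult)
      show "(\<lambda>x. indicator Qcell x * f (x, t)) \<in> borel_measurable lborel" by measurable
    qed
    finally show "(\<integral>\<^sup>+ x. indicator (QTbar T) (x, t) * f (x, t) \<partial>lborel)
        = indicator {0..T} t * (\<integral>\<^sup>+ x. indicator Qcell x * f (x, t) \<partial>lborel)" .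
  qed
  finally show ?thesis .
qed

section \<open>The second moment of a Young measure generated with bounded energy\<close>

context stored_energy
begin

lemma eta_nonneg: "0 \<le> eta G l A"
  using G_nonneg[of A] by (simp add: eta_def)

lemma sq_le_eta: "\<exists>a b. 0 \<le> a \<and> 0 \<le> b \<and> (\<forall>w. sq w \<le> a * eta G (fst w) (snd w) + b)"
proof -
  \<comment> \<open>The factor 2 undoes the one half in the kinetic energy, and \<open>4 / m\<close>
    undoes the constant \<open>m / 4\<close> of coercivity.\<close>
  define a where "a = max 2 (4 / m)"
  define c where "c = (norm (DG 0))\<^sup>2 / m"
  have a: "2 \<le> a" "4 / m \<le> a" "0 \<le> a" by (auto simp: a_def)
  have c: "0 \<le> c" using m_pos by (simp add: c_def)
  have "sq w \<le> a * eta G (fst w) (snd w) + a * c" for w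
  proof -
    have "(norm (snd w))\<^sup>2 = (4 / m) * (m / 4 * (norm (snd w))\<^sup>2)" using m_pos by simp
    also have "\<dots> \<le> (4 / m) * (G (snd w) + c)"
      using G_coercive[of "snd w"] m_pos by (intro mult_left_mono) (auto simp: c_def)
    also have "\<dots> \<le> a * (G (snd w) + c)"
      using a G_nonneg[of "snd w"] c by (intro mult_right_mono) auto
    finally have 1: "(norm (snd w))\<^sup>2 \<le> a * (G (snd w) + c)" .
    have "2 * ((norm (fst w))\<^sup>2 / 2) \<le> a * ((norm (fst w))\<^sup>2 / 2)"
      using a by (intro mult_right_mono) auto
    with 1 show ?thesis by (simp add: sq_def eta_def algebra_simps)
  qed
  then show ?thesis
    using a c by (intro exI[of _ a] exI[of _ "a * c"]) simp
qed

lemma abs_eta_le_sq: "\<bar>eta G (fst w) (snd w)\<bar> \<le> G 0 + (norm (DG 0))\<^sup>2 + (1 + M) * sq w"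
proof -
  have "0 \<le> M * (norm (fst w))\<^sup>2" using M_pos by simp
  moreover have "(norm (fst w))\<^sup>2 / 2 \<le> (norm (fst w))\<^sup>2" by simp
  ultimately have "eta G (fst w) (snd w) \<le> G 0 + (norm (DG 0))\<^sup>2 + (1 + M) * sq w"
    using G_growth[of "snd w"] unfolding eta_def sq_def distrib_left distrib_right by linarith
  then show ?thesis
    using eta_nonneg[of "fst w" "snd w"] by simp
qed

lemma eta_borel [measurable]: "(\<lambda>w. eta G (fst w) (snd w)) \<in> borel_measurable borel"
proof -
  have "continuous_on UNIV (\<lambda>w :: vec3 \<times> mat3. G (snd w))"
    by (rule continuous_on_compose2[OF continuous_on_G[of UNIV]]) (auto intro: continuous_on_snd continuous_on_id)
  then have "continuous_on UNIV (\<lambda>w :: vec3 \<times> mat3. eta G (fst w) (snd w))"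
    unfolding eta_def by (intro continuous_on_add continuous_on_divide continuous_on_power continuous_on_norm continuous_on_fst continuous_on_id continuous_on_const) auto
  then show ?thesis by (rule borel_measurable_continuous_onI)
qed

text \<open>A lower semicontinuity argument. Coercivity turns the energy bound into a bound on
  \<open>sq\<close> along the sequence; the truncations of \<open>sq\<close> are bounded and
  continuous, so the bound passes to their means in the limit, and monotone convergence removes the
  truncation.\<close>

lemma generated_second_moment:
  assumes Y: "young_kernel N T"
    and vF: "\<And>n. set_borel_measurable lborel (QTbar T) (\<lambda>z. ve n (fst z) (snd z))"
      "\<And>n. set_borel_measurable lborel (QTbar T) (\<lambda>z. Fe n (fst z) (snd z))"
    and en: "\<And>n t. t \<in> {0..T} \<Longrightarrow> set_integrable lborel Qcell (\<lambda>x. eta G (ve n x t) (Fe n x t))"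
      "\<And>n t. t \<in> {0..T} \<Longrightarrow> (LINT x:Qcell|lborel. eta G (ve n x t) (Fe n x t)) \<le> C"
    and conv: "\<And>g :: vec3 \<times> mat3 \<Rightarrow> real. continuous_on UNIV g \<Longrightarrow> bounded (range g) \<Longrightarrow>
       (\<lambda>n. LINT z:QTbar T|lborel. g (ve n (fst z) (snd z), Fe n (fst z) (snd z)))
          \<longlonglongrightarrow> (LINT z:QTbar T|lborel. ymean N (fst z) (snd z) g)"
    and T: "0 < T"
  shows "young_second_moment N T"
proof -
  interpret young_kernel N T by (rule Y)
  obtain a b where ab: "0 \<le> a" "0 \<le> b" "\<forall>w. sq w \<le> a * eta G (fst w) (snd w) + b"
    using sq_le_eta by blast
  \<comment> \<open>The sequence is measurable only as a function cut off to the cylinder; the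
    cut-off pair is Borel on the whole space.\<close>
  define u where "u n z = (indicator (QTbar T) z *\<^sub>R ve n (fst z) (snd z), indicator (QTbar T) z *\<^sub>R Fe n (fst z) (snd z))" for n z
  have u[measurable]: "u n \<in> borel_measurable borel" for n
    unfolding u_def borel_prod[symmetric] using vF[of n] unfolding set_borel_measurable_def
    by (intro measurable_Pair) (simp_all add: borel_prod)
  have uQ: "u n z = (ve n (fst z) (snd z), Fe n (fst z) (snd z))" if "z \<in> QTbar T" for n z
    using that by (simp add: u_def)
  \<comment> \<open>\<open>D\<close> bounds the second moment on a single time slice,
    \<open>B\<close> its integral over [0, T]; neither depends on the index of the sequence or on
    the truncation.\<close>
  define D where "D = ennreal a * ennreal C + ennreal b * emeasure lborel Qcell"
  define B where "B = ennreal T * D"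
  have Dfin: "D < \<infinity>" using emeasure_Qcell_finite by (simp add: D_def ennreal_mult_less_top)
  have Bfin: "B < \<infinity>" using Dfin by (simp add: B_def ennreal_mult_less_top)
  have Beq: "B = ennreal (enn2real B)" using Bfin by simp
  have bound: "(\<integral>\<^sup>+ z. indicator (QTbar T) z * ennreal (sq (u n z)) \<partial>lborel) \<le> B" for n
  proof -
    have "(\<integral>\<^sup>+ x. indicator Qcell x * ennreal (sq (u n (x, t))) \<partial>lborel) \<le> D" if t: "t \<in> {0..T}" for t
    proof -
      let ?e = "\<lambda>x. eta G (ve n x t) (Fe n x t)"
      have int: "integrable lborel (\<lambda>x. indicator Qcell x * ?e x)"
        using en(1)[OF t, of n] by (simp add: set_integrable_def)
      have "(\<integral>\<^sup>+ x. indicator Qcell x * ennreal (sq (u n (x, t))) \<partial>lborel)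
          \<le> (\<integral>\<^sup>+ x. ennreal a * ennreal (indicator Qcell x * ?e x) + ennreal b * indicator Qcell x \<partial>lborel)"
      proof (intro nn_integral_mono)
        fix x
        show "indicator Qcell x * ennreal (sq (u n (x, t))) \<le> ennreal a * ennreal (indicator Qcell x * ?e x) + ennreal b * indicator Qcell x"
        proof (cases "x \<in> Qcell")
          case True
          then have "(x, t) \<in> QTbar T" using t by (simp add: QTbar_def)
          then have "sq (u n (x, t)) \<le> a * ?e x + b" using spec[OF ab(3), of "u n (x, t)"] by (simp add: uQ)
          then have "ennreal (sq (u n (x, t))) \<le> ennreal (a * ?e x + b)" by (rule ennreal_leI)
          also have "\<dots> = ennreal a * ennreal (?e x) + ennreal b"
            using ab eta_nonneg[of "ve n x t" "Fe n x t"] by (simp add: ennreal_plus ennreal_mult)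
          finally show ?thesis using True by simp
        qed simp
      qed
      also have "\<dots> = ennreal a * (\<integral>\<^sup>+ x. ennreal (indicator Qcell x * ?e x) \<partial>lborel) + ennreal b * emeasure lborel Qcell"
        using borel_measurable_integrable[OF int] by (simp add: nn_integral_add nn_integral_cmult)
      also have "(\<integral>\<^sup>+ x. ennreal (indicator Qcell x * ?e x) \<partial>lborel) = ennreal (LINT x|lborel. indicator Qcell x * ?e x)"
        by (rule nn_integral_eq_integral[OF int]) (auto simp: eta_nonneg)
      also have "\<dots> \<le> ennreal C"
        using en(2)[OF t, of n] by (intro ennreal_leI) (simp add: set_lebesgue_integral_def)
      finally show ?thesis unfolding D_def by (simp add: add_right_mono mult_left_mono)
    qed
    then have "(\<integral>\<^sup>+ z. indicator (QTbar T) z * ennreal (sq (u n z)) \<partial>lborel)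
        \<le> (\<integral>\<^sup>+ t. D * indicator {0..T} t \<partial>lborel)"
      by (subst nn_integral_QTbar) (auto intro!: nn_integral_mono simp: indicator_def)
    also have "\<dots> = B"
      using T by (simp add: nn_integral_cmult B_def mult.commute)
    finally show ?thesis .
  qed
  define g where "g k w = min (sq w) (real k)" for k :: nat and w
  have g: "continuous_on UNIV (g k)" "\<bar>g k w\<bar> \<le> real k" "0 \<le> g k w" for k w
    unfolding g_def by (auto intro!: continuous_intros simp: sq_nonneg)
  have gbd: "bounded (range (g k))" for k using g(2) by (auto simp: bounded_iff)
  have gm[measurable]: "g k \<in> borel_measurable borel" for k by (intro borel_measurable_continuous_onI g)
  have ig: "integrable (K z) (g k)" for z k
  proof -
    interpret prob_space "K z" by (rule prob_space_K)
    show ?thesis by (rule integrable_const_bound[where B="real k"]) (use g(2) in auto)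
  qed
  have meas[measurable]: "(\<lambda>z. integral\<^sup>L (K z) (g k)) \<in> borel_measurable borel" for k
    by (rule mean_measurable[OF gm])
  have mb: "0 \<le> integral\<^sup>L (K z) (g k)" "integral\<^sup>L (K z) (g k) \<le> real k" for z k
  proof -
    interpret prob_space "K z" by (rule prob_space_K)
    show "0 \<le> integral\<^sup>L (K z) (g k)" by (intro Bochner_Integration.integral_nonneg g)
    have "integral\<^sup>L (K z) (g k) \<le> (LINT w|K z. real k)"
      using g(2)[of k] by (intro integral_mono ig) (auto simp: abs_le_iff)
    then show "integral\<^sup>L (K z) (g k) \<le> real k" by (simp add: prob_space)
  qed
  have gB: "(\<integral>\<^sup>+ z. indicator (QTbar T) z * ennreal (integral\<^sup>L (K z) (g k)) \<partial>lborel) \<le> B" for k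
  proof -
    have i1: "integrable lborel (\<lambda>z. indicator (QTbar T) z * integral\<^sup>L (K z) (g k))"
      by (rule bounded_on_borel_set_integrable[OF _ _ emeasure_QTbar_finite, where B="real k"]) (use mb in \<open>auto simp: abs_le_iff\<close>)
    have i2: "integrable lborel (\<lambda>z. indicator (QTbar T) z * g k (u n z))" for n
      by (rule bounded_on_borel_set_integrable[OF _ _ emeasure_QTbar_finite g(2)]) measurable
    have e1: "(LINT z:QTbar T|lborel. ymean N (fst z) (snd z) (g k)) = (LINT z|lborel. indicator (QTbar T) z * integral\<^sup>L (K z) (g k))"
      unfolding set_lebesgue_integral_def
      by (intro Bochner_Integration.integral_cong refl) (simp add: indicator_def ymean_def K_def)
    have e2: "(LINT z:QTbar T|lborel. g k (ve n (fst z) (snd z), Fe n (fst z) (snd z))) = (LINT z|lborel. indicator (QTbar T) z * g k (u n z))" for n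
      unfolding set_lebesgue_integral_def
      by (intro Bochner_Integration.integral_cong refl) (simp add: indicator_def uQ)
    have "(LINT z|lborel. indicator (QTbar T) z * g k (u n z)) \<le> enn2real B" for n
    proof -
      have "ennreal (LINT z|lborel. indicator (QTbar T) z * g k (u n z)) = (\<integral>\<^sup>+ z. ennreal (indicator (QTbar T) z * g k (u n z)) \<partial>lborel)"
        by (rule nn_integral_eq_integral[OF i2, symmetric]) (simp add: g)
      also have "\<dots> \<le> (\<integral>\<^sup>+ z. indicator (QTbar T) z * ennreal (sq (u n z)) \<partial>lborel)"
        by (intro nn_integral_mono) (auto simp: indicator_def g_def intro!: ennreal_leI)
      also have "\<dots> \<le> B" by (rule bound)
      finally show ?thesis
        by (subst (asm) Beq) (simp add: ennreal_le_iff)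
    qed
    then have "(LINT z|lborel. indicator (QTbar T) z * integral\<^sup>L (K z) (g k)) \<le> enn2real B"
      using LIMSEQ_le_const2[OF conv[OF g(1) gbd, of k], unfolded e1 e2] by blast
    then have "ennreal (LINT z|lborel. indicator (QTbar T) z * integral\<^sup>L (K z) (g k)) \<le> B"
      by (subst Beq) (rule ennreal_leI)
    moreover have "(\<integral>\<^sup>+ z. indicator (QTbar T) z * ennreal (integral\<^sup>L (K z) (g k)) \<partial>lborel)
        = (\<integral>\<^sup>+ z. ennreal (indicator (QTbar T) z * integral\<^sup>L (K z) (g k)) \<partial>lborel)"
      by (intro nn_integral_cong) (simp add: indicator_def)
    moreover have "\<dots> = ennreal (LINT z|lborel. indicator (QTbar T) z * integral\<^sup>L (K z) (g k))"
      by (rule nn_integral_eq_integral[OF i1]) (simp add: mb)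
    ultimately show ?thesis by simp
  qed
  have SUPg: "ennreal (sq w) = (SUP k. ennreal (g k w))" for w
  proof (rule LIMSEQ_unique)
    obtain n where n: "sq w \<le> real n" using real_arch_simple by blast
    have "eventually (\<lambda>k. ennreal (g k w) = ennreal (sq w)) sequentially"
      using n by (intro eventually_sequentiallyI[of n]) (simp add: g_def min_def)
    then show "(\<lambda>k. ennreal (g k w)) \<longlonglongrightarrow> ennreal (sq w)" by (rule tendsto_eventually)
    show "(\<lambda>k. ennreal (g k w)) \<longlonglongrightarrow> (SUP k. ennreal (g k w))"
      by (rule LIMSEQ_SUP) (auto simp: incseq_def g_def intro!: ennreal_leI min.mono)
  qed
  have inc: "incseq (\<lambda>k w. ennreal (g k w))"
    by (auto simp: incseq_def le_fun_def g_def intro!: ennreal_leI min.mono)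
  have "(\<integral>\<^sup>+ w. ennreal (sq w) \<partial>K z) = (SUP k. ennreal (integral\<^sup>L (K z) (g k)))" for z
  proof -
    have "(\<integral>\<^sup>+ w. ennreal (sq w) \<partial>K z) = (SUP k. \<integral>\<^sup>+ w. ennreal (g k w) \<partial>K z)"
      unfolding SUPg by (rule nn_integral_monotone_convergence_SUP[OF inc]) measurable
    then show ?thesis using nn_integral_eq_integral[OF ig] g(3) by simp
  qed
  then have "(\<integral>\<^sup>+ z. indicator (QTbar T) z * (\<integral>\<^sup>+ w. ennreal (sq w) \<partial>K z) \<partial>lborel)
     = (\<integral>\<^sup>+ z. (SUP k. indicator (QTbar T) z * ennreal (integral\<^sup>L (K z) (g k))) \<partial>lborel)"
    by (simp add: SUP_mult_left_ennreal)
  also have "\<dots> = (SUP k. \<integral>\<^sup>+ z. indicator (QTbar T) z * ennreal (integral\<^sup>L (K z) (g k)) \<partial>lborel)"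
  proof (rule nn_integral_monotone_convergence_SUP)
    show "incseq (\<lambda>k z. indicator (QTbar T) z * ennreal (integral\<^sup>L (K z) (g k)))"
      unfolding incseq_def le_fun_def
      by (intro allI impI mult_left_mono ennreal_leI integral_mono ig) (auto simp: g_def min.mono)
  qed measurable
  also have "\<dots> \<le> B" by (intro SUP_least gB)
  finally show ?thesis
    using Bfin by unfold_locales (rule le_less_trans)
qed

end

section \<open>Relative entropy\<close>

text \<open>Boundedness belongs to the definition because products of Lipschitz functions are
  Lipschitz only if the factors are bounded. All coefficients of the relative entropy and all
  weighted test functions are built from sums and products within this class.\<close>

definition admissible :: "(vec3 \<times> real \<Rightarrow> real) \<Rightarrow> bool" where
  "admissible f \<longleftrightarrow> (\<exists>L. L-lipschitz_on UNIV f) \<and> (\<exists>B. \<forall>z. \<bar>f z\<bar> \<le> B)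
     \<and> (\<forall>z k. f (z + (2 * pi) *\<^sub>R xdir k) = f z)"

lemma lipschitz_on_mult_bounded:
  fixes f g :: "'a::metric_space \<Rightarrow> real"
  assumes f: "C-lipschitz_on S f" and g: "D-lipschitz_on S g"
    and A: "\<And>z. \<bar>f z\<bar> \<le> A" and B: "\<And>z. \<bar>g z\<bar> \<le> B"
  shows "(A * D + B * C)-lipschitz_on S (\<lambda>z. f z * g z)"
proof (rule lipschitz_onI)
  have AB: "0 \<le> A" "0 \<le> B" using A[of undefined] B[of undefined] by linarith+
  have CD: "0 \<le> C" "0 \<le> D" using lipschitz_on_nonneg f g by blast+
  show "0 \<le> A * D + B * C" using AB CD by simp
  fix x y assume xy: "x \<in> S" "y \<in> S"
  have "f x * g x - f y * g y = f x * (g x - g y) + g y * (f x - f y)" by (simp add: algebra_simps)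
  then have "\<bar>f x * g x - f y * g y\<bar> \<le> \<bar>f x\<bar> * \<bar>g x - g y\<bar> + \<bar>g y\<bar> * \<bar>f x - f y\<bar>"
    by (metis abs_mult abs_triangle_ineq)
  also have "\<dots> \<le> A * (D * dist x y) + B * (C * dist x y)"
    using lipschitz_onD[OF f xy] lipschitz_onD[OF g xy] A B AB
    by (intro add_mono mult_mono) (auto simp: dist_real_def)
  finally show "dist (f x * g x) (f y * g y) \<le> (A * D + B * C) * dist x y"
    by (simp add: dist_real_def algebra_simps)
qed

lemma admissible_const: "admissible (\<lambda>z. c)"
  unfolding admissible_def
  using lipschitz_on_constant[of UNIV c] by auto

lemma admissible_mult:
  assumes "admissible f" "admissible g" shows "admissible (\<lambda>z. f z * g z)"
proof -
  from assms obtain C D A B where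
    f: "C-lipschitz_on UNIV f" "D-lipschitz_on UNIV g" "\<And>z. \<bar>f z\<bar> \<le> A" "\<And>z. \<bar>g z\<bar> \<le> B"
    unfolding admissible_def by auto
  have "\<bar>f z * g z\<bar> \<le> A * B" for z
    unfolding abs_mult using f(3)[of z] f(4)[of z] abs_ge_zero[of "f z"] by (intro mult_mono) linarith+
  then show ?thesis
    using lipschitz_on_mult_bounded[OF f] assms unfolding admissible_def by auto
qed

lemma admissible_add:
  assumes "admissible f" "admissible g" shows "admissible (\<lambda>z. f z + g z)"
proof -
  from assms obtain C D A B where
    f: "C-lipschitz_on UNIV f" "D-lipschitz_on UNIV g" "\<And>z. \<bar>f z\<bar> \<le> A" "\<And>z. \<bar>g z\<bar> \<le> B"
    unfolding admissible_def by auto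
  have "\<bar>f z + g z\<bar> \<le> A + B" for z
    using f(3)[of z] f(4)[of z] by linarith
  then show ?thesis
    using lipschitz_on_add[OF f(1,2)] assms unfolding admissible_def by auto
qed

lemma admissible_uminus: "admissible f \<Longrightarrow> admissible (\<lambda>z. - f z)"
  using admissible_mult[OF admissible_const[of "-1"]] by simp

lemma admissible_diff: "admissible f \<Longrightarrow> admissible g \<Longrightarrow> admissible (\<lambda>z. f z - g z)"
  using admissible_add[OF _ admissible_uminus] by fastforce

lemma admissible_sum: "(\<And>i. i \<in> I \<Longrightarrow> admissible (f i)) \<Longrightarrow> admissible (\<lambda>z. \<Sum>i\<in>I. f i z)"
  by (induction I rule: infinite_finite_induct) (auto intro: admissible_const admissible_add)

section \<open>Calculus of directional derivatives, and functions frozen in time\<close>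

lemma has_dir_deriv_const: "has_dir_deriv (\<lambda>z. c) e z 0"
  by (simp add: has_dir_deriv_def)

lemma has_dir_deriv_add:
  "has_dir_deriv f e z a \<Longrightarrow> has_dir_deriv g e z b \<Longrightarrow> has_dir_deriv (\<lambda>z. f z + g z) e z (a + b)"
  unfolding has_dir_deriv_def by (rule DERIV_add)

lemma has_dir_deriv_diff:
  "has_dir_deriv f e z a \<Longrightarrow> has_dir_deriv g e z b \<Longrightarrow> has_dir_deriv (\<lambda>z. f z - g z) e z (a - b)"
  unfolding has_dir_deriv_def by (rule DERIV_diff)

lemma has_dir_deriv_mult:
  "has_dir_deriv f e z a \<Longrightarrow> has_dir_deriv g e z b \<Longrightarrow> has_dir_deriv (\<lambda>z. f z * g z) e z (a * g z + b * f z)"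
  unfolding has_dir_deriv_def by (drule (1) DERIV_mult) simp

lemma has_dir_deriv_sum:
  "(\<And>i. i \<in> I \<Longrightarrow> has_dir_deriv (f i) e z (d i)) \<Longrightarrow> has_dir_deriv (\<lambda>z. \<Sum>i\<in>I. f i z) e z (\<Sum>i\<in>I. d i)"
  unfolding has_dir_deriv_def by (rule DERIV_sum)

lemma has_dir_deriv_unique: "has_dir_deriv f e z a \<Longrightarrow> has_dir_deriv f e z b \<Longrightarrow> a = b"
  unfolding has_dir_deriv_def by (rule DERIV_unique)

text \<open>A limit along a fixed sequence, and not an application of the library constant deriv, so that the
  derivative of a continuous function is Borel measurable everywhere.\<close>

definition dir_deriv :: "(vec3 \<times> real \<Rightarrow> real) \<Rightarrow> vec3 \<times> real \<Rightarrow> vec3 \<times> real \<Rightarrow> real" where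
  "dir_deriv f e z = lim (\<lambda>n. diff_quot (1 / real (Suc n)) e f z)"

lemma dir_deriv_borel:
  "f \<in> borel_measurable borel \<Longrightarrow> dir_deriv f e \<in> borel_measurable borel"
  unfolding dir_deriv_def[abs_def] by (intro borel_measurable_lim_metric borel_measurable_diff_quot)

lemma dir_deriv_eq:
  assumes "has_dir_deriv f e z d" shows "dir_deriv f e z = d"
proof -
  have "(\<lambda>n. 1 / real (Suc n)) \<longlonglongrightarrow> 0" by (intro LIMSEQ_Suc lim_1_over_n)
  then have "(\<lambda>n. diff_quot (1 / real (Suc n)) e f z) \<longlonglongrightarrow> d"
    using assms unfolding has_dir_deriv_def by (intro diff_quot_tendsto) auto
  then show ?thesis unfolding dir_deriv_def by (rule limI)
qed

text \<open>Freezing a function of time outside [0, T] extends it to the whole space with the same Lipschitz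
  constant.\<close>

definition clampT :: "real \<Rightarrow> real \<Rightarrow> real" where
  "clampT T t = max 0 (min T t)"

lemma clampT_bounds: "0 < T \<Longrightarrow> 0 \<le> clampT T t" "0 < T \<Longrightarrow> clampT T t \<le> T"
  and clampT_id: "0 \<le> t \<Longrightarrow> t \<le> T \<Longrightarrow> clampT T t = t"
  and clampT_dist: "\<bar>clampT T s - clampT T t\<bar> \<le> \<bar>s - t\<bar>"
  by (auto simp: clampT_def)

definition tclamp :: "real \<Rightarrow> (vec3 \<Rightarrow> real \<Rightarrow> 'b) \<Rightarrow> vec3 \<times> real \<Rightarrow> 'b" where
  "tclamp T f z = f (fst z) (clampT T (snd z))"

lemma lipschitz_tclamp:
  assumes "0 < T" "L-lipschitz_on (UNIV \<times> {0..T}) (\<lambda>z. f (fst z) (snd z))"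
  shows "L-lipschitz_on UNIV (tclamp T f)"
proof (rule lipschitz_onI)
  show "0 \<le> L" using assms(2) by (rule lipschitz_on_nonneg)
  fix x y :: "vec3 \<times> real"
  have "dist (tclamp T f x) (tclamp T f y) \<le> L * dist (fst x, clampT T (snd x)) (fst y, clampT T (snd y))"
    using lipschitz_onD[OF assms(2), of "(fst x, clampT T (snd x))" "(fst y, clampT T (snd y))"] clampT_bounds[OF assms(1)]
    by (simp add: tclamp_def)
  also have "dist (fst x, clampT T (snd x)) (fst y, clampT T (snd y)) \<le> dist (fst x, snd x) (fst y, snd y)"
    unfolding dist_Pair_Pair using clampT_dist[of T "snd x" "snd y"]
    by (intro real_sqrt_le_mono add_left_mono power_mono) (auto simp: dist_real_def)
  finally show "dist (tclamp T f x) (tclamp T f y) \<le> L * dist x y"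
    using lipschitz_on_nonneg[OF assms(2)] by (simp add: mult_left_mono)
qed

lemma periodic_int_multiple:
  fixes f :: "vec3 \<times> real \<Rightarrow> 'b"
  assumes per: "\<And>z k. f (z + (2 * pi) *\<^sub>R xdir k) = f z"
  shows "f (z + (2 * pi * of_int n) *\<^sub>R xdir k) = f z"
proof -
  have nat: "f (z + (2 * pi * real n) *\<^sub>R xdir k) = f z" for n :: nat and z
  proof (induction n)
    case (Suc n)
    have "z + (2 * pi * real (Suc n)) *\<^sub>R xdir k = (z + (2 * pi * real n) *\<^sub>R xdir k) + (2 * pi) *\<^sub>R xdir k"
      by (simp add: algebra_simps)
    then show ?case by (simp only: per Suc)
  qed simp
  show ?thesis
  proof (cases "0 \<le> n")
    case True
    then show ?thesis using nat[of z "nat n"] by simp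
  next
    case False
    then have "f ((z + (2 * pi * of_int n) *\<^sub>R xdir k) + (2 * pi * real (nat (- n))) *\<^sub>R xdir k) = f (z + (2 * pi * of_int n) *\<^sub>R xdir k)"
      using nat by blast
    then show ?thesis using False by (simp add: algebra_simps)
  qed
qed

text \<open>In each coordinate the integer part of \<open>x $ i / (2 * pi)\<close> counts the
  periods to be subtracted. It is used to pass from a bound on the compact closed cell to a global
  one.\<close>

lemma periodic_reduce:
  fixes f :: "vec3 \<times> real \<Rightarrow> 'b"
  assumes per: "\<And>z k. f (z + (2 * pi) *\<^sub>R xdir k) = f z"
  shows "\<exists>y\<in>Qcell. f (x, t) = f (y, t)"
proof -
  define n where "n i = - \<lfloor>x $ i / (2 * pi)\<rfloor>" for i :: 3
  have sum: "f (z + (\<Sum>i\<in>A. (2 * pi * of_int (n i)) *\<^sub>R xdir i)) = f z" if "finite A" for A z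
    using that
  proof (induction A arbitrary: z)
    case (insert a A)
    have "f (z + (\<Sum>i\<in>insert a A. (2 * pi * of_int (n i)) *\<^sub>R xdir i))
        = f ((z + (2 * pi * of_int (n a)) *\<^sub>R xdir a) + (\<Sum>i\<in>A. (2 * pi * of_int (n i)) *\<^sub>R xdir i))"
      using insert by (simp add: add.assoc)
    then show ?case using insert periodic_int_multiple[of f, OF per] by simp
  qed simp
  define y where "y = x + (\<Sum>i\<in>UNIV. (2 * pi * of_int (n i)) *\<^sub>R axis i 1)"
  have y: "y $ j = x $ j - 2 * pi * of_int \<lfloor>x $ j / (2 * pi)\<rfloor>" for j
    by (simp add: y_def n_def axis_def if_distrib[of "(*) _"] sum.delta sum_negf cong: if_cong)
  have "0 \<le> y $ j \<and> y $ j < 2 * pi" for j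
  proof -
    have "of_int \<lfloor>x $ j / (2 * pi)\<rfloor> \<le> x $ j / (2 * pi)" "x $ j / (2 * pi) < of_int \<lfloor>x $ j / (2 * pi)\<rfloor> + 1"
      by linarith+
    then have "of_int \<lfloor>x $ j / (2 * pi)\<rfloor> * (2 * pi) \<le> x $ j" "x $ j < (of_int \<lfloor>x $ j / (2 * pi)\<rfloor> + 1) * (2 * pi)"
      using pi_gt_zero by (simp_all only: pos_le_divide_eq pos_divide_less_eq mult_pos_pos zero_less_numeral)
    then show ?thesis unfolding y distrib_right by (simp add: mult.commute)
  qed
  moreover have "(x, t) + (\<Sum>i\<in>UNIV. (2 * pi * of_int (n i)) *\<^sub>R xdir i) = (y, t)"
    by (simp add: y_def xdir_def prod_eq_iff fst_sum snd_sum)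
  ultimately show ?thesis
    using sum[of UNIV "(x, t)"] by (intro bexI[of _ y]) (auto simp: Qcell_def)
qed

lemma tclamp_bounded:
  fixes f :: "vec3 \<Rightarrow> real \<Rightarrow> 'b::real_normed_vector"
  assumes T: "0 < T" and lip: "L-lipschitz_on (UNIV \<times> {0..T}) (\<lambda>z. f (fst z) (snd z))"
    and per: "\<And>t. periodic3 (\<lambda>x. f x t)"
  shows "\<exists>B. \<forall>z. norm (tclamp T f z) \<le> B" "tclamp T f (z + (2 * pi) *\<^sub>R xdir k) = tclamp T f z"
proof -
  show p: "tclamp T f (z + (2 * pi) *\<^sub>R xdir k) = tclamp T f z" for z k
    using per by (simp add: tclamp_def xdir_def periodic3_def)
  have "compact (cbox (0 :: vec3) (\<chi> i. 2 * pi) \<times> {0..T})" by (intro compact_Times compact_cbox compact_Icc)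
  moreover have "continuous_on (cbox (0 :: vec3) (\<chi> i. 2 * pi) \<times> {0..T}) (tclamp T f)"
    using lipschitz_on_continuous_on[OF lipschitz_tclamp[OF T lip]] by (rule continuous_on_subset) simp
  ultimately have "bounded (tclamp T f ` (cbox (0 :: vec3) (\<chi> i. 2 * pi) \<times> {0..T}))"
    by (intro compact_imp_bounded compact_continuous_image)
  then obtain B where B: "\<And>y. y \<in> cbox (0 :: vec3) (\<chi> i. 2 * pi) \<times> {0..T} \<Longrightarrow> norm (tclamp T f y) \<le> B"
    unfolding bounded_iff by blast
  have "norm (tclamp T f z) \<le> B" for z
  proof -
    obtain y where y: "y \<in> Qcell" "tclamp T f (fst z, snd z) = tclamp T f (y, snd z)"
      using periodic_reduce[of "tclamp T f", OF p] by blast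
    have "clampT T (clampT T (snd z)) = clampT T (snd z)" by (simp add: clampT_def)
    then have "tclamp T f z = tclamp T f (y, clampT T (snd z))" using y by (simp add: tclamp_def)
    moreover have "(y, clampT T (snd z)) \<in> cbox (0 :: vec3) (\<chi> i. 2 * pi) \<times> {0..T}"
      using y(1) Qcell_subset_cbox clampT_bounds[OF T] by auto
    ultimately show ?thesis using B by simp
  qed
  then show "\<exists>B. \<forall>z. norm (tclamp T f z) \<le> B" by blast
qed

lemma has_dir_deriv_tdir:
  assumes "f x differentiable (at t)" "0 < t" "t < T"
  shows "has_dir_deriv (tclamp T f) tdir (x, t) (pdt f x t)"
proof -
  have "(f x has_real_derivative pdt f x t) (at t)"
    using assms(1) unfolding pdt_def by (simp add: DERIV_deriv_iff_real_differentiable)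
  then have "((\<lambda>s. f x (t + s)) has_real_derivative pdt f x t) (at 0)"
    using DERIV_shift[of "f x" "pdt f x t" 0 t] by (simp add: add.commute)
  then have "((\<lambda>s. tclamp T f ((x, t) + s *\<^sub>R tdir)) has_real_derivative pdt f x t) (at 0)"
  proof (rule has_field_derivative_transform_within_open)
    show "open {- t<..<T - t}" "0 \<in> {- t<..<T - t}" using assms by auto
    show "f x (t + s) = tclamp T f ((x, t) + s *\<^sub>R tdir)" if "s \<in> {- t<..<T - t}" for s
      using that by (simp add: tclamp_def tdir_def clampT_id)
  qed
  then show ?thesis by (simp add: has_dir_deriv_def)
qed

lemma has_dir_deriv_xdir:
  assumes "(\<lambda>s. f (x + s *\<^sub>R axis \<alpha> 1) t) differentiable (at 0)" "0 < t" "t < T"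
  shows "has_dir_deriv (tclamp T f) (xdir \<alpha>) (x, t) (pdx \<alpha> f x t)"
  using assms by (simp add: has_dir_deriv_def tclamp_def xdir_def clampT_id pdx_def DERIV_deriv_iff_real_differentiable)

lemma has_derivative_mat3:
  fixes A :: "real \<Rightarrow> mat3"
  assumes "\<And>i j. ((\<lambda>s. A s $ i $ j) has_real_derivative B $ i $ j) (at s)"
  shows "(A has_derivative (\<lambda>h. h *\<^sub>R B)) (at s)"
proof -
  have "((\<lambda>s. A s \<bullet> axis i (axis j 1)) has_derivative (\<lambda>h. (h *\<^sub>R B) \<bullet> axis i (axis j 1))) (at s)" for i j
    using assms[of i j] by (simp add: inner_axis has_field_derivative_def mult_commute_abs)
  then show ?thesis
    by (subst has_derivative_componentwise_within) (auto simp: Basis_vec_def)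
qed

lemma mat3_inner: "A \<bullet> B = (\<Sum>i\<in>UNIV. \<Sum>j\<in>UNIV. A $ i $ j * B $ i $ j)" for A B :: mat3
  by (simp add: inner_vec_def)

lemma vec3_inner: "a \<bullet> b = (\<Sum>i\<in>UNIV. a $ i * b $ i)" for a b :: vec3
  by (simp add: inner_vec_def)

lemma subquadratic_if_bounded:
  fixes g :: "vec3 \<times> mat3 \<Rightarrow> real"
  assumes "bounded (range g)"
  shows "((\<lambda>w. g w / (1 + (norm (fst w))\<^sup>2 + (norm (snd w))\<^sup>2)) \<longlongrightarrow> 0) at_infinity"
proof -
  obtain B where B: "\<And>w. \<bar>g w\<bar> \<le> B" using assms by (auto simp: bounded_iff)
  have "((\<lambda>w. B / (1 + sq w)) \<longlongrightarrow> 0) at_infinity"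
    by (rule tendsto_divide_0[OF tendsto_const filterlim_at_top_imp_at_infinity[OF filterlim_sq_at_infinity]])
  moreover have "eventually (\<lambda>w. norm (g w / (1 + sq w)) \<le> B / (1 + sq w)) at_infinity"
  proof (rule always_eventually, rule allI)
    fix w
    have "0 < 1 + sq w" using sq_nonneg[of w] by simp
    then show "norm (g w / (1 + sq w)) \<le> B / (1 + sq w)"
      using B[of w] by (simp add: abs_divide divide_right_mono)
  qed
  ultimately have "((\<lambda>w. g w / (1 + sq w)) \<longlongrightarrow> 0) at_infinity"
    by (rule Lim_null_comparison[rotated])
  then show ?thesis by (simp add: sq_def add.assoc)
qed

lemma measurable_fst_nth [measurable]: "(\<lambda>w :: vec3 \<times> mat3. fst w $ i) \<in> borel_measurable borel"
  and measurable_snd_nth [measurable]: "(\<lambda>w :: vec3 \<times> mat3. snd w $ i $ j) \<in> borel_measurable borel"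
  by (intro borel_measurable_continuous_onI continuous_on_component continuous_on_fst continuous_on_snd continuous_on_id)+

text \<open>The form \<open>1 + 1 * sq w\<close> matches the shape \<open>A + B * sq w\<close> of
  the growth condition under which means are integrable.\<close>

lemma abs_le_sq:
  "\<bar>fst w $ i\<bar> \<le> 1 + 1 * sq w" "norm (fst w) \<le> 1 + sq w" "\<bar>snd w $ i $ j\<bar> \<le> 1 + 1 * sq w" "norm (snd w) \<le> 1 + sq w"
proof -
  have le: "x \<le> 1 + x\<^sup>2" for x :: real
  proof -
    have "0 \<le> (x - 1 / 2)\<^sup>2" by simp
    then show ?thesis by (simp add: power2_eq_square algebra_simps)
  qed
  show 1: "norm (fst w) \<le> 1 + sq w" and 2: "norm (snd w) \<le> 1 + sq w"
    using le[of "norm (fst w)"] le[of "norm (snd w)"] by (auto simp: sq_def add_increasing add_increasing2 intro: order_trans)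
  show "\<bar>fst w $ i\<bar> \<le> 1 + 1 * sq w" using component_le_norm_cart[of "fst w" i] 1 by simp
  have "\<bar>snd w $ i $ j\<bar> \<le> norm (snd w $ i)" by (rule component_le_norm_cart)
  also have "\<dots> \<le> norm (snd w)" by (rule Finite_Cartesian_Product.norm_nth_le)
  finally show "\<bar>snd w $ i $ j\<bar> \<le> 1 + 1 * sq w" using 2 by simp
qed

section \<open>The measure-valued solution together with a classical solution, and the means of the
  Young measure\<close>

locale dissipative_setting = stored_energy G DG D2G D3G m M
  for G DG D2G D3G m M +
  fixes T :: real
    and v0 :: "vec3 \<Rightarrow> vec3" and F0 :: "vec3 \<Rightarrow> mat3"
    and v :: "vec3 \<Rightarrow> real \<Rightarrow> vec3" and F :: "vec3 \<Rightarrow> real \<Rightarrow> mat3"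
    and \<nu> :: "vec3 \<Rightarrow> real \<Rightarrow> (vec3 \<times> mat3) measure"
    and \<gamma> :: "(vec3 \<times> real) measure"
    and vh :: "vec3 \<Rightarrow> real \<Rightarrow> vec3" and Fh :: "vec3 \<Rightarrow> real \<Rightarrow> mat3"
  assumes T_pos: "0 < T"
    and dmv: "dmv_solution G DG T v0 F0 v F \<nu> \<gamma>"
    and hat: "lipschitz_solution DG T vh Fh"
begin

lemma v0_meas [measurable]: "v0 \<in> borel_measurable borel" and F0_meas [measurable]: "F0 \<in> borel_measurable borel"
  and v0_sq: "integrable lborel (\<lambda>x. indicator Qcell x * (norm (v0 x))\<^sup>2)"
  and F0_sq: "integrable lborel (\<lambda>x. indicator Qcell x * (norm (F0 x))\<^sup>2)"
  and v_meas: "(\<lambda>z. indicator (QTbar T) z *\<^sub>R v (fst z) (snd z)) \<in> borel_measurable borel"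
  and F_meas: "(\<lambda>z. indicator (QTbar T) z *\<^sub>R F (fst z) (snd z)) \<in> borel_measurable borel"
  using dmv unfolding dmv_solution_def set_integrable_def set_borel_measurable_def by simp_all

lemma \<nu>_prob: "(x, t) \<in> QTbar T \<Longrightarrow> prob_space (\<nu> x t) \<and> sets (\<nu> x t) = sets borel"
  using dmv[unfolded dmv_solution_def, THEN conjunct2, THEN conjunct2, THEN conjunct2, THEN conjunct2, THEN conjunct2, THEN conjunct2, THEN conjunct2, THEN conjunct1] by blast

lemma generating: "\<exists>ve Fe. \<exists>C.
        (\<forall>n. set_borel_measurable lborel (QTbar T) (\<lambda>z. ve n (fst z) (snd z)) \<and>
             set_borel_measurable lborel (QTbar T) (\<lambda>z. Fe n (fst z) (snd z))) \<and>
        (\<forall>n. \<forall>t\<in>{0..T}. set_integrable lborel Qcell (\<lambda>x. eta G (ve n x t) (Fe n x t)) \<and>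
              (LINT x:Qcell|lborel. eta G (ve n x t) (Fe n x t)) \<le> C) \<and>
        (\<forall>g :: vec3 \<times> mat3 \<Rightarrow> real.
           continuous_on UNIV g \<and>
           ((\<lambda>w. g w / (1 + (norm (fst w))^2 + (norm (snd w))^2)) \<longlongrightarrow> 0) at_infinity \<longrightarrow>
             (AE z in lborel. z \<in> QTbar T \<longrightarrow> integrable (\<nu> (fst z) (snd z)) g) \<and>
             set_integrable lborel (QTbar T) (\<lambda>z. ymean \<nu> (fst z) (snd z) g) \<and>
             (\<forall>\<phi> :: vec3 \<times> real \<Rightarrow> real. \<phi> \<in> borel_measurable lborel \<and> bounded (range \<phi>) \<longrightarrow>
                (\<lambda>n. LINT z:QTbar T|lborel. g (ve n (fst z) (snd z), Fe n (fst z) (snd z)) * \<phi> z)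
                \<longlonglongrightarrow> (LINT z:QTbar T|lborel. ymean \<nu> (fst z) (snd z) g * \<phi> z)))"
  using dmv[unfolded dmv_solution_def, THEN conjunct2, THEN conjunct2, THEN conjunct2, THEN conjunct2, THEN conjunct2, THEN conjunct2, THEN conjunct2, THEN conjunct2, THEN conjunct1] .

lemma barycentre: "AE z in lborel. z \<in> QTbar T \<longrightarrow>
        v (fst z) (snd z) = ymean \<nu> (fst z) (snd z) fst \<and>
        F (fst z) (snd z) = ymean \<nu> (fst z) (snd z) snd"
  using dmv[unfolded dmv_solution_def, THEN conjunct2, THEN conjunct2, THEN conjunct2, THEN conjunct2, THEN conjunct2, THEN conjunct2, THEN conjunct2, THEN conjunct2, THEN conjunct2, THEN conjunct1] .

lemma \<gamma>_sets: "sets \<gamma> = sets borel"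
  using dmv[unfolded dmv_solution_def, THEN conjunct2, THEN conjunct2, THEN conjunct2, THEN conjunct2, THEN conjunct2, THEN conjunct2, THEN conjunct2, THEN conjunct2, THEN conjunct2, THEN conjunct2, THEN conjunct1] .

lemma \<gamma>_finite: "0 \<le> s \<Longrightarrow> s < T \<Longrightarrow> emeasure \<gamma> (Qcell \<times> {0..s}) < \<infinity>"
  using dmv[unfolded dmv_solution_def, THEN conjunct2, THEN conjunct2, THEN conjunct2, THEN conjunct2, THEN conjunct2, THEN conjunct2, THEN conjunct2, THEN conjunct2, THEN conjunct2, THEN conjunct2, THEN conjunct2, THEN conjunct2, THEN conjunct1] by blast

lemma momentum: "test_QT T psi psit psix \<Longrightarrow>
        (LINT x:Qcell|lborel. psi x 0 * v0 x $ i)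
        + (LINT z:QT T|lborel. v (fst z) (snd z) $ i * psit (fst z) (snd z))
        = (\<Sum>\<alpha>\<in>UNIV. LINT z:QT T|lborel.
              ymean \<nu> (fst z) (snd z) (\<lambda>w. DG (snd w) $ i $ \<alpha>) * psix (fst z) (snd z) $ \<alpha>)"
  using dmv[unfolded dmv_solution_def, THEN conjunct2, THEN conjunct2, THEN conjunct2, THEN conjunct2, THEN conjunct2, THEN conjunct2, THEN conjunct2, THEN conjunct2, THEN conjunct2, THEN conjunct2, THEN conjunct2, THEN conjunct2, THEN conjunct2, THEN conjunct1] by blast

lemma compatibility: "test_QT T psi psit psix \<Longrightarrow>
        (LINT x:Qcell|lborel. psi x 0 * F0 x $ i $ \<alpha>)
        + (LINT z:QT T|lborel. F (fst z) (snd z) $ i $ \<alpha> * psit (fst z) (snd z))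
        = (LINT z:QT T|lborel. v (fst z) (snd z) $ i * psix (fst z) (snd z) $ \<alpha>)"
  using dmv[unfolded dmv_solution_def, THEN conjunct2, THEN conjunct2, THEN conjunct2, THEN conjunct2, THEN conjunct2, THEN conjunct2, THEN conjunct2, THEN conjunct2, THEN conjunct2, THEN conjunct2, THEN conjunct2, THEN conjunct2, THEN conjunct2, THEN conjunct2, THEN conjunct1] by blast

lemma energy: "test_T T \<theta> \<theta>' \<Longrightarrow>
        0 \<le> (LINT z:QT T|lborel. \<theta>' (snd z) * ymean \<nu> (fst z) (snd z) (\<lambda>w. eta G (fst w) (snd w)))
        + (LINT z:QT T|\<gamma>. \<theta>' (snd z))
        + (LINT x:Qcell|lborel. \<theta> 0 * eta G (v0 x) (F0 x))"
  using dmv[unfolded dmv_solution_def, THEN conjunct2, THEN conjunct2, THEN conjunct2, THEN conjunct2, THEN conjunct2, THEN conjunct2, THEN conjunct2, THEN conjunct2, THEN conjunct2, THEN conjunct2, THEN conjunct2, THEN conjunct2, THEN conjunct2, THEN conjunct2, THEN conjunct2] by fastforce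

lemma young: "young_kernel \<nu> T"
proof (rule young_kernel.intro)
  fix x t assume "(x, t) \<in> QTbar T"
  then show "prob_space (\<nu> x t)" "sets (\<nu> x t) = sets borel" using \<nu>_prob by blast+
next
  fix g :: "vec3 \<times> mat3 \<Rightarrow> real" assume g: "continuous_on UNIV g" "bounded (range g)"
  have "set_integrable lborel (QTbar T) (\<lambda>z. ymean \<nu> (fst z) (snd z) g)"
    using generating g(1) subquadratic_if_bounded[OF g(2)] by blast
  then show "(\<lambda>z. indicator (QTbar T) z * ymean \<nu> (fst z) (snd z) g) \<in> borel_measurable borel"
    unfolding set_integrable_def by (auto dest: borel_measurable_integrable)
qed

lemma second_moment_bound: "young_second_moment \<nu> T"
  using generating
proof (elim exE conjE)
  fix ve Fe C
  assume m: "\<forall>n. set_borel_measurable lborel (QTbar T) (\<lambda>z. ve n (fst z) (snd z)) \<and>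
             set_borel_measurable lborel (QTbar T) (\<lambda>z. Fe n (fst z) (snd z))"
    and e: "\<forall>n. \<forall>t\<in>{0..T}. set_integrable lborel Qcell (\<lambda>x. eta G (ve n x t) (Fe n x t)) \<and>
              (LINT x:Qcell|lborel. eta G (ve n x t) (Fe n x t)) \<le> C"
    and g: "\<forall>g :: vec3 \<times> mat3 \<Rightarrow> real.
           continuous_on UNIV g \<and>
           ((\<lambda>w. g w / (1 + (norm (fst w))^2 + (norm (snd w))^2)) \<longlongrightarrow> 0) at_infinity \<longrightarrow>
             (AE z in lborel. z \<in> QTbar T \<longrightarrow> integrable (\<nu> (fst z) (snd z)) g) \<and>
             set_integrable lborel (QTbar T) (\<lambda>z. ymean \<nu> (fst z) (snd z) g) \<and>
             (\<forall>\<phi> :: vec3 \<times> real \<Rightarrow> real. \<phi> \<in> borel_measurable lborel \<and> bounded (range \<phi>) \<longrightarrow>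
                (\<lambda>n. LINT z:QTbar T|lborel. g (ve n (fst z) (snd z), Fe n (fst z) (snd z)) * \<phi> z)
                \<longlonglongrightarrow> (LINT z:QTbar T|lborel. ymean \<nu> (fst z) (snd z) g * \<phi> z))"
  show ?thesis
  proof (rule generated_second_moment[OF young _ _ _ _ _ T_pos, of ve Fe C])
    fix g :: "vec3 \<times> mat3 \<Rightarrow> real" assume gg: "continuous_on UNIV g" "bounded (range g)"
    have "(\<lambda>z::vec3 \<times> real. 1 :: real) \<in> borel_measurable lborel \<and> bounded (range (\<lambda>z::vec3 \<times> real. 1 :: real))"
      by simp
    with g gg(1) subquadratic_if_bounded[OF gg(2)]
    have "(\<lambda>n. LINT z:QTbar T|lborel. g (ve n (fst z) (snd z), Fe n (fst z) (snd z)) * 1)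
                \<longlonglongrightarrow> (LINT z:QTbar T|lborel. ymean \<nu> (fst z) (snd z) g * 1)"
      by blast
    then show "(\<lambda>n. LINT z:QTbar T|lborel. g (ve n (fst z) (snd z), Fe n (fst z) (snd z)))
          \<longlonglongrightarrow> (LINT z:QTbar T|lborel. ymean \<nu> (fst z) (snd z) g)" by simp
  qed (use m e in blast)+
qed

sublocale young_second_moment \<nu> T
  by (rule second_moment_bound)

text \<open>Means are taken with respect to \<open>K\<close>, hence are Borel everywhere. They
  represent \<open>v\<close> and \<open>F\<close> only almost everywhere on the cylinder, which is
  enough under integrals.\<close>

definition vb :: "3 \<Rightarrow> vec3 \<times> real \<Rightarrow> real" where "vb i z = (LINT w|K z. fst w $ i)"
definition Fb :: "3 \<Rightarrow> 3 \<Rightarrow> vec3 \<times> real \<Rightarrow> real" where "Fb i j z = (LINT w|K z. snd w $ i $ j)"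
definition Pb :: "3 \<Rightarrow> 3 \<Rightarrow> vec3 \<times> real \<Rightarrow> real" where "Pb i j z = (LINT w|K z. DG (snd w) $ i $ j)"
definition eb :: "vec3 \<times> real \<Rightarrow> real" where "eb z = (LINT w|K z. eta G (fst w) (snd w))"

lemma DG_component_measurable [measurable]: "(\<lambda>w :: vec3 \<times> mat3. DG (snd w) $ i $ j) \<in> borel_measurable borel"
proof -
  have "continuous_on UNIV (\<lambda>w :: vec3 \<times> mat3. DG (snd w))"
    by (rule continuous_on_compose2[OF continuous_on_DG[of UNIV]]) (auto intro: continuous_on_snd continuous_on_id)
  then show ?thesis by (intro borel_measurable_continuous_onI continuous_on_component)
qed

lemma DG_component_bound: "\<bar>DG (snd w) $ i $ j\<bar> \<le> (norm (DG 0) + M) + M * sq w"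
proof -
  have "\<bar>DG (snd w) $ i $ j\<bar> \<le> norm (DG (snd w))"
    using component_le_norm_cart[of "DG (snd w) $ i" j] Finite_Cartesian_Product.norm_nth_le[of "DG (snd w)" i] by linarith
  also have "\<dots> \<le> norm (DG 0) + M * norm (snd w)"
    using DG_lipschitz[of "snd w" 0] norm_triangle_sub[of "DG (snd w)" "DG 0"] by simp
  also have "M * norm (snd w) \<le> M * (1 + sq w)"
    using abs_le_sq(4) M_pos by (intro mult_left_mono) auto
  finally show ?thesis by (simp add: distrib_left)
qed

lemma means_borel [measurable]:
  "vb i \<in> borel_measurable borel" "Fb i j \<in> borel_measurable borel" "Pb i j \<in> borel_measurable borel" "eb \<in> borel_measurable borel"
  unfolding vb_def[abs_def] Fb_def[abs_def] Pb_def[abs_def] eb_def[abs_def]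
  by (intro mean_measurable measurable_fst_nth measurable_snd_nth DG_component_measurable eta_borel)+

lemma means_AE_integrable: "AE z in lborel. z \<in> QTbar T \<longrightarrow>
    (\<forall>i. integrable (K z) (\<lambda>w. fst w $ i)) \<and> (\<forall>i j. integrable (K z) (\<lambda>w. snd w $ i $ j)) \<and>
    (\<forall>i j. integrable (K z) (\<lambda>w. DG (snd w) $ i $ j)) \<and> integrable (K z) (\<lambda>w. eta G (fst w) (snd w)) \<and> integrable (K z) sq"
proof -
  have "AE z in lborel. \<forall>i. z \<in> QTbar T \<longrightarrow> integrable (K z) (\<lambda>w. fst w $ i)"
    using AE_integrable_quadratic[OF measurable_fst_nth abs_le_sq(1)] by (intro AE_all_countable[THEN iffD2] allI)
  moreover have "AE z in lborel. \<forall>i j. z \<in> QTbar T \<longrightarrow> integrable (K z) (\<lambda>w. snd w $ i $ j)"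
    using AE_integrable_quadratic[OF measurable_snd_nth abs_le_sq(3)] by (intro AE_all_countable[THEN iffD2] allI)
  moreover have "AE z in lborel. \<forall>i j. z \<in> QTbar T \<longrightarrow> integrable (K z) (\<lambda>w. DG (snd w) $ i $ j)"
    using AE_integrable_quadratic[OF DG_component_measurable DG_component_bound] by (intro AE_all_countable[THEN iffD2] allI)
  ultimately show ?thesis
    using AE_integrable_quadratic[OF eta_borel abs_eta_le_sq] AE_integrable_sq
    by eventually_elim blast
qed

lemma means_integrable:
  "integrable lborel (\<lambda>z. indicator (QT T) z * vb i z)"
  "integrable lborel (\<lambda>z. indicator (QT T) z * Fb i j z)"
  "integrable lborel (\<lambda>z. indicator (QT T) z * Pb i j z)"
  "integrable lborel (\<lambda>z. indicator (QT T) z * eb z)"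
proof -
  have *: "integrable lborel (\<lambda>z. indicator (QT T) z * f z)"
    if "integrable lborel (\<lambda>z. indicator (QTbar T) z * f z)" for f :: "vec3 \<times> real \<Rightarrow> real"
  proof -
    have "(\<lambda>z. indicator (QT T) z * f z) = (\<lambda>z. (indicator (QTbar T) z * f z) * indicator (QT T) z)"
      using QT_subset_QTbar[of T] by (intro ext) (auto simp: indicator_def)
    then show ?thesis
      using integrable_mult_bounded[OF _ that, of "indicator (QT T)" 1] by simp
  qed
  show "integrable lborel (\<lambda>z. indicator (QT T) z * vb i z)"
    "integrable lborel (\<lambda>z. indicator (QT T) z * Fb i j z)"
    "integrable lborel (\<lambda>z. indicator (QT T) z * Pb i j z)"
    "integrable lborel (\<lambda>z. indicator (QT T) z * eb z)"
    unfolding vb_def Fb_def Pb_def eb_def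
    by (rule *, rule set_integrable_mean[OF measurable_fst_nth abs_le_sq(1)],
        rule *, rule set_integrable_mean[OF measurable_snd_nth abs_le_sq(3)],
        rule *, rule set_integrable_mean[OF DG_component_measurable DG_component_bound],
        rule *, rule set_integrable_mean[OF eta_borel abs_eta_le_sq])
qed

text \<open>A coordinate may be drawn out of the vector-valued integral only if the vector-valued
  function is integrable; for almost every point this is the domination by
  \<open>1 + sq\<close>.\<close>

lemma barycentre_components: "AE z in lborel. z \<in> QTbar T \<longrightarrow>
    (\<forall>i. v (fst z) (snd z) $ i = vb i z) \<and> (\<forall>i j. F (fst z) (snd z) $ i $ j = Fb i j z)"
  using barycentre means_AE_integrable
proof eventually_elim
  case (elim z)
  show ?case
  proof
    assume z: "z \<in> QTbar T"
    interpret prob_space "K z" by (rule prob_space_K)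
    have i: "integrable (K z) (\<lambda>w. 1 + sq w)" using elim z by simp
    have ym: "ymean \<nu> (fst z) (snd z) g = integral\<^sup>L (K z) g" for g :: "vec3 \<times> mat3 \<Rightarrow> 'c::{banach,second_countable_topology}"
      using z by (simp add: ymean_def K_def)
    have "integrable (K z) fst"
      by (rule Bochner_Integration.integrable_bound[OF i])
        (use abs_le_sq(2) sq_nonneg in \<open>auto intro!: AE_I2\<close>)
    then have 1: "integral\<^sup>L (K z) fst $ i = vb i z" for i
      unfolding vb_def using integral_bounded_linear[OF bounded_linear_vec_nth[of i], of "K z" fst] by simp
    have "integrable (K z) snd"
      by (rule Bochner_Integration.integrable_bound[OF i])
        (use abs_le_sq(4) sq_nonneg in \<open>auto intro!: AE_I2\<close>)
    then have 2: "integral\<^sup>L (K z) snd $ i $ j = Fb i j z" for i j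
      unfolding Fb_def
      using integral_bounded_linear[OF bounded_linear_compose[OF bounded_linear_vec_nth[of j] bounded_linear_vec_nth[of i]], of "K z" snd] by simp
    show "(\<forall>i. v (fst z) (snd z) $ i = vb i z) \<and> (\<forall>i j. F (fst z) (snd z) $ i $ j = Fb i j z)"
      using elim(1) z by (simp add: ym 1 2)
  qed
qed

end

text \<open>The norm is estimated by the sum over all nine entries.\<close>

lemma norm_mat3_le: "norm A \<le> 9 * L" if "\<And>i j. \<bar>A $ i $ j\<bar> \<le> L" for A :: mat3
proof -
  have "norm (A $ i) \<le> 3 * L" for i
    using norm_le_l1_cart[of "A $ i"] sum_mono[of UNIV "\<lambda>j. \<bar>A $ i $ j\<bar>" "\<lambda>_. L"] that by simp
  moreover have "norm A \<le> (\<Sum>i\<in>UNIV. norm (A $ i))"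
    unfolding norm_vec_def[of A] by (rule L2_set_le_sum) simp
  ultimately show ?thesis
    using sum_mono[of UNIV "\<lambda>i. norm (A $ i)" "\<lambda>_. 3 * L"] by fastforce
qed

section \<open>The extended classical solution, its stress and their derivatives\<close>

context dissipative_setting
begin

definition V :: "vec3 \<times> real \<Rightarrow> vec3" where "V = tclamp T vh"
definition W :: "vec3 \<times> real \<Rightarrow> mat3" where "W = tclamp T Fh"
definition S :: "vec3 \<times> real \<Rightarrow> mat3" where "S z = DG (W z)"
definition Vt :: "3 \<Rightarrow> vec3 \<times> real \<Rightarrow> real" where "Vt i = dir_deriv (\<lambda>z. V z $ i) tdir"
definition Vx :: "3 \<Rightarrow> 3 \<Rightarrow> vec3 \<times> real \<Rightarrow> real" where "Vx i j = dir_deriv (\<lambda>z. V z $ i) (xdir j)"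
definition Wt :: "3 \<Rightarrow> 3 \<Rightarrow> vec3 \<times> real \<Rightarrow> real" where "Wt i j = dir_deriv (\<lambda>z. W z $ i $ j) tdir"
definition St :: "3 \<Rightarrow> 3 \<Rightarrow> vec3 \<times> real \<Rightarrow> real" where "St i j = dir_deriv (\<lambda>z. S z $ i $ j) tdir"
definition Sx :: "3 \<Rightarrow> 3 \<Rightarrow> 3 \<Rightarrow> vec3 \<times> real \<Rightarrow> real" where "Sx i j k = dir_deriv (\<lambda>z. S z $ i $ j) (xdir k)"

lemma hat_periodic: "periodic3 (\<lambda>x. vh x t)" "periodic3 (\<lambda>x. Fh x t)"
  using hat[unfolded lipschitz_solution_def, THEN conjunct1] by blast+

lemma hat_lipschitz:
  "\<exists>L. L-lipschitz_on UNIV V \<and> L-lipschitz_on UNIV W \<and> L-lipschitz_on UNIV S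
     \<and> L-lipschitz_on (UNIV \<times> {0..T}) (\<lambda>z. vh (fst z) (snd z)) \<and> L-lipschitz_on (UNIV \<times> {0..T}) (\<lambda>z. Fh (fst z) (snd z))"
proof -
  obtain L where L: "L-lipschitz_on (UNIV \<times> {0..T}) (\<lambda>z. vh (fst z) (snd z))" "L-lipschitz_on (UNIV \<times> {0..T}) (\<lambda>z. Fh (fst z) (snd z))"
    using hat[unfolded lipschitz_solution_def, THEN conjunct2, THEN conjunct1] by blast
  have W: "L-lipschitz_on UNIV W" unfolding W_def by (rule lipschitz_tclamp[OF T_pos L(2)])
  have "M-lipschitz_on (W ` UNIV) DG"
    using DG_lipschitz M_pos by (intro lipschitz_onI) (auto simp: dist_norm)
  from lipschitz_on_compose2[OF W this] have S: "(M * L)-lipschitz_on UNIV S" by (simp add: S_def[abs_def])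
  have V: "L-lipschitz_on UNIV V" unfolding V_def by (rule lipschitz_tclamp[OF T_pos L(1)])
  show ?thesis
    by (rule exI[of _ "max L (M * L)"]) (intro conjI; rule lipschitz_on_le[OF V max.cobounded1] lipschitz_on_le[OF W max.cobounded1]
        lipschitz_on_le[OF S max.cobounded2] lipschitz_on_le[OF L(1) max.cobounded1] lipschitz_on_le[OF L(2) max.cobounded1])
qed

lemma hat_bounded: "\<exists>B. \<forall>z. norm (V z) \<le> B" "\<exists>B. \<forall>z. norm (W z) \<le> B" "\<exists>B. \<forall>z. norm (S z) \<le> B"
  and hat_shift: "V (z + (2 * pi) *\<^sub>R xdir k) = V z" "W (z + (2 * pi) *\<^sub>R xdir k) = W z" "S (z + (2 * pi) *\<^sub>R xdir k) = S z"
proof -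
  obtain L where L: "L-lipschitz_on (UNIV \<times> {0..T}) (\<lambda>z. vh (fst z) (snd z))" "L-lipschitz_on (UNIV \<times> {0..T}) (\<lambda>z. Fh (fst z) (snd z))"
    using hat[unfolded lipschitz_solution_def, THEN conjunct2, THEN conjunct1] by blast
  note b = tclamp_bounded[of T L vh, OF T_pos L(1) hat_periodic(1)] tclamp_bounded[of T L Fh, OF T_pos L(2) hat_periodic(2)]
  show "\<exists>B. \<forall>z. norm (V z) \<le> B" "\<exists>B. \<forall>z. norm (W z) \<le> B" unfolding V_def W_def by (rule b)+
  then obtain B where B: "\<And>z. norm (W z) \<le> B" by blast
  have "norm (S z) \<le> norm (DG 0) + M * B" for z
  proof -
    have "norm (S z) \<le> norm (DG 0) + M * norm (W z)"
      using DG_lipschitz[of "W z" 0] norm_triangle_sub[of "S z" "DG 0"] by (simp add: S_def)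
    also have "M * norm (W z) \<le> M * B" using B M_pos by (intro mult_left_mono) auto
    finally show ?thesis by simp
  qed
  then show "\<exists>B. \<forall>z. norm (S z) \<le> B" by blast
  show "V (z + (2 * pi) *\<^sub>R xdir k) = V z" "W (z + (2 * pi) *\<^sub>R xdir k) = W z" unfolding V_def W_def by (rule b)+
  then show "S (z + (2 * pi) *\<^sub>R xdir k) = S z" by (simp add: S_def)
qed

lemma component_lipschitz:
  "L-lipschitz_on UNIV f \<Longrightarrow> L-lipschitz_on UNIV (\<lambda>z. f z $ i)"
  "L-lipschitz_on UNIV h \<Longrightarrow> L-lipschitz_on UNIV (\<lambda>z. h z $ i $ j)"
  for f :: "vec3 \<times> real \<Rightarrow> vec3" and h :: "vec3 \<times> real \<Rightarrow> mat3"
proof -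
  have *: "\<bar>x $ i - y $ i\<bar> \<le> norm (x - y)" for x y :: vec3
    using component_le_norm_cart[of "x - y" i] by simp
  have **: "\<bar>x $ i $ j - y $ i $ j\<bar> \<le> norm (x - y)" for x y :: mat3
    using component_le_norm_cart[of "(x - y) $ i" j] Finite_Cartesian_Product.norm_nth_le[of "x - y" i] by simp
  show "L-lipschitz_on UNIV (\<lambda>z. f z $ i)" if "L-lipschitz_on UNIV f"
    using lipschitz_onD[OF that] lipschitz_on_nonneg[OF that] order_trans[OF *]
    by (intro lipschitz_onI) (simp_all add: dist_norm)
  show "L-lipschitz_on UNIV (\<lambda>z. h z $ i $ j)" if "L-lipschitz_on UNIV h"
    using lipschitz_onD[OF that] lipschitz_on_nonneg[OF that] order_trans[OF **]
    by (intro lipschitz_onI) (simp_all add: dist_norm)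
qed

lemma hat_admissible:
  "admissible (\<lambda>z. V z $ i)" "admissible (\<lambda>z. W z $ i $ j)" "admissible (\<lambda>z. S z $ i $ j)" "admissible (\<lambda>z. G (W z))"
proof -
  obtain L where L: "L-lipschitz_on UNIV V" "L-lipschitz_on UNIV W" "L-lipschitz_on UNIV S" using hat_lipschitz by blast
  obtain B where B: "\<And>z. norm (V z) \<le> B" using hat_bounded(1) by blast
  obtain C where C: "\<And>z. norm (W z) \<le> C" using hat_bounded(2) by blast
  obtain D where D: "\<And>z. norm (S z) \<le> D" using hat_bounded(3) by blast
  have nn: "\<bar>A $ i $ j\<bar> \<le> norm A" for A :: mat3
    using component_le_norm_cart[of "A $ i" j] Finite_Cartesian_Product.norm_nth_le[of A i] by simp
  have "\<bar>V z $ i\<bar> \<le> B" for z using component_le_norm_cart[of "V z" i] B[of z] by simp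
  then show "admissible (\<lambda>z. V z $ i)"
    unfolding admissible_def hat_shift using component_lipschitz(1)[OF L(1)] by blast
  have "\<bar>W z $ i $ j\<bar> \<le> C" for z using nn[of "W z"] C[of z] by simp
  then show "admissible (\<lambda>z. W z $ i $ j)"
    unfolding admissible_def hat_shift using component_lipschitz(2)[OF L(2)] by blast
  have "\<bar>S z $ i $ j\<bar> \<le> D" for z using nn[of "S z"] D[of z] by simp
  then show "admissible (\<lambda>z. S z $ i $ j)"
    unfolding admissible_def hat_shift using component_lipschitz(2)[OF L(3)] by blast
  have C0: "0 \<le> C" using C[of 0] norm_ge_zero[of "W 0"] by linarith
  have D0: "0 \<le> D" using D[of 0] norm_ge_zero[of "S 0"] by linarith
  have L0: "0 \<le> L" using lipschitz_on_nonneg[OF L(1)] .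
  \<comment> \<open>\<open>G\<close> itself is not globally Lipschitz, but \<open>W\<close> has
    bounded range: one factor of the quadratic remainder is at most \<open>2 * C\<close>, which
    leaves the slope \<open>D + M * C\<close>.\<close>
  have diff: "\<bar>G (W x) - G (W y)\<bar> \<le> (D + M * C) * norm (W x - W y)" for x y
  proof -
    let ?d = "W x - W y"
    have d: "norm ?d \<le> 2 * C" using norm_triangle_ineq4[of "W x" "W y"] C[of x] C[of y] by linarith
    have "M / 2 * (norm ?d)\<^sup>2 \<le> M / 2 * ((2 * C) * norm ?d)"
      unfolding power2_eq_square using d M_pos by (intro mult_left_mono mult_right_mono) auto
    moreover have "0 \<le> G_rel (W x) (W y)"
      using G_rel_lower[of "W x" "W y"] m_pos by (smt (verit) mult_nonneg_nonneg divide_nonneg_nonneg zero_le_power2)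
    moreover have "\<bar>S y \<bullet> ?d\<bar> \<le> D * norm ?d"
      using order_trans[OF Cauchy_Schwarz_ineq2 mult_right_mono[OF D[of y] norm_ge_zero]] .
    ultimately show ?thesis
      using G_rel_upper[of "W x" "W y"] unfolding G_rel_def S_def distrib_right by (simp add: mult.assoc)
  qed
  have "((D + M * C) * L)-lipschitz_on UNIV (\<lambda>z. G (W z))"
  proof (rule lipschitz_onI)
    show "0 \<le> (D + M * C) * L" using C0 D0 L0 M_pos by simp
    fix x y
    have "\<bar>G (W x) - G (W y)\<bar> \<le> (D + M * C) * norm (W x - W y)" by (rule diff)
    also have "\<dots> \<le> (D + M * C) * (L * dist x y)"
      using lipschitz_onD[OF L(2), of x y] C0 D0 M_pos by (intro mult_left_mono) (auto simp: dist_norm)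
    finally show "dist (G (W x)) (G (W y)) \<le> (D + M * C) * L * dist x y" by (simp add: dist_real_def mult.assoc)
  qed
  moreover have "\<bar>G (W z)\<bar> \<le> G 0 + (norm (DG 0))\<^sup>2 + (1 + M) * C\<^sup>2" for z
  proof -
    have "(1 + M) * (norm (W z))\<^sup>2 \<le> (1 + M) * C\<^sup>2"
      using C[of z] M_pos by (intro mult_left_mono power_mono) auto
    then show ?thesis using G_growth[of "W z"] G_nonneg[of "W z"] by simp
  qed
  ultimately show "admissible (\<lambda>z. G (W z))"
    unfolding admissible_def hat_shift by blast
qed

lemma admissible_borel: "admissible f \<Longrightarrow> f \<in> borel_measurable borel"
  unfolding admissible_def by (auto intro: lipschitz_borel)

lemmas hat_borel [measurable] = hat_admissible[THEN admissible_borel]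

lemma hat_deriv_borel [measurable]:
  "Vt i \<in> borel_measurable borel" "Vx i j \<in> borel_measurable borel" "Wt i j \<in> borel_measurable borel"
  "St i j \<in> borel_measurable borel" "Sx i j k \<in> borel_measurable borel"
  unfolding Vt_def Vx_def Wt_def St_def Sx_def by (intro dir_deriv_borel hat_borel)+

text \<open>In the interior of the time interval freezing changes nothing nearby, so the partial
  derivatives of the classical solution are directional derivatives of the extended functions. The
  last two clauses are the system itself: momentum balance and compatibility.\<close>

lemma hat_derivatives: "AE z in lborel. z \<in> QO T \<longrightarrow>
    (\<forall>i. has_dir_deriv (\<lambda>z. V z $ i) tdir z (Vt i z)) \<and> (\<forall>i j. has_dir_deriv (\<lambda>z. V z $ i) (xdir j) z (Vx i j z)) \<and>
    (\<forall>i j. has_dir_deriv (\<lambda>z. W z $ i $ j) tdir z (Wt i j z)) \<and>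
    (\<forall>i j. has_dir_deriv (\<lambda>z. S z $ i $ j) tdir z (St i j z)) \<and>
    (\<forall>i j k. has_dir_deriv (\<lambda>z. S z $ i $ j) (xdir k) z (Sx i j k z)) \<and>
    (\<forall>i. Vt i z = (\<Sum>j\<in>UNIV. Sx i j j z)) \<and> (\<forall>i j. Wt i j z = Vx i j z)"
  using hat[unfolded lipschitz_solution_def, THEN conjunct2, THEN conjunct2]
proof eventually_elim
  case (elim z)
  show ?case
  proof
    assume zQ: "z \<in> QO T"
    obtain x t where z: "z = (x, t)" by (cases z)
    have "(x, t) \<in> QT T" using subsetD[OF QO_subset_QT zQ] by (simp only: z)
    then have x: "x \<in> Qcell" by (simp add: QT_def)
    have t: "0 < t" "t < T" using zQ by (simp_all add: z QO_def)
    have pd: "\<And>i. has_pds (\<lambda>x t. vh x t $ i) x t" "\<And>i j. has_pds (\<lambda>x t. Fh x t $ i $ j) x t"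
      "\<And>i j. has_pds (\<lambda>x t. DG (Fh x t) $ i $ j) x t"
      and eq: "\<And>i. pdt (\<lambda>x t. vh x t $ i) x t = (\<Sum>j\<in>UNIV. pdx j (\<lambda>x t. DG (Fh x t) $ i $ j) x t)"
      "\<And>i j. pdt (\<lambda>x t. Fh x t $ i $ j) x t = pdx j (\<lambda>x t. vh x t $ i) x t"
      using elim t x by (simp_all add: z)
    have VWS: "(\<lambda>z. V z $ i) = tclamp T (\<lambda>x t. vh x t $ i)" "(\<lambda>z. W z $ i $ j) = tclamp T (\<lambda>x t. Fh x t $ i $ j)"
      "(\<lambda>z. S z $ i $ j) = tclamp T (\<lambda>x t. DG (Fh x t) $ i $ j)" for i j
      by (auto simp: V_def W_def S_def tclamp_def fun_eq_iff)
    have d: "has_dir_deriv (\<lambda>z. V z $ i) tdir z (pdt (\<lambda>x t. vh x t $ i) x t)"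
      "has_dir_deriv (\<lambda>z. V z $ i) (xdir k) z (pdx k (\<lambda>x t. vh x t $ i) x t)"
      "has_dir_deriv (\<lambda>z. W z $ i $ j) tdir z (pdt (\<lambda>x t. Fh x t $ i $ j) x t)"
      "has_dir_deriv (\<lambda>z. S z $ i $ j) tdir z (pdt (\<lambda>x t. DG (Fh x t) $ i $ j) x t)"
      "has_dir_deriv (\<lambda>z. S z $ i $ j) (xdir k) z (pdx k (\<lambda>x t. DG (Fh x t) $ i $ j) x t)" for i j k
      unfolding VWS z using pd t unfolding has_pds_def by (auto intro!: has_dir_deriv_tdir has_dir_deriv_xdir)
    have e: "Vt i z = pdt (\<lambda>x t. vh x t $ i) x t" "Vx i k z = pdx k (\<lambda>x t. vh x t $ i) x t"
      "Wt i j z = pdt (\<lambda>x t. Fh x t $ i $ j) x t" "St i j z = pdt (\<lambda>x t. DG (Fh x t) $ i $ j) x t"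
      "Sx i j k z = pdx k (\<lambda>x t. DG (Fh x t) $ i $ j) x t" for i j k
      unfolding Vt_def Vx_def Wt_def St_def Sx_def by (intro dir_deriv_eq d)+
    show "(\<forall>i. has_dir_deriv (\<lambda>z. V z $ i) tdir z (Vt i z)) \<and> (\<forall>i j. has_dir_deriv (\<lambda>z. V z $ i) (xdir j) z (Vx i j z)) \<and>
      (\<forall>i j. has_dir_deriv (\<lambda>z. W z $ i $ j) tdir z (Wt i j z)) \<and>
      (\<forall>i j. has_dir_deriv (\<lambda>z. S z $ i $ j) tdir z (St i j z)) \<and>
      (\<forall>i j k. has_dir_deriv (\<lambda>z. S z $ i $ j) (xdir k) z (Sx i j k z)) \<and>
      (\<forall>i. Vt i z = (\<Sum>j\<in>UNIV. Sx i j j z)) \<and> (\<forall>i j. Wt i j z = Vx i j z)"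
      unfolding e by (intro conjI allI d eq)
  qed
qed

text \<open>Along the time direction \<open>W\<close> is a differentiable curve in the space of
  matrices, because its entries are differentiable, and the total derivatives of \<open>G\<close>
  and \<open>DG\<close> apply to that curve. The second identity computes the derivative of
  \<open>S z \<bullet> Z\<close> for a fixed \<open>Z\<close> in two ways.\<close>

lemma chain_rules:
  assumes "\<And>i j. has_dir_deriv (\<lambda>z. W z $ i $ j) tdir z (Wt i j z)"
    and "\<And>i j. has_dir_deriv (\<lambda>z. S z $ i $ j) tdir z (St i j z)"
  shows "has_dir_deriv (\<lambda>z. G (W z)) tdir z (\<Sum>i\<in>UNIV. \<Sum>j\<in>UNIV. S z $ i $ j * Wt i j z)"
    and "(\<Sum>i\<in>UNIV. \<Sum>j\<in>UNIV. St i j z * Z $ i $ j) = D2G (W z) (\<chi> i j. Wt i j z) Z"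
proof -
  define Q :: mat3 where "Q = (\<chi> i j. Wt i j z)"
  have dW: "((\<lambda>s. W (z + s *\<^sub>R tdir)) has_derivative (\<lambda>h. h *\<^sub>R Q)) (at 0)"
    by (rule has_derivative_mat3) (use assms(1) in \<open>simp add: has_dir_deriv_def Q_def\<close>)
  have c: "has_dir_deriv (\<lambda>z. f (W z)) tdir z (f' Q)" if "(f has_derivative f') (at (W z))" for f :: "mat3 \<Rightarrow> real" and f'
  proof -
    have "(f has_derivative f') (at (W (z + 0 *\<^sub>R tdir)))" using that by simp
    from has_derivative_compose[OF dW this]
    have "((\<lambda>s. f (W (z + s *\<^sub>R tdir))) has_derivative (\<lambda>h. f' (h *\<^sub>R Q))) (at 0)" .
    moreover have "f' (h *\<^sub>R Q) = f' Q * h" for h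
      using linear_cmul[OF has_derivative_linear[OF that]] by simp
    ultimately show ?thesis by (simp add: has_dir_deriv_def has_field_derivative_def)
  qed
  show "has_dir_deriv (\<lambda>z. G (W z)) tdir z (\<Sum>i\<in>UNIV. \<Sum>j\<in>UNIV. S z $ i $ j * Wt i j z)"
    using c[OF G_deriv] by (simp add: mat3_inner Q_def S_def)
  have "has_dir_deriv (\<lambda>z. S z \<bullet> Z) tdir z (D2G (W z) Q Z)"
    using c[OF DG_deriv[of Z]] by (simp add: S_def)
  moreover have "has_dir_deriv (\<lambda>z. S z \<bullet> Z) tdir z (\<Sum>i\<in>UNIV. \<Sum>j\<in>UNIV. St i j z * Z $ i $ j + 0 * S z $ i $ j)"
    unfolding mat3_inner by (intro has_dir_deriv_sum has_dir_deriv_mult has_dir_deriv_const assms)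
  ultimately show "(\<Sum>i\<in>UNIV. \<Sum>j\<in>UNIV. St i j z * Z $ i $ j) = D2G (W z) (\<chi> i j. Wt i j z) Z"
    unfolding Q_def by (auto dest: has_dir_deriv_unique)
qed

text \<open>Write \<open>Q\<close> for the matrix of time derivatives of \<open>W\<close>. By the
  chain rule the second group of terms is \<open>D2G (W z) Q (A - W z)\<close>; symmetry exchanges
  its arguments and makes it the linear part of the increment of \<open>DG\<close> contracted with
  \<open>Q\<close>. Only the Taylor remainder is left.\<close>

lemma relative_stress_bound:
  assumes "\<And>i j. has_dir_deriv (\<lambda>z. W z $ i $ j) tdir z (Wt i j z)"
    and "\<And>i j. has_dir_deriv (\<lambda>z. S z $ i $ j) tdir z (St i j z)"
  shows "(\<Sum>i\<in>UNIV. \<Sum>j\<in>UNIV. (DG A $ i $ j - S z $ i $ j) * Wt i j z - (A $ i $ j - W z $ i $ j) * St i j z)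
    \<le> M / 2 * (norm (A - W z))\<^sup>2 * norm (\<chi> i j. Wt i j z)"
proof -
  define Q :: mat3 where "Q = (\<chi> i j. Wt i j z)"
  have "(\<Sum>i\<in>UNIV. \<Sum>j\<in>UNIV. (A $ i $ j - W z $ i $ j) * St i j z) = D2G (W z) Q (A - W z)"
    using chain_rules(2)[OF assms, of "A - W z"] by (simp add: Q_def mult.commute)
  moreover have "(\<Sum>i\<in>UNIV. \<Sum>j\<in>UNIV. (DG A $ i $ j - S z $ i $ j) * Wt i j z) = (DG A - DG (W z)) \<bullet> Q"
    by (simp add: mat3_inner Q_def S_def)
  ultimately have "(\<Sum>i\<in>UNIV. \<Sum>j\<in>UNIV. (DG A $ i $ j - S z $ i $ j) * Wt i j z - (A $ i $ j - W z $ i $ j) * St i j z)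
      = (DG A - DG (W z)) \<bullet> Q - D2G (W z) (A - W z) Q"
    by (simp only: sum_subtractf D2G_commute[of "W z" "A - W z" Q])
  also have "\<dots> \<le> M / 2 * (norm (A - W z))\<^sup>2 * norm Q"
    using DG_taylor[of A "W z" Q] by linarith
  finally show ?thesis by (simp only: Q_def)
qed

end

text \<open>A relation instead of an integral operator: value and integrability are carried
  together, so integrals of long linear combinations are assembled by rules without separate
  integrability goals.\<close>

definition hI :: "'a::euclidean_space set \<Rightarrow> ('a \<Rightarrow> real) \<Rightarrow> real \<Rightarrow> bool" where
  "hI A f I \<longleftrightarrow> has_bochner_integral lborel (\<lambda>z. indicator A z * f z) I"

lemma hI_add: "hI S f a \<Longrightarrow> hI S g b \<Longrightarrow> hI S (\<lambda>z. f z + g z) (a + b)"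
  unfolding hI_def distrib_left by (rule has_bochner_integral_add)

lemma hI_diff: "hI S f a \<Longrightarrow> hI S g b \<Longrightarrow> hI S (\<lambda>z. f z - g z) (a - b)"
  unfolding hI_def right_diff_distrib by (rule has_bochner_integral_diff)

lemma hI_sum: "(\<And>i. i \<in> J \<Longrightarrow> hI S (f i) (a i)) \<Longrightarrow> hI S (\<lambda>z. \<Sum>i\<in>J. f i z) (\<Sum>i\<in>J. a i)"
  unfolding hI_def sum_distrib_left by (rule has_bochner_integral_sum)

lemma hI_cmult: "hI S f a \<Longrightarrow> hI S (\<lambda>z. c * f z) (c * a)"
  unfolding hI_def mult.left_commute[of _ c] by (rule has_bochner_integral_mult_right) simp

lemma hI_cong: "hI A f a \<Longrightarrow> (\<And>z. z \<in> A \<Longrightarrow> f z = g z) \<Longrightarrow> hI A g a"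
proof -
  assume f: "hI A f a" and eq: "\<And>z. z \<in> A \<Longrightarrow> f z = g z"
  have "(\<lambda>z. indicator A z * f z) = (\<lambda>z. indicator A z * g z)" using eq by (auto simp: indicator_def)
  then show "hI A g a" using f by (simp add: hI_def)
qed

section \<open>Integrals over the cylinder with essentially bounded coefficients\<close>

context dissipative_setting
begin

abbreviation hQ :: "(vec3 \<times> real \<Rightarrow> real) \<Rightarrow> real \<Rightarrow> bool" where
  "hQ \<equiv> hI (QT T)"

definition IQ :: "(vec3 \<times> real \<Rightarrow> real) \<Rightarrow> real" where
  "IQ f = (LINT z|lborel. indicator (QT T) z * f z)"

definition I0 :: "(vec3 \<Rightarrow> real) \<Rightarrow> real" where
  "I0 f = (LINT x|lborel. indicator Qcell x * f x)"

lemma hQ_IQ: "hQ f a \<Longrightarrow> IQ f = a"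
  unfolding hI_def IQ_def by (rule has_bochner_integral_integral_eq)

lemma hQ_le:
  assumes f: "hQ f a" and g: "hQ g b" and le: "AE z in lborel. z \<in> QO T \<longrightarrow> f z \<le> g z"
  shows "a \<le> b"
proof -
  have "(LINT z|lborel. indicator (QT T) z * f z) \<le> (LINT z|lborel. indicator (QT T) z * g z)"
  proof (rule integral_mono_AE)
    show "integrable lborel (\<lambda>z. indicator (QT T) z * f z)" "integrable lborel (\<lambda>z. indicator (QT T) z * g z)"
      using f g unfolding hI_def by (auto dest: integrable.intros)
    show "AE z in lborel. indicator (QT T) z * f z \<le> indicator (QT T) z * g z"
      using le AE_QT_QO[of T] by eventually_elim (auto simp: indicator_def)
  qed
  then show ?thesis using hQ_IQ[OF f] hQ_IQ[OF g] by (simp add: IQ_def)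
qed

lemma hQ_unique:
  assumes f: "hQ f a" and g: "hQ g b" and eq: "AE z in lborel. z \<in> QO T \<longrightarrow> f z = g z"
  shows "a = b"
proof (rule antisym)
  show "a \<le> b" by (rule hQ_le[OF f g]) (use eq in eventually_elim, simp)
  show "b \<le> a" by (rule hQ_le[OF g f]) (use eq in eventually_elim, simp)
qed

text \<open>The class of coefficients by which an integrable mean may be multiplied. The bound holds
  only almost everywhere because derivatives of the classical solution exist only there.\<close>

definition ess_bdd :: "(vec3 \<times> real \<Rightarrow> real) \<Rightarrow> bool" where
  "ess_bdd g \<longleftrightarrow> g \<in> borel_measurable borel \<and> (\<exists>B. AE z in lborel. z \<in> QO T \<longrightarrow> \<bar>g z\<bar> \<le> B)"

lemma ess_bdd_mult: assumes "ess_bdd f" "ess_bdd g" shows "ess_bdd (\<lambda>z. f z * g z)"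
proof -
  from assms obtain A B where m[measurable]: "f \<in> borel_measurable borel" "g \<in> borel_measurable borel"
    and A: "AE z in lborel. z \<in> QO T \<longrightarrow> \<bar>f z\<bar> \<le> A" and B: "AE z in lborel. z \<in> QO T \<longrightarrow> \<bar>g z\<bar> \<le> B"
    unfolding ess_bdd_def by blast
  have "AE z in lborel. z \<in> QO T \<longrightarrow> \<bar>f z * g z\<bar> \<le> \<bar>A\<bar> * \<bar>B\<bar>"
    using A B
  proof eventually_elim
    case (elim z)
    show ?case
      unfolding abs_mult using elim by (intro impI mult_mono) auto
  qed
  moreover have "(\<lambda>z. f z * g z) \<in> borel_measurable borel" by measurable
  ultimately show ?thesis unfolding ess_bdd_def by blast
qed

lemma ess_bdd_admissible: assumes "admissible f" shows "ess_bdd f"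
proof -
  obtain B where "\<And>z. \<bar>f z\<bar> \<le> B" using assms unfolding admissible_def by blast
  then have "AE z in lborel. z \<in> QO T \<longrightarrow> \<bar>f z\<bar> \<le> B" by (intro AE_I2 impI)
  then show ?thesis unfolding ess_bdd_def using admissible_borel[OF assms] by blast
qed

lemma ess_bdd_dir_deriv:
  assumes f: "L-lipschitz_on UNIV f" and e: "norm e = 1" and g: "g \<in> borel_measurable borel"
    and der: "AE z in lborel. z \<in> QO T \<longrightarrow> has_dir_deriv f e z (g z)"
  shows "AE z in lborel. z \<in> QO T \<longrightarrow> \<bar>g z\<bar> \<le> L"
  using der
proof eventually_elim
  case (elim z)
  show ?case
  proof
    assume "z \<in> QO T"
    then have "((\<lambda>s. f (z + s *\<^sub>R e)) has_real_derivative g z) (at 0)" using elim by (simp add: has_dir_deriv_def)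
    then show "\<bar>g z\<bar> \<le> L" by (rule directional_derivative_bound) (rule lipschitz_direction_bound[OF f e])
  qed
qed

lemma hat_deriv_bound:
  "\<exists>L. (\<forall>i. AE z in lborel. z \<in> QO T \<longrightarrow> \<bar>Vt i z\<bar> \<le> L) \<and> (\<forall>i j. AE z in lborel. z \<in> QO T \<longrightarrow> \<bar>Vx i j z\<bar> \<le> L)
    \<and> (\<forall>i j. AE z in lborel. z \<in> QO T \<longrightarrow> \<bar>Wt i j z\<bar> \<le> L) \<and> (\<forall>i j. AE z in lborel. z \<in> QO T \<longrightarrow> \<bar>St i j z\<bar> \<le> L)
    \<and> (\<forall>i j k. AE z in lborel. z \<in> QO T \<longrightarrow> \<bar>Sx i j k z\<bar> \<le> L)"
proof -
  obtain L where L: "L-lipschitz_on UNIV V" "L-lipschitz_on UNIV W" "L-lipschitz_on UNIV S" using hat_lipschitz by blast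
  have 1: "AE z in lborel. z \<in> QO T \<longrightarrow> \<bar>Vt i z\<bar> \<le> L" for i
    by (rule ess_bdd_dir_deriv[OF component_lipschitz(1)[OF L(1)] norm_tdir hat_deriv_borel(1)])
      (use hat_derivatives in eventually_elim, blast)
  have 2: "AE z in lborel. z \<in> QO T \<longrightarrow> \<bar>Vx i j z\<bar> \<le> L" for i j
    by (rule ess_bdd_dir_deriv[OF component_lipschitz(1)[OF L(1)] norm_xdir hat_deriv_borel(2)])
      (use hat_derivatives in eventually_elim, blast)
  have 3: "AE z in lborel. z \<in> QO T \<longrightarrow> \<bar>Wt i j z\<bar> \<le> L" for i j
    by (rule ess_bdd_dir_deriv[OF component_lipschitz(2)[OF L(2)] norm_tdir hat_deriv_borel(3)])
      (use hat_derivatives in eventually_elim, blast)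
  have 4: "AE z in lborel. z \<in> QO T \<longrightarrow> \<bar>St i j z\<bar> \<le> L" for i j
    by (rule ess_bdd_dir_deriv[OF component_lipschitz(2)[OF L(3)] norm_tdir hat_deriv_borel(4)])
      (use hat_derivatives in eventually_elim, blast)
  have 5: "AE z in lborel. z \<in> QO T \<longrightarrow> \<bar>Sx i j k z\<bar> \<le> L" for i j k
    by (rule ess_bdd_dir_deriv[OF component_lipschitz(2)[OF L(3)] norm_xdir hat_deriv_borel(5)])
      (use hat_derivatives in eventually_elim, blast)
  show ?thesis using 1 2 3 4 5 by blast
qed

lemma ess_bdd_hat: "ess_bdd (Vt i)" "ess_bdd (Vx i j)" "ess_bdd (Wt i j)" "ess_bdd (St i j)" "ess_bdd (Sx i j k)"
  unfolding ess_bdd_def using hat_deriv_bound hat_deriv_borel by blast+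

lemma hQ_mean:
  assumes g: "ess_bdd g" and w: "integrable lborel (\<lambda>z. indicator (QT T) z * w z)"
  shows "hQ (\<lambda>z. g z * w z) (IQ (\<lambda>z. g z * w z))"
proof -
  obtain B where [measurable]: "g \<in> borel_measurable borel" and B: "AE z in lborel. z \<in> QO T \<longrightarrow> \<bar>g z\<bar> \<le> B"
    using g unfolding ess_bdd_def by blast
  have [measurable]: "QT T \<in> sets borel" by (rule QT_borel)
  have "integrable lborel (\<lambda>z. (indicator (QT T) z * w z) * (indicator (QT T) z * g z))"
  proof (rule integrable_mult_bounded[OF _ w])
    show "AE z in lborel. \<bar>indicator (QT T) z * g z\<bar> \<le> \<bar>B\<bar>"
      using B AE_QT_QO[of T] by eventually_elim (auto simp: indicator_def)
  qed measurable
  moreover have "(\<lambda>z. (indicator (QT T) z * w z) * (indicator (QT T) z * g z)) = (\<lambda>z. indicator (QT T) z * (g z * w z))"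
    by (auto simp: indicator_def)
  ultimately have "integrable lborel (\<lambda>z. indicator (QT T) z * (g z * w z))" by simp
  then show ?thesis unfolding hI_def IQ_def by (rule has_bochner_integral_integrable)
qed

lemma hQ_bd: "ess_bdd g \<Longrightarrow> hQ g (IQ g)"
  using hQ_mean[of g "\<lambda>_. 1"] emeasure_QT_finite[of T] by simp

end

text \<open>The weight is given and continuously differentiable on the whole line, so no one-sided
  derivative at time 0 arises. It is instantiated twice: by the adjoint weight for stability and by
  a squared positive part for the concentration measure.\<close>

locale test_weight = dissipative_setting +
  fixes \<theta> \<theta>' :: "real \<Rightarrow> real" and \<tau> :: real
  assumes \<theta>_deriv: "\<And>t. (\<theta> has_real_derivative \<theta>' t) (at t)"
    and \<theta>'_cont: "continuous_on UNIV \<theta>'"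
    and \<theta>_nonneg: "\<And>t. 0 \<le> t \<Longrightarrow> 0 \<le> \<theta> t"
    and \<theta>_support: "\<tau> < T" "\<And>t. \<tau> \<le> t \<Longrightarrow> \<theta> t = 0"
begin

text \<open>Freezing makes the weight bounded and globally Lipschitz. In contrast
  \<open>\<Theta>t\<close> is not frozen; it is the time derivative of \<open>\<Theta>\<close> in
  the interior of the cylinder.\<close>

definition \<Theta> :: "vec3 \<times> real \<Rightarrow> real" where "\<Theta> = tclamp T (\<lambda>x. \<theta>)"
definition \<Theta>t :: "vec3 \<times> real \<Rightarrow> real" where "\<Theta>t z = \<theta>' (snd z)"

lemma \<theta>'_borel [measurable]: "\<theta>' \<in> borel_measurable borel"
  by (intro borel_measurable_continuous_onI \<theta>'_cont)

lemma \<Theta>_admissible: "admissible \<Theta>"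
proof -
  have "compact (\<theta>' ` {0..T})"
    by (intro compact_continuous_image continuous_on_subset[OF \<theta>'_cont] compact_Icc) simp
  then have "bounded (\<theta>' ` {0..T})" by (rule compact_imp_bounded)
  then obtain B where "\<forall>y\<in>\<theta>' ` {0..T}. norm y \<le> B"
    unfolding bounded_iff by blast
  then have B: "\<bar>\<theta>' t\<bar> \<le> B" if "t \<in> {0..T}" for t using that by simp
  have B0: "0 \<le> B" using B[of 0] T_pos by simp
  have "B-lipschitz_on {0..T} \<theta>"
  proof (rule bounded_derivative_imp_lipschitz)
    show "(\<theta> has_derivative (\<lambda>h. \<theta>' t * h)) (at t within {0..T})" for t
      using \<theta>_deriv[of t] by (auto simp: has_field_derivative_def intro: has_derivative_at_withinI)
    show "onorm (\<lambda>h. \<theta>' t * h) \<le> B" if "t \<in> {0..T}" for t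
      using B[OF that] by (intro onorm_bound B0) (auto simp: abs_mult mult_right_mono)
  qed (use B0 in simp_all)
  note lip\<theta> = this
  have lip: "B-lipschitz_on (UNIV \<times> {0..T}) (\<lambda>z :: vec3 \<times> real. \<theta> (snd z))"
  proof (rule lipschitz_onI[OF _ B0])
    fix x y :: "vec3 \<times> real" assume "x \<in> UNIV \<times> {0..T}" "y \<in> UNIV \<times> {0..T}"
    then have "dist (\<theta> (snd x)) (\<theta> (snd y)) \<le> B * dist (snd x) (snd y)"
      by (intro lipschitz_onD[OF lip\<theta>]) auto
    also have "\<dots> \<le> B * dist x y" using B0 by (intro mult_left_mono dist_snd_le)
    finally show "dist (\<theta> (snd x)) (\<theta> (snd y)) \<le> B * dist x y" .
  qed
  have per: "periodic3 (\<lambda>x. \<theta> t)" for t by (simp add: periodic3_def)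
  show ?thesis
    unfolding admissible_def \<Theta>_def
    using lipschitz_tclamp[of T B "\<lambda>x. \<theta>", OF T_pos lip] tclamp_bounded[of T B "\<lambda>x. \<theta>", OF T_pos lip per] by auto
qed

lemma \<Theta>_deriv:
  assumes "z \<in> QO T"
  shows "has_dir_deriv \<Theta> tdir z (\<Theta>t z)" "has_dir_deriv \<Theta> (xdir j) z 0"
proof -
  have t: "0 < snd z" "snd z < T" using assms by (simp_all add: QO_def)
  have "pdt (\<lambda>x. \<theta>) (fst z) (snd z) = \<Theta>t z"
    unfolding pdt_def \<Theta>t_def using DERIV_imp_deriv[OF \<theta>_deriv[of "snd z"]] by simp
  moreover have "\<theta> differentiable (at (snd z))"
    using \<theta>_deriv[of "snd z"] by (auto simp: real_differentiable_def)
  ultimately show "has_dir_deriv \<Theta> tdir z (\<Theta>t z)"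
    using has_dir_deriv_tdir[of "\<lambda>x. \<theta>" "fst z" "snd z" T] t by (simp add: \<Theta>_def)
  show "has_dir_deriv \<Theta> (xdir j) z 0"
    by (simp add: has_dir_deriv_def \<Theta>_def tclamp_def xdir_def)
qed

lemma \<Theta>_QO: "z \<in> QO T \<Longrightarrow> \<Theta> z = \<theta> (snd z)"
  by (simp add: QO_def \<Theta>_def tclamp_def clampT_id)

lemma \<Theta>_0: "\<Theta> (x, 0) = \<theta> 0"
  using T_pos by (simp add: \<Theta>_def tclamp_def clampT_id)

lemma \<Theta>_zero: "\<tau> \<le> t \<Longrightarrow> \<Theta> (x, t) = 0"
  using \<theta>_support(1) unfolding \<Theta>_def tclamp_def by (auto intro!: \<theta>_support(2) simp: clampT_def)

lemma \<Theta>_nonneg: "0 \<le> \<Theta> z"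
  using \<theta>_nonneg clampT_bounds[OF T_pos] by (simp add: \<Theta>_def tclamp_def)

lemma ess_bdd_\<Theta>: "ess_bdd \<Theta>" and ess_bdd_\<Theta>t: "ess_bdd \<Theta>t"
proof -
  show "ess_bdd \<Theta>" by (rule ess_bdd_admissible[OF \<Theta>_admissible])
  obtain L where L: "L-lipschitz_on UNIV \<Theta>" using \<Theta>_admissible unfolding admissible_def by blast
  have m: "\<Theta>t \<in> borel_measurable borel" unfolding \<Theta>t_def[abs_def] by measurable
  have "AE z in lborel. z \<in> QO T \<longrightarrow> \<bar>\<Theta>t z\<bar> \<le> L"
    by (rule ess_bdd_dir_deriv[OF L norm_tdir m]) (use \<Theta>_deriv in simp)
  then show "ess_bdd \<Theta>t" unfolding ess_bdd_def using m by blast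
qed

lemma test_product:
  assumes "admissible p"
  shows "admissible (\<lambda>z. \<Theta> z * p z)" "\<tau> \<le> t \<Longrightarrow> \<Theta> (x, t) * p (x, t) = 0"
    "z \<in> QO T \<Longrightarrow> has_dir_deriv p tdir z d \<Longrightarrow> has_dir_deriv (\<lambda>z. \<Theta> z * p z) tdir z (\<Theta>t z * p z + d * \<Theta> z)"
    "z \<in> QO T \<Longrightarrow> has_dir_deriv p (xdir j) z d \<Longrightarrow> has_dir_deriv (\<lambda>z. \<Theta> z * p z) (xdir j) z (0 * p z + d * \<Theta> z)"
  by (rule admissible_mult[OF \<Theta>_admissible assms]) (simp add: \<Theta>_zero, (intro has_dir_deriv_mult \<Theta>_deriv; assumption)+)

end

section \<open>Initial data and the weak equations tested with Lipschitz functions\<close>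

context dissipative_setting
begin

lemma integrable_Qcell_square_component:
  fixes f :: "vec3 \<Rightarrow> 'c::euclidean_space" and g :: "vec3 \<Rightarrow> real"
  assumes [measurable]: "f \<in> borel_measurable borel" "g \<in> borel_measurable borel"
    and f: "integrable lborel (\<lambda>x. indicator Qcell x * (norm (f x))\<^sup>2)"
    and g: "\<And>x. \<bar>g x\<bar> \<le> a + b * (norm (f x))\<^sup>2"
  shows "integrable lborel (\<lambda>x. indicator Qcell x * g x)"
proof (rule Bochner_Integration.integrable_bound)
  show "integrable lborel (\<lambda>x. a * indicator Qcell x + b * (indicator Qcell x * (norm (f x))\<^sup>2))"
    using f emeasure_Qcell_finite by simp
  show "AE x in lborel. norm (indicator Qcell x * g x) \<le> norm (a * indicator Qcell x + b * (indicator Qcell x * (norm (f x))\<^sup>2))"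
    using g by (intro AE_I2) (auto simp: indicator_def intro: order_trans[OF _ abs_ge_self])
qed measurable

lemma initial_component_measurable [measurable]: "(\<lambda>x. v0 x $ i) \<in> borel_measurable borel" "(\<lambda>x. F0 x $ i $ j) \<in> borel_measurable borel"
  using measurable_compose[OF measurable_Pair[OF v0_meas F0_meas, unfolded borel_prod] measurable_fst_nth, of i]
    measurable_compose[OF measurable_Pair[OF v0_meas F0_meas, unfolded borel_prod] measurable_snd_nth, of i j] by simp_all

lemma initial_integrable:
  "integrable lborel (\<lambda>x. indicator Qcell x * v0 x $ i)" "integrable lborel (\<lambda>x. indicator Qcell x * F0 x $ i $ j)"
  "integrable lborel (\<lambda>x. indicator Qcell x * eta G (v0 x) (F0 x))"
proof -
  have le: "x \<le> 1 + 1 * x\<^sup>2" for x :: real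
  proof -
    have "0 \<le> (x - 1 / 2)\<^sup>2" by simp
    then show ?thesis by (simp add: power2_eq_square algebra_simps)
  qed
  have "\<bar>v0 x $ i\<bar> \<le> 1 + 1 * (norm (v0 x))\<^sup>2" for x
    using order_trans[OF component_le_norm_cart le] .
  then show "integrable lborel (\<lambda>x. indicator Qcell x * v0 x $ i)"
    by (intro integrable_Qcell_square_component[OF v0_meas _ v0_sq]) measurable
  have "\<bar>F0 x $ i $ j\<bar> \<le> 1 + 1 * (norm (F0 x))\<^sup>2" for x
    using order_trans[OF order_trans[OF component_le_norm_cart Finite_Cartesian_Product.norm_nth_le] le] .
  then show "integrable lborel (\<lambda>x. indicator Qcell x * F0 x $ i $ j)"
    by (intro integrable_Qcell_square_component[OF F0_meas _ F0_sq]) measurable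
  have p: "(\<lambda>x. (v0 x, F0 x)) \<in> borel_measurable borel"
    using measurable_Pair[OF v0_meas F0_meas] by (simp add: borel_prod)
  have "(\<lambda>x. eta G (v0 x) (F0 x)) \<in> borel_measurable borel"
    using measurable_compose[OF p eta_borel] by simp
  then show "integrable lborel (\<lambda>x. indicator Qcell x * eta G (v0 x) (F0 x))"
  proof (rule integrable_Qcell_square_component[OF p])
    have "(norm (v0 x, F0 x))\<^sup>2 = sq (v0 x, F0 x)" for x by (simp add: norm_Pair sq_def)
    then show "\<bar>eta G (v0 x) (F0 x)\<bar> \<le> (G 0 + (norm (DG 0))\<^sup>2) + (1 + M) * (norm (v0 x, F0 x))\<^sup>2" for x
      using abs_eta_le_sq[of "(v0 x, F0 x)"] by simp
    have "(\<lambda>x. indicator Qcell x * (norm (v0 x, F0 x))\<^sup>2) = (\<lambda>x. indicator Qcell x * (norm (v0 x))\<^sup>2 + indicator Qcell x * (norm (F0 x))\<^sup>2)"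
      by (simp add: norm_Pair distrib_left)
    then show "integrable lborel (\<lambda>x. indicator Qcell x * (norm (v0 x, F0 x))\<^sup>2)"
      using v0_sq F0_sq by simp
  qed
qed

text \<open>The part of the relative entropy that only involves the classical solution, and its time
  derivative.\<close>

definition Kf :: "vec3 \<times> real \<Rightarrow> real" where
  "Kf z = (\<Sum>i\<in>UNIV. 1 / 2 * (V z $ i * V z $ i)) - G (W z) + (\<Sum>i\<in>UNIV. \<Sum>j\<in>UNIV. S z $ i $ j * W z $ i $ j)"

definition Kt :: "vec3 \<times> real \<Rightarrow> real" where
  "Kt z = (\<Sum>i\<in>UNIV. V z $ i * Vt i z) + (\<Sum>i\<in>UNIV. \<Sum>j\<in>UNIV. W z $ i $ j * St i j z)"

lemma Kf_admissible: "admissible Kf"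
  unfolding Kf_def[abs_def]
  by (intro admissible_add admissible_diff admissible_sum admissible_mult admissible_const hat_admissible)

lemma Kf_deriv: "AE z in lborel. z \<in> QO T \<longrightarrow> has_dir_deriv Kf tdir z (Kt z)"
  using hat_derivatives
proof eventually_elim
  case (elim z)
  show ?case
  proof
    assume "z \<in> QO T"
    then have d: "\<And>i. has_dir_deriv (\<lambda>z. V z $ i) tdir z (Vt i z)" "\<And>i j. has_dir_deriv (\<lambda>z. W z $ i $ j) tdir z (Wt i j z)"
      "\<And>i j. has_dir_deriv (\<lambda>z. S z $ i $ j) tdir z (St i j z)" using elim by blast+
    have "has_dir_deriv Kf tdir z ((\<Sum>i\<in>UNIV. 0 * (V z $ i * V z $ i) + (Vt i z * V z $ i + Vt i z * V z $ i) * (1 / 2))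
      - (\<Sum>i\<in>UNIV. \<Sum>j\<in>UNIV. S z $ i $ j * Wt i j z)
      + (\<Sum>i\<in>UNIV. \<Sum>j\<in>UNIV. St i j z * W z $ i $ j + Wt i j z * S z $ i $ j))"
      unfolding Kf_def[abs_def]
      by (intro has_dir_deriv_add has_dir_deriv_diff has_dir_deriv_sum has_dir_deriv_mult has_dir_deriv_const d chain_rules(1))
    \<comment> \<open>The derivative of \<open>G (W z)\<close> cancels the term of the product rule
      in which \<open>W\<close> is differentiated; hence \<open>Kt\<close> contains no time
      derivative of \<open>W\<close>.\<close>
    moreover have "(\<Sum>i\<in>UNIV. 0 * (V z $ i * V z $ i) + (Vt i z * V z $ i + Vt i z * V z $ i) * (1 / 2))
      - (\<Sum>i\<in>UNIV. \<Sum>j\<in>UNIV. S z $ i $ j * Wt i j z)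
      + (\<Sum>i\<in>UNIV. \<Sum>j\<in>UNIV. St i j z * W z $ i $ j + Wt i j z * S z $ i $ j) = Kt z"
      unfolding Kt_def sum.distrib by (simp add: mult.commute)
    ultimately show "has_dir_deriv Kf tdir z (Kt z)" by simp
  qed
qed

lemma weak_w_integrable: "set_integrable lborel (QT T) (\<lambda>z. v (fst z) (snd z) $ i)" "set_integrable lborel (QT T) (\<lambda>z. F (fst z) (snd z) $ i $ j)"
  and weak_w_eq: "AE z in lborel. indicator (QT T) z * v (fst z) (snd z) $ i = indicator (QT T) z * vb i z"
    "AE z in lborel. indicator (QT T) z * F (fst z) (snd z) $ i $ j = indicator (QT T) z * Fb i j z"
proof -
  show e1: "AE z in lborel. indicator (QT T) z * v (fst z) (snd z) $ i = indicator (QT T) z * vb i z" for i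
    using barycentre_components by eventually_elim (use QT_subset_QTbar[of T] in \<open>auto simp: indicator_def\<close>)
  show e2: "AE z in lborel. indicator (QT T) z * F (fst z) (snd z) $ i $ j = indicator (QT T) z * Fb i j z" for i j
    using barycentre_components by eventually_elim (use QT_subset_QTbar[of T] in \<open>auto simp: indicator_def\<close>)
  have [measurable]: "(\<lambda>x :: vec3. x $ i) \<in> borel_measurable borel" "(\<lambda>x :: mat3. x $ i $ j) \<in> borel_measurable borel" for i j
    by (intro borel_measurable_continuous_onI continuous_on_component continuous_on_id)+
  have i: "indicator (QT T) z * (indicator (QTbar T) z *\<^sub>R a) $ i = indicator (QT T) z * a $ i" for z i and a :: vec3
    using QT_subset_QTbar[of T] by (auto simp: indicator_def)
  have j: "indicator (QT T) z * (indicator (QTbar T) z *\<^sub>R a) $ i $ j = indicator (QT T) z * a $ i $ j" for z i j and a :: mat3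
    using QT_subset_QTbar[of T] by (auto simp: indicator_def)
  note [measurable] = measurable_compose[OF v_meas, of "\<lambda>x. x $ i" borel for i] measurable_compose[OF F_meas, of "\<lambda>x. x $ i $ j" borel for i j]
  have m1: "(\<lambda>z. indicator (QT T) z * v (fst z) (snd z) $ i) \<in> borel_measurable borel" for i
    unfolding i[symmetric, of _ "v _ _"] by measurable
  have m2: "(\<lambda>z. indicator (QT T) z * F (fst z) (snd z) $ i $ j) \<in> borel_measurable borel" for i j
    unfolding j[symmetric, of _ "F _ _"] by measurable
  show "set_integrable lborel (QT T) (\<lambda>z. v (fst z) (snd z) $ i)" for i
    unfolding set_integrable_def real_scaleR_def
    by (rule integrable_cong_AE_imp[OF means_integrable(1)[of i]]) (use m1 e1[of i] in auto)
  show "set_integrable lborel (QT T) (\<lambda>z. F (fst z) (snd z) $ i $ j)" for i j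
    unfolding set_integrable_def real_scaleR_def
    by (rule integrable_cong_AE_imp[OF means_integrable(2)[of i j]]) (use m2 e2[of i j] in auto)
qed

lemma LINT_QT_to_IQ:
  assumes w: "set_integrable lborel (QT T) w" and eq: "AE z in lborel. indicator (QT T) z * w z = indicator (QT T) z * u z"
    and [measurable]: "u \<in> borel_measurable borel" "g \<in> borel_measurable borel"
  shows "(LINT z:QT T|lborel. w z * g z) = IQ (\<lambda>z. g z * u z)"
  unfolding set_lebesgue_integral_def IQ_def
proof (rule integral_cong_AE)
  have [measurable]: "(\<lambda>z. indicator (QT T) z * w z) \<in> borel_measurable borel"
    using w unfolding set_integrable_def by (auto dest: borel_measurable_integrable)
  have "(\<lambda>z. (indicator (QT T) z * w z) * g z) \<in> borel_measurable borel" by measurable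
  then show "(\<lambda>z. indicator (QT T) z *\<^sub>R (w z * g z)) \<in> borel_measurable lborel" by (simp add: mult.assoc)
  show "(\<lambda>z. indicator (QT T) z * (g z * u z)) \<in> borel_measurable lborel" by measurable
  show "AE z in lborel. indicator (QT T) z *\<^sub>R (w z * g z) = indicator (QT T) z * (g z * u z)"
    using eq by eventually_elim (auto simp: indicator_def)
qed

lemma momentum_lipschitz_test:
  assumes adm: "admissible \<psi>" and \<tau>: "\<tau> < T" "\<And>x t. \<tau> \<le> t \<Longrightarrow> \<psi> (x, t) = 0"
    and meas: "pt \<in> borel_measurable borel" "\<And>j. px j \<in> borel_measurable borel"
    and dt: "AE z in lborel. z \<in> QO T \<longrightarrow> has_dir_deriv \<psi> tdir z (pt z)"
    and dx: "\<And>j. AE z in lborel. z \<in> QO T \<longrightarrow> has_dir_deriv \<psi> (xdir j) z (px j z)"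
  shows "I0 (\<lambda>x. \<psi> (x, 0) * v0 x $ i) + IQ (\<lambda>z. pt z * vb i z) = (\<Sum>j\<in>UNIV. IQ (\<lambda>z. px j z * Pb i j z))"
proof -
  obtain L where L: "L-lipschitz_on UNIV \<psi>" and per: "\<And>z k. \<psi> (z + (2 * pi) *\<^sub>R xdir k) = \<psi> z"
    using adm unfolding admissible_def by blast
  let ?P = "\<lambda>j z. ymean \<nu> (fst z) (snd z) (\<lambda>w. DG (snd w) $ i $ j)"
  have P: "indicator (QT T) z * ?P j z = indicator (QT T) z * Pb i j z" for j z
    using QT_subset_QTbar[of T] by (auto simp: indicator_def ymean_def Pb_def K_def)
  have iP: "set_integrable lborel (QT T) (?P j)" for j
    unfolding set_integrable_def real_scaleR_def P by (rule means_integrable)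
  have a: "set_integrable lborel Qcell (\<lambda>x. v0 x $ i)"
    using initial_integrable(1)[of i] by (simp add: set_integrable_def)
  have "(LINT x:Qcell|lborel. \<psi> (x, 0) * v0 x $ i) + (LINT z:QT T|lborel. v (fst z) (snd z) $ i * pt z)
        = (\<Sum>j\<in>UNIV. LINT z:QT T|lborel. ?P j z * px j z)"
  proof (rule weak_form_lipschitz_test[OF T_pos a weak_w_integrable(1) iP _ L per \<tau> meas dt dx])
    fix psi psit psix assume "test_QT T psi psit psix"
    from momentum[OF this, of i] show "(LINT x:Qcell|lborel. psi x 0 * v0 x $ i)
        + (LINT z:QT T|lborel. v (fst z) (snd z) $ i * psit (fst z) (snd z))
        = (\<Sum>j\<in>UNIV. LINT z:QT T|lborel. ?P j z * psix (fst z) (snd z) $ j)" .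
  qed
  then show ?thesis
    unfolding LINT_QT_to_IQ[OF weak_w_integrable(1) weak_w_eq(1) means_borel(1) meas(1)]
      LINT_QT_to_IQ[OF iP AE_I2[OF P] means_borel(3) meas(2)]
    by (simp add: I0_def set_lebesgue_integral_def)
qed

lemma compatibility_lipschitz_test:
  assumes adm: "admissible \<psi>" and \<tau>: "\<tau> < T" "\<And>x t. \<tau> \<le> t \<Longrightarrow> \<psi> (x, t) = 0"
    and meas: "pt \<in> borel_measurable borel" "\<And>j. px j \<in> borel_measurable borel"
    and dt: "AE z in lborel. z \<in> QO T \<longrightarrow> has_dir_deriv \<psi> tdir z (pt z)"
    and dx: "\<And>j. AE z in lborel. z \<in> QO T \<longrightarrow> has_dir_deriv \<psi> (xdir j) z (px j z)"
  shows "I0 (\<lambda>x. \<psi> (x, 0) * F0 x $ i $ j) + IQ (\<lambda>z. pt z * Fb i j z) = IQ (\<lambda>z. px j z * vb i z)"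
proof -
  obtain L where L: "L-lipschitz_on UNIV \<psi>" and per: "\<And>z k. \<psi> (z + (2 * pi) *\<^sub>R xdir k) = \<psi> z"
    using adm unfolding admissible_def by blast
  \<comment> \<open>The compatibility equation involves one spatial derivative only; a flux whose
    sole non-zero component is the \<open>j\<close>-th brings it into the general form.\<close>
  let ?w = "\<lambda>k z. if k = j then v (fst z) (snd z) $ i else 0"
  have iw: "set_integrable lborel (QT T) (?w k)" for k
    using weak_w_integrable(1)[of i] by (cases "k = j") (simp_all add: set_integrable_def)
  have a: "set_integrable lborel Qcell (\<lambda>x. F0 x $ i $ j)"
    using initial_integrable(2)[of i j] by (simp add: set_integrable_def)
  have single: "(\<Sum>k\<in>UNIV. LINT z:QT T|lborel. ?w k z * q z k) = (LINT z:QT T|lborel. v (fst z) (snd z) $ i * q z j)" for q :: "vec3 \<times> real \<Rightarrow> 3 \<Rightarrow> real"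
  proof -
    have "(LINT z:QT T|lborel. ?w k z * q z k) = (if k = j then (LINT z:QT T|lborel. v (fst z) (snd z) $ i * q z j) else 0)" for k
      by (simp add: set_lebesgue_integral_def)
    then show ?thesis by simp
  qed
  have "(LINT x:Qcell|lborel. \<psi> (x, 0) * F0 x $ i $ j) + (LINT z:QT T|lborel. F (fst z) (snd z) $ i $ j * pt z)
        = (\<Sum>k\<in>UNIV. LINT z:QT T|lborel. ?w k z * px k z)"
  proof (rule weak_form_lipschitz_test[OF T_pos a weak_w_integrable(2) iw _ L per \<tau> meas dt dx])
    fix psi psit psix assume "test_QT T psi psit psix"
    from compatibility[OF this, of i j] show "(LINT x:Qcell|lborel. psi x 0 * F0 x $ i $ j)
        + (LINT z:QT T|lborel. F (fst z) (snd z) $ i $ j * psit (fst z) (snd z))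
        = (\<Sum>k\<in>UNIV. LINT z:QT T|lborel. ?w k z * psix (fst z) (snd z) $ k)"
      unfolding single[of "\<lambda>z k. psix (fst z) (snd z) $ k"] .
  qed
  then show ?thesis
    unfolding single[of "\<lambda>z k. px k z"]
      LINT_QT_to_IQ[OF weak_w_integrable(2) weak_w_eq(2) means_borel(2) meas(1)]
      LINT_QT_to_IQ[OF weak_w_integrable(1) weak_w_eq(1) means_borel(1) meas(2)]
    by (simp add: I0_def set_lebesgue_integral_def)
qed

lemma QT_time_integral:
  assumes adm: "admissible \<psi>" and \<tau>: "\<tau> < T" "\<And>x t. \<tau> \<le> t \<Longrightarrow> \<psi> (x, t) = 0"
    and meas: "pt \<in> borel_measurable borel"
    and dt: "AE z in lborel. z \<in> QO T \<longrightarrow> has_dir_deriv \<psi> tdir z (pt z)"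
  shows "IQ pt = - I0 (\<lambda>x. \<psi> (x, 0))"
proof -
  obtain L B where "L-lipschitz_on UNIV \<psi>" "\<And>z. \<bar>\<psi> z\<bar> \<le> B" using adm unfolding admissible_def by blast
  then show ?thesis unfolding IQ_def I0_def by (intro integral_time_derivative[OF T_pos _ _ \<tau> meas dt])
qed

lemma QT_space_integral:
  assumes adm: "admissible p" and meas: "px \<in> borel_measurable borel"
    and dx: "AE z in lborel. z \<in> QO T \<longrightarrow> has_dir_deriv p (xdir j) z (px z)"
  shows "IQ px = 0"
proof -
  obtain L B where "L-lipschitz_on UNIV p" "\<And>z. \<bar>p z\<bar> \<le> B" and "\<And>z. p (z + (2 * pi) *\<^sub>R xdir j) = p z"
    using adm unfolding admissible_def by blast
  then show ?thesis unfolding IQ_def by (intro integral_spatial_derivative_periodic[OF _ _ _ meas dx])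
qed

end

section \<open>The averaged relative entropy and the relative stress\<close>

context dissipative_setting
begin

definition rel :: "vec3 \<times> mat3 \<Rightarrow> vec3 \<times> real \<Rightarrow> real" where
  "rel w z = (norm (fst w - V z))\<^sup>2 / 2 + G_rel (snd w) (W z)"

lemma rel_expand:
  "rel w z = eta G (fst w) (snd w) - (\<Sum>i\<in>UNIV. V z $ i * fst w $ i) - (\<Sum>i\<in>UNIV. \<Sum>j\<in>UNIV. S z $ i $ j * snd w $ i $ j) + Kf z"
proof -
  have 1: "(norm (fst w - V z))\<^sup>2 / 2 = (norm (fst w))\<^sup>2 / 2 - V z \<bullet> fst w + (V z \<bullet> V z) / 2"
    unfolding power2_norm_eq_inner by (simp add: inner_diff_left inner_diff_right inner_commute diff_divide_distrib add_divide_distrib)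
  have 2: "Kf z = (V z \<bullet> V z) / 2 - G (W z) + S z \<bullet> W z"
    unfolding Kf_def vec3_inner[of "V z"] mat3_inner by (simp add: sum_divide_distrib)
  have 3: "(\<Sum>i\<in>UNIV. V z $ i * fst w $ i) = V z \<bullet> fst w" by (simp add: vec3_inner)
  have 4: "(\<Sum>i\<in>UNIV. \<Sum>j\<in>UNIV. S z $ i $ j * snd w $ i $ j) = S z \<bullet> snd w" by (simp add: mat3_inner)
  show ?thesis
    unfolding rel_def 1 2 3 4 G_rel_def eta_def by (simp add: S_def inner_diff_right)
qed

lemma rel_lower: "min 1 m / 2 * ((norm (fst w - V z))\<^sup>2 + (norm (snd w - W z))\<^sup>2) \<le> rel w z"
proof -
  have "min 1 m / 2 * (norm (fst w - V z))\<^sup>2 \<le> 1 / 2 * (norm (fst w - V z))\<^sup>2"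
    by (intro mult_right_mono) auto
  moreover have "min 1 m / 2 * (norm (snd w - W z))\<^sup>2 \<le> m / 2 * (norm (snd w - W z))\<^sup>2"
    by (intro mult_right_mono) auto
  ultimately show ?thesis
    using G_rel_lower[of "snd w" "W z"] unfolding rel_def distrib_left by linarith
qed

lemma rel_upper: "rel w z \<le> max 1 M / 2 * ((norm (fst w - V z))\<^sup>2 + (norm (snd w - W z))\<^sup>2)"
proof -
  have "1 / 2 * (norm (fst w - V z))\<^sup>2 \<le> max 1 M / 2 * (norm (fst w - V z))\<^sup>2"
    by (intro mult_right_mono) auto
  moreover have "M / 2 * (norm (snd w - W z))\<^sup>2 \<le> max 1 M / 2 * (norm (snd w - W z))\<^sup>2"
    by (intro mult_right_mono) auto
  ultimately show ?thesis
    using G_rel_upper[of "snd w" "W z"] unfolding rel_def distrib_left by linarith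
qed

lemma rel_nonneg: "0 \<le> rel w z"
proof -
  have "0 \<le> min 1 m / 2 * ((norm (fst w - V z))\<^sup>2 + (norm (snd w - W z))\<^sup>2)" using m_pos by simp
  then show ?thesis using rel_lower[of w z] by linarith
qed

text \<open>The average of \<open>rel\<close> with the linear terms already evaluated. This form is
  Borel everywhere and splits into summands that can be weighted and integrated one by one; it
  agrees with the mean of \<open>rel\<close>, and is non-negative, only almost everywhere.\<close>

definition rb :: "vec3 \<times> real \<Rightarrow> real" where
  "rb z = eb z - (\<Sum>i\<in>UNIV. V z $ i * vb i z) - (\<Sum>i\<in>UNIV. \<Sum>j\<in>UNIV. S z $ i $ j * Fb i j z) + Kf z"

lemma rb_borel [measurable]: "rb \<in> borel_measurable borel"
proof -
  have [measurable]: "Kf \<in> borel_measurable borel" by (rule admissible_borel[OF Kf_admissible])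
  show ?thesis unfolding rb_def[abs_def] by measurable
qed

lemma rb_mean: "AE z in lborel. z \<in> QTbar T \<longrightarrow> integrable (K z) (\<lambda>w. rel w z) \<and> rb z = (LINT w|K z. rel w z)"
  using means_AE_integrable
proof eventually_elim
  case (elim z)
  show ?case
  proof
    assume z: "z \<in> QTbar T"
    interpret prob_space "K z" by (rule prob_space_K)
    have i: "\<And>i. integrable (K z) (\<lambda>w. fst w $ i)" "\<And>i j. integrable (K z) (\<lambda>w. snd w $ i $ j)"
      "integrable (K z) (\<lambda>w. eta G (fst w) (snd w))" using elim z by blast+
    have "has_bochner_integral (K z) (\<lambda>w. rel w z) (eb z - (\<Sum>i\<in>UNIV. V z $ i * vb i z) - (\<Sum>i\<in>UNIV. \<Sum>j\<in>UNIV. S z $ i $ j * Fb i j z) + Kf z * measure (K z) (space (K z)))"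
      unfolding rel_expand eb_def vb_def Fb_def
      by (intro has_bochner_integral_add has_bochner_integral_diff has_bochner_integral_sum has_bochner_integral_mult_right
          has_bochner_integral_integrable i) (auto simp: has_bochner_integral_iff)
    then show "integrable (K z) (\<lambda>w. rel w z) \<and> rb z = (LINT w|K z. rel w z)"
      by (simp add: has_bochner_integral_iff rb_def prob_space)
  qed
qed

lemma rb_nonneg: "AE z in lborel. z \<in> QO T \<longrightarrow> 0 \<le> rb z"
  using rb_mean
proof eventually_elim
  case (elim z)
  show ?case
  proof
    assume "z \<in> QO T"
    then have "rb z = (LINT w|K z. rel w z)" using elim QO_subset_QT QT_subset_QTbar by blast
    then show "0 \<le> rb z" by (simp add: rel_nonneg)
  qed
qed

text \<open>The contraction of the averaged relative stress with the time derivative of the classical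
  deformation gradient; the part linear in the difference is absorbed by the symmetry of D2G.\<close>

definition qb :: "vec3 \<times> real \<Rightarrow> real" where
  "qb z = (\<Sum>i\<in>UNIV. \<Sum>j\<in>UNIV. (Pb i j z - S z $ i $ j) * Wt i j z - (Fb i j z - W z $ i $ j) * St i j z)"

text \<open>The estimate holds for every single state \<open>w\<close> and is then averaged over
  \<open>K z\<close>. Both \<open>qb\<close> and \<open>rb\<close> are means under the same
  probability measure, so the constant is preserved.\<close>

lemma qb_bound: "\<exists>C\<ge>0. AE z in lborel. z \<in> QO T \<longrightarrow> qb z \<le> C * rb z"
proof -
  obtain L where L: "\<forall>i j. AE z in lborel. z \<in> QO T \<longrightarrow> \<bar>Wt i j z\<bar> \<le> L" using hat_deriv_bound by blast
  have L': "AE z in lborel. \<forall>i j. z \<in> QO T \<longrightarrow> \<bar>Wt i j z\<bar> \<le> L"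
    using L by (intro AE_all_countable[THEN iffD2] allI) blast
  \<comment> \<open>The product of \<open>M / 2\<close> from the Taylor remainder, of
    \<open>9 * \<bar>L\<bar>\<close> bounding the norm of the matrix of time derivatives of
    \<open>W\<close>, and of \<open>2 / m\<close> for passing from the squared distance to
    \<open>G_rel\<close>.\<close>
  define C where "C = M * (9 * \<bar>L\<bar>) / m"
  have C: "0 \<le> C" using M_pos m_pos by (simp add: C_def)
  have "AE z in lborel. z \<in> QO T \<longrightarrow> qb z \<le> C * rb z"
    using L' hat_derivatives means_AE_integrable rb_mean
  proof eventually_elim
    case (elim z)
    show ?case
    proof
      assume z: "z \<in> QO T"
      then have zb: "z \<in> QTbar T" using QO_subset_QT QT_subset_QTbar by blast
      have i: "\<And>i j. integrable (K z) (\<lambda>w. snd w $ i $ j)" "\<And>i j. integrable (K z) (\<lambda>w. DG (snd w) $ i $ j)"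
        using elim(3) zb by blast+
      have d: "\<And>i j. has_dir_deriv (\<lambda>z. W z $ i $ j) tdir z (Wt i j z)" "\<And>i j. has_dir_deriv (\<lambda>z. S z $ i $ j) tdir z (St i j z)"
        using elim(2) z by blast+
      have r: "integrable (K z) (\<lambda>w. rel w z)" "rb z = (LINT w|K z. rel w z)" using elim(4) zb by blast+
      interpret prob_space "K z" by (rule prob_space_K)
      have c: "has_bochner_integral (K z) (\<lambda>w. c) c" for c :: real by (simp add: has_bochner_integral_iff prob_space)
      let ?f = "\<lambda>w. (\<Sum>i\<in>UNIV. \<Sum>j\<in>UNIV. (DG (snd w) $ i $ j - S z $ i $ j) * Wt i j z - (snd w $ i $ j - W z $ i $ j) * St i j z)"
      have q: "has_bochner_integral (K z) ?f (qb z)"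
        unfolding qb_def Pb_def Fb_def
        by (intro has_bochner_integral_diff has_bochner_integral_sum has_bochner_integral_mult_left
          has_bochner_integral_integrable i c)
      have "norm (\<chi> i j. Wt i j z) \<le> 9 * \<bar>L\<bar>"
        using elim(1) z by (intro norm_mat3_le) (auto intro: order_trans[OF _ abs_ge_self])
      then have f: "?f w \<le> C * rel w z" for w
      proof -
        have "?f w \<le> M / 2 * (norm (snd w - W z))\<^sup>2 * norm (\<chi> i j. Wt i j z)"
          by (rule relative_stress_bound[OF d])
        also have "\<dots> \<le> M / 2 * (norm (snd w - W z))\<^sup>2 * (9 * \<bar>L\<bar>)"
          using \<open>norm (\<chi> i j. Wt i j z) \<le> 9 * \<bar>L\<bar>\<close> M_pos by (intro mult_left_mono) auto
        also have "\<dots> = C * (m / 2 * (norm (snd w - W z))\<^sup>2)" using m_pos by (simp add: C_def)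
        also have "\<dots> \<le> C * rel w z"
          using G_rel_lower[of "snd w" "W z"] zero_le_power2[of "norm (fst w - V z)"] unfolding rel_def by (intro mult_left_mono C) linarith
        finally show ?thesis .
      qed
      have "qb z = (LINT w|K z. ?f w)" using q by (simp add: has_bochner_integral_iff)
      also have "\<dots> \<le> (LINT w|K z. C * rel w z)"
        using q r f by (intro integral_mono) (auto simp: has_bochner_integral_iff)
      finally show "qb z \<le> C * rb z" by (simp add: r)
    qed
  qed
  with C show ?thesis by blast
qed

lemma h0_hat:
  assumes "admissible p" and i: "integrable lborel (\<lambda>x. indicator Qcell x * f x)"
  shows "hI Qcell (\<lambda>x. p (x, 0) * f x) (I0 (\<lambda>x. p (x, 0) * f x))"
proof -
  obtain B where B: "\<And>z. \<bar>p z\<bar> \<le> B" using assms unfolding admissible_def by blast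
  note [measurable] = admissible_borel[OF assms(1)]
  have "integrable lborel (\<lambda>x. (indicator Qcell x * f x) * p (x, 0))"
    by (rule integrable_mult_bounded[OF _ i, where C=B]) (auto simp: B)
  then have "integrable lborel (\<lambda>x. indicator Qcell x * (p (x, 0) * f x))" by (simp add: mult_ac)
  then show ?thesis unfolding hI_def I0_def by (rule has_bochner_integral_integrable)
qed

definition R0 :: real where "R0 = I0 (\<lambda>x. rel (v0 x, F0 x) (x, 0))"

lemma h0_R0: "hI Qcell (\<lambda>x. rel (v0 x, F0 x) (x, 0)) R0"
  and R0_expand: "R0 = I0 (\<lambda>x. eta G (v0 x) (F0 x)) - (\<Sum>i\<in>UNIV. I0 (\<lambda>x. V (x, 0) $ i * v0 x $ i))
     - (\<Sum>i\<in>UNIV. \<Sum>j\<in>UNIV. I0 (\<lambda>x. S (x, 0) $ i $ j * F0 x $ i $ j)) + I0 (\<lambda>x. Kf (x, 0))"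
proof -
  have e: "hI Qcell (\<lambda>x. eta G (v0 x) (F0 x)) (I0 (\<lambda>x. eta G (v0 x) (F0 x)))"
    unfolding hI_def I0_def by (rule has_bochner_integral_integrable[OF initial_integrable(3)])
  have k: "hI Qcell (\<lambda>x. Kf (x, 0)) (I0 (\<lambda>x. Kf (x, 0)))"
    using h0_hat[OF Kf_admissible, of "\<lambda>_. 1"] emeasure_Qcell_finite by simp
  have h: "hI Qcell (\<lambda>x. rel (v0 x, F0 x) (x, 0)) (I0 (\<lambda>x. eta G (v0 x) (F0 x)) - (\<Sum>i\<in>UNIV. I0 (\<lambda>x. V (x, 0) $ i * v0 x $ i))
     - (\<Sum>i\<in>UNIV. \<Sum>j\<in>UNIV. I0 (\<lambda>x. S (x, 0) $ i $ j * F0 x $ i $ j)) + I0 (\<lambda>x. Kf (x, 0)))"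
    unfolding rel_expand fst_conv snd_conv
    by (intro hI_add hI_diff hI_sum h0_hat hat_admissible initial_integrable e k)
  then show r: "R0 = I0 (\<lambda>x. eta G (v0 x) (F0 x)) - (\<Sum>i\<in>UNIV. I0 (\<lambda>x. V (x, 0) $ i * v0 x $ i))
     - (\<Sum>i\<in>UNIV. \<Sum>j\<in>UNIV. I0 (\<lambda>x. S (x, 0) $ i $ j * F0 x $ i $ j)) + I0 (\<lambda>x. Kf (x, 0))"
    unfolding hI_def R0_def by (simp only: I0_def has_bochner_integral_integral_eq)
  show "hI Qcell (\<lambda>x. rel (v0 x, F0 x) (x, 0)) R0" using h unfolding r .
qed

lemma hat_deriv_AE:
  "AE z in lborel. z \<in> QO T \<longrightarrow> has_dir_deriv (\<lambda>z. V z $ i) tdir z (Vt i z)"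
  "AE z in lborel. z \<in> QO T \<longrightarrow> has_dir_deriv (\<lambda>z. V z $ i) (xdir j) z (Vx i j z)"
  "AE z in lborel. z \<in> QO T \<longrightarrow> has_dir_deriv (\<lambda>z. S z $ i $ j) tdir z (St i j z)"
  "AE z in lborel. z \<in> QO T \<longrightarrow> has_dir_deriv (\<lambda>z. S z $ i $ j) (xdir k) z (Sx i j k z)"
  by (use hat_derivatives in eventually_elim, blast)+

lemma Kt_borel [measurable]: "Kt \<in> borel_measurable borel"
  unfolding Kt_def[abs_def] by measurable

lemma ess_bdd_Kt: "ess_bdd Kt"
proof -
  obtain L where L: "L-lipschitz_on UNIV Kf" using Kf_admissible unfolding admissible_def by blast
  show ?thesis unfolding ess_bdd_def using ess_bdd_dir_deriv[OF L norm_tdir Kt_borel Kf_deriv] Kt_borel by blast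
qed

lemma rb_weight_hQ:
  assumes "ess_bdd g"
  shows "hQ (\<lambda>z. g z * rb z) (IQ (\<lambda>z. g z * eb z) - (\<Sum>i\<in>UNIV. IQ (\<lambda>z. (g z * V z $ i) * vb i z))
     - (\<Sum>i\<in>UNIV. \<Sum>j\<in>UNIV. IQ (\<lambda>z. (g z * S z $ i $ j) * Fb i j z)) + IQ (\<lambda>z. g z * Kf z))"
proof (rule hI_cong)
  show "hQ (\<lambda>z. g z * eb z - (\<Sum>i\<in>UNIV. (g z * V z $ i) * vb i z) - (\<Sum>i\<in>UNIV. \<Sum>j\<in>UNIV. (g z * S z $ i $ j) * Fb i j z) + g z * Kf z)
    (IQ (\<lambda>z. g z * eb z) - (\<Sum>i\<in>UNIV. IQ (\<lambda>z. (g z * V z $ i) * vb i z))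
     - (\<Sum>i\<in>UNIV. \<Sum>j\<in>UNIV. IQ (\<lambda>z. (g z * S z $ i $ j) * Fb i j z)) + IQ (\<lambda>z. g z * Kf z))"
    by (intro hI_add hI_diff hI_sum hQ_mean hQ_bd means_integrable ess_bdd_mult assms ess_bdd_admissible hat_admissible Kf_admissible)
qed (simp add: rb_def distrib_left right_diff_distrib sum_distrib_left mult.assoc)

lemma hQ_rb: "ess_bdd g \<Longrightarrow> hQ (\<lambda>z. g z * rb z) (IQ (\<lambda>z. g z * rb z))"
  using rb_weight_hQ[of g] hQ_IQ[OF rb_weight_hQ[of g]] by simp

end

section \<open>The weighted identities and the relative entropy inequality\<close>

context test_weight
begin

lemma I0_scale: "I0 (\<lambda>x. \<Theta> (x, 0) * p (x, 0) * f x) = \<theta> 0 * I0 (\<lambda>x. p (x, 0) * f x)"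
  unfolding \<Theta>_0 I0_def by (simp add: mult.left_commute mult.assoc)

lemma energy_weight: "0 \<le> IQ (\<lambda>z. \<Theta>t z * eb z) + (LINT z:QT T|\<gamma>. \<theta>' (snd z)) + \<theta> 0 * I0 (\<lambda>x. eta G (v0 x) (F0 x))"
proof -
  have "test_T T \<theta> \<theta>'"
    unfolding test_T_def using \<theta>_deriv \<theta>_nonneg \<theta>_support \<theta>'_cont
    by (auto intro: DERIV_subset continuous_on_subset)
  from energy[OF this] have "0 \<le> (LINT z:QT T|lborel. \<theta>' (snd z) * ymean \<nu> (fst z) (snd z) (\<lambda>w. eta G (fst w) (snd w)))
        + (LINT z:QT T|\<gamma>. \<theta>' (snd z)) + (LINT x:Qcell|lborel. \<theta> 0 * eta G (v0 x) (F0 x))" .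
  moreover have "(LINT z:QT T|lborel. \<theta>' (snd z) * ymean \<nu> (fst z) (snd z) (\<lambda>w. eta G (fst w) (snd w))) = IQ (\<lambda>z. \<Theta>t z * eb z)"
    unfolding set_lebesgue_integral_def IQ_def \<Theta>t_def eb_def
    using QT_subset_QTbar[of T] by (intro Bochner_Integration.integral_cong refl) (auto simp: indicator_def ymean_def K_def)
  moreover have "(LINT x:Qcell|lborel. \<theta> 0 * eta G (v0 x) (F0 x)) = \<theta> 0 * I0 (\<lambda>x. eta G (v0 x) (F0 x))"
    unfolding set_lebesgue_integral_def I0_def by (simp add: mult.left_commute)
  ultimately show ?thesis by (simp only:)
qed

lemma product_deriv_AE:
  assumes "admissible p" and d: "AE z in lborel. z \<in> QO T \<longrightarrow> has_dir_deriv p tdir z (pt z)"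
  shows "AE z in lborel. z \<in> QO T \<longrightarrow> has_dir_deriv (\<lambda>z. \<Theta> z * p z) tdir z (\<Theta>t z * p z + pt z * \<Theta> z)"
  using d by eventually_elim (use test_product(3)[OF assms(1)] in blast)

lemma product_deriv_AE_x:
  assumes "admissible p" and d: "AE z in lborel. z \<in> QO T \<longrightarrow> has_dir_deriv p (xdir j) z (px z)"
  shows "AE z in lborel. z \<in> QO T \<longrightarrow> has_dir_deriv (\<lambda>z. \<Theta> z * p z) (xdir j) z (0 * p z + px z * \<Theta> z)"
  using d by eventually_elim (use test_product(4)[OF assms(1)] in blast)

lemma \<Theta>_borel [measurable]: "\<Theta> \<in> borel_measurable borel" "\<Theta>t \<in> borel_measurable borel"
  using ess_bdd_\<Theta> ess_bdd_\<Theta>t unfolding ess_bdd_def by blast+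

text \<open>The \<open>i\<close>-th momentum equation is tested with the weight times the
  \<open>i\<close>-th classical velocity. The vanishing summand in the spatial derivative of that
  product is the derivative of the weight.\<close>

lemma momentum_weight:
  "\<theta> 0 * I0 (\<lambda>x. V (x, 0) $ i * v0 x $ i) + IQ (\<lambda>z. (\<Theta>t z * V z $ i) * vb i z) + IQ (\<lambda>z. (\<Theta> z * Vt i z) * vb i z)
    = (\<Sum>j\<in>UNIV. IQ (\<lambda>z. (\<Theta> z * Vx i j z) * Pb i j z))"
proof -
  have "I0 (\<lambda>x. \<Theta> (x, 0) * V (x, 0) $ i * v0 x $ i) + IQ (\<lambda>z. (\<Theta>t z * V z $ i + Vt i z * \<Theta> z) * vb i z)
    = (\<Sum>j\<in>UNIV. IQ (\<lambda>z. (0 * V z $ i + Vx i j z * \<Theta> z) * Pb i j z))"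
    by (rule momentum_lipschitz_test[where \<psi>="\<lambda>z. \<Theta> z * V z $ i", OF test_product(1)[OF hat_admissible(1)] \<theta>_support(1)
        test_product(2)[OF hat_admissible(1)] _ _ product_deriv_AE[OF hat_admissible(1) hat_deriv_AE(1)]
        product_deriv_AE_x[OF hat_admissible(1) hat_deriv_AE(2)]]) measurable
  moreover have "IQ (\<lambda>z. (\<Theta>t z * V z $ i + Vt i z * \<Theta> z) * vb i z) = IQ (\<lambda>z. (\<Theta>t z * V z $ i) * vb i z) + IQ (\<lambda>z. (\<Theta> z * Vt i z) * vb i z)"
  proof (rule hQ_IQ, rule hI_cong)
    show "hQ (\<lambda>z. (\<Theta>t z * V z $ i) * vb i z + (\<Theta> z * Vt i z) * vb i z) (IQ (\<lambda>z. (\<Theta>t z * V z $ i) * vb i z) + IQ (\<lambda>z. (\<Theta> z * Vt i z) * vb i z))"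
      by (intro hI_add hQ_mean means_integrable ess_bdd_mult ess_bdd_\<Theta> ess_bdd_\<Theta>t ess_bdd_hat ess_bdd_admissible hat_admissible)
  qed (simp add: algebra_simps)
  ultimately show ?thesis
    using I0_scale[of "\<lambda>z. V z $ i" "\<lambda>x. v0 x $ i"] by (simp add: mult.commute[of "\<Theta> _"])
qed

lemma compatibility_weight:
  "\<theta> 0 * I0 (\<lambda>x. S (x, 0) $ i $ j * F0 x $ i $ j) + IQ (\<lambda>z. (\<Theta>t z * S z $ i $ j) * Fb i j z) + IQ (\<lambda>z. (\<Theta> z * St i j z) * Fb i j z)
    = IQ (\<lambda>z. (\<Theta> z * Sx i j j z) * vb i z)"
proof -
  have "I0 (\<lambda>x. \<Theta> (x, 0) * S (x, 0) $ i $ j * F0 x $ i $ j) + IQ (\<lambda>z. (\<Theta>t z * S z $ i $ j + St i j z * \<Theta> z) * Fb i j z)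
    = IQ (\<lambda>z. (0 * S z $ i $ j + Sx i j j z * \<Theta> z) * vb i z)"
    by (rule compatibility_lipschitz_test[where \<psi>="\<lambda>z. \<Theta> z * S z $ i $ j" and px="\<lambda>k z. 0 * S z $ i $ j + Sx i j k z * \<Theta> z",
        OF test_product(1)[OF hat_admissible(3)] \<theta>_support(1)
        test_product(2)[OF hat_admissible(3)] _ _ product_deriv_AE[OF hat_admissible(3) hat_deriv_AE(3)]
        product_deriv_AE_x[OF hat_admissible(3) hat_deriv_AE(4)]]) measurable
  moreover have "IQ (\<lambda>z. (\<Theta>t z * S z $ i $ j + St i j z * \<Theta> z) * Fb i j z) = IQ (\<lambda>z. (\<Theta>t z * S z $ i $ j) * Fb i j z) + IQ (\<lambda>z. (\<Theta> z * St i j z) * Fb i j z)"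
  proof (rule hQ_IQ, rule hI_cong)
    show "hQ (\<lambda>z. (\<Theta>t z * S z $ i $ j) * Fb i j z + (\<Theta> z * St i j z) * Fb i j z) (IQ (\<lambda>z. (\<Theta>t z * S z $ i $ j) * Fb i j z) + IQ (\<lambda>z. (\<Theta> z * St i j z) * Fb i j z))"
      by (intro hI_add hQ_mean means_integrable ess_bdd_mult ess_bdd_\<Theta> ess_bdd_\<Theta>t ess_bdd_hat ess_bdd_admissible hat_admissible)
  qed (simp add: algebra_simps)
  ultimately show ?thesis
    using I0_scale[of "\<lambda>z. S z $ i $ j" "\<lambda>x. F0 x $ i $ j"] by (simp add: mult.commute[of "\<Theta> _"])
qed

lemma Kf_weight: "IQ (\<lambda>z. \<Theta>t z * Kf z) + IQ (\<lambda>z. \<Theta> z * Kt z) = - (\<theta> 0 * I0 (\<lambda>x. Kf (x, 0)))"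
proof -
  note [measurable] = admissible_borel[OF Kf_admissible]
  have "IQ (\<lambda>z. \<Theta>t z * Kf z + Kt z * \<Theta> z) = - I0 (\<lambda>x. \<Theta> (x, 0) * Kf (x, 0))"
    by (rule QT_time_integral[where \<psi>="\<lambda>z. \<Theta> z * Kf z", OF test_product(1)[OF Kf_admissible] \<theta>_support(1)
        test_product(2)[OF Kf_admissible] _ product_deriv_AE[OF Kf_admissible Kf_deriv]]) measurable
  moreover have "IQ (\<lambda>z. \<Theta>t z * Kf z + Kt z * \<Theta> z) = IQ (\<lambda>z. \<Theta>t z * Kf z) + IQ (\<lambda>z. \<Theta> z * Kt z)"
  proof (rule hQ_IQ, rule hI_cong)
    show "hQ (\<lambda>z. \<Theta>t z * Kf z + \<Theta> z * Kt z) (IQ (\<lambda>z. \<Theta>t z * Kf z) + IQ (\<lambda>z. \<Theta> z * Kt z))"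
      by (intro hI_add hQ_bd ess_bdd_mult ess_bdd_\<Theta> ess_bdd_\<Theta>t ess_bdd_Kt ess_bdd_admissible Kf_admissible)
  qed (simp add: mult.commute)
  ultimately show ?thesis
    using I0_scale[of Kf "\<lambda>_. 1"] by simp
qed

text \<open>The integrand is the \<open>j\<close>-th derivative of weight times velocity times
  stress, which integrates to zero over the torus. One half will cancel the kinetic term of
  \<open>Kt\<close>, the other supplies the classical stress in \<open>qb\<close>.\<close>

lemma flux_weight: "IQ (\<lambda>z. \<Theta> z * (V z $ i * Sx i j j z) + \<Theta> z * (S z $ i $ j * Vx i j z)) = 0"
proof -
  have "AE z in lborel. z \<in> QO T \<longrightarrow> has_dir_deriv (\<lambda>z. V z $ i * S z $ i $ j) (xdir j) z (Vx i j z * S z $ i $ j + Sx i j j z * V z $ i)"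
    using hat_deriv_AE(2)[of i j] hat_deriv_AE(4)[of i j j] by eventually_elim (use has_dir_deriv_mult[of "\<lambda>z. V z $ i" _ _ _ "\<lambda>z. S z $ i $ j"] in blast)
  from product_deriv_AE_x[OF admissible_mult[OF hat_admissible(1,3)] this]
  have "AE z in lborel. z \<in> QO T \<longrightarrow> has_dir_deriv (\<lambda>z. \<Theta> z * (V z $ i * S z $ i $ j)) (xdir j) z
      (0 * (V z $ i * S z $ i $ j) + (Vx i j z * S z $ i $ j + Sx i j j z * V z $ i) * \<Theta> z)" .
  from QT_space_integral[OF test_product(1)[OF admissible_mult[OF hat_admissible(1,3)]] _ this]
  have "IQ (\<lambda>z. 0 * (V z $ i * S z $ i $ j) + (Vx i j z * S z $ i $ j + Sx i j j z * V z $ i) * \<Theta> z) = 0" by measurable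
  then show ?thesis by (simp add: algebra_simps)
qed

text \<open>From the energy inequality the two tested equations are subtracted and the identity for
  \<open>Kf\<close> is added, so that all terms with the differentiated weight combine to
  \<open>rb\<close>. The remaining volume terms, completed by a flux of zero integral, equal the
  weight times \<open>- qb\<close>.\<close>

lemma relative_entropy_inequality:
  assumes C: "0 \<le> C" "AE z in lborel. z \<in> QO T \<longrightarrow> qb z \<le> C * rb z"
  shows "0 \<le> IQ (\<lambda>z. \<Theta>t z * rb z) + (LINT z:QT T|\<gamma>. \<theta>' (snd z)) + \<theta> 0 * R0 + C * IQ (\<lambda>z. \<Theta> z * rb z)"
proof -
  \<comment> \<open>Letters: \<open>a\<close> momentum, \<open>b\<close> compatibility,
    \<open>d\<close> flux, \<open>k2\<close> the classical part. Digits: 0 initial term, 1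
    differentiated weight, 2 differentiated coefficient in time, 3 spatial flux.\<close>
  define a2 a3 b2 b3 d where "a2 i = IQ (\<lambda>z. (\<Theta> z * Vt i z) * vb i z)" and "a3 i j = IQ (\<lambda>z. (\<Theta> z * Vx i j z) * Pb i j z)"
    and "b2 i j = IQ (\<lambda>z. (\<Theta> z * St i j z) * Fb i j z)" and "b3 i j = IQ (\<lambda>z. (\<Theta> z * Sx i j j z) * vb i z)"
    and "d i j = IQ (\<lambda>z. \<Theta> z * (V z $ i * Sx i j j z) + \<Theta> z * (S z $ i $ j * Vx i j z))" for i j :: 3
  define k2 where "k2 = IQ (\<lambda>z. \<Theta> z * Kt z)"
  let ?f = "\<lambda>z. (\<Sum>i\<in>UNIV. (\<Theta> z * Vt i z) * vb i z) - (\<Sum>i\<in>UNIV. \<Sum>j\<in>UNIV. (\<Theta> z * Vx i j z) * Pb i j z)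
     + (\<Sum>i\<in>UNIV. \<Sum>j\<in>UNIV. (\<Theta> z * St i j z) * Fb i j z) - (\<Sum>i\<in>UNIV. \<Sum>j\<in>UNIV. (\<Theta> z * Sx i j j z) * vb i z)
     - \<Theta> z * Kt z + (\<Sum>i\<in>UNIV. \<Sum>j\<in>UNIV. \<Theta> z * (V z $ i * Sx i j j z) + \<Theta> z * (S z $ i $ j * Vx i j z))"
  have d: "hQ (\<lambda>z. \<Theta> z * (V z $ i * Sx i j j z) + \<Theta> z * (S z $ i $ j * Vx i j z)) (d i j)" for i j
  proof -
    have "hQ (\<lambda>z. \<Theta> z * (V z $ i * Sx i j j z) + \<Theta> z * (S z $ i $ j * Vx i j z)) (IQ (\<lambda>z. \<Theta> z * (V z $ i * Sx i j j z)) + IQ (\<lambda>z. \<Theta> z * (S z $ i $ j * Vx i j z)))"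
      by (intro hI_add hQ_bd ess_bdd_mult ess_bdd_\<Theta> ess_bdd_admissible hat_admissible ess_bdd_hat)
    then show ?thesis using hQ_IQ d_def by fastforce
  qed
  have f: "hQ ?f ((\<Sum>i\<in>UNIV. a2 i) - (\<Sum>i\<in>UNIV. \<Sum>j\<in>UNIV. a3 i j) + (\<Sum>i\<in>UNIV. \<Sum>j\<in>UNIV. b2 i j) - (\<Sum>i\<in>UNIV. \<Sum>j\<in>UNIV. b3 i j) - k2
     + (\<Sum>i\<in>UNIV. \<Sum>j\<in>UNIV. d i j))"
    unfolding a2_def a3_def b2_def b3_def k2_def
    by (intro hI_add hI_diff hI_sum d hQ_mean hQ_bd means_integrable ess_bdd_mult ess_bdd_\<Theta> ess_bdd_hat ess_bdd_Kt)
  have fq: "AE z in lborel. z \<in> QO T \<longrightarrow> (- C) * (\<Theta> z * rb z) \<le> ?f z"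
    using C(2) hat_derivatives
  proof eventually_elim
    case (elim z)
    show ?case
    proof
      assume z: "z \<in> QO T"
      have Vt: "Vt i z = (\<Sum>j\<in>UNIV. Sx i j j z)" and Vx: "Vx i j z = Wt i j z" for i j using elim z by auto
      have "?f z = \<Theta> z * ((\<Sum>i\<in>UNIV. Vt i z * vb i z) - (\<Sum>i\<in>UNIV. \<Sum>j\<in>UNIV. Vx i j z * Pb i j z)
        + (\<Sum>i\<in>UNIV. \<Sum>j\<in>UNIV. St i j z * Fb i j z) - (\<Sum>i\<in>UNIV. \<Sum>j\<in>UNIV. Sx i j j z * vb i z) - Kt z
        + (\<Sum>i\<in>UNIV. \<Sum>j\<in>UNIV. V z $ i * Sx i j j z + S z $ i $ j * Vx i j z))"
        by (simp add: distrib_left right_diff_distrib sum_distrib_left mult.assoc)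
      \<comment> \<open>Momentum balance of the classical solution: the mean velocity from the
        momentum test cancels the one from the compatibility test.\<close>
      also have "(\<Sum>i\<in>UNIV. Vt i z * vb i z) = (\<Sum>i\<in>UNIV. \<Sum>j\<in>UNIV. Sx i j j z * vb i z)"
        unfolding Vt by (simp add: sum_distrib_right)
      also have "(\<Sum>i\<in>UNIV. \<Sum>j\<in>UNIV. Sx i j j z * vb i z) - (\<Sum>i\<in>UNIV. \<Sum>j\<in>UNIV. Vx i j z * Pb i j z)
        + (\<Sum>i\<in>UNIV. \<Sum>j\<in>UNIV. St i j z * Fb i j z) - (\<Sum>i\<in>UNIV. \<Sum>j\<in>UNIV. Sx i j j z * vb i z) - Kt z
        + (\<Sum>i\<in>UNIV. \<Sum>j\<in>UNIV. V z $ i * Sx i j j z + S z $ i $ j * Vx i j z) = - qb z"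
        unfolding Kt_def qb_def Vx Vt
        by (simp add: sum.distrib sum_subtractf sum_distrib_left left_diff_distrib right_diff_distrib mult.commute)
      finally have "?f z = - (\<Theta> z * qb z)" by simp
      moreover have "\<Theta> z * qb z \<le> \<Theta> z * (C * rb z)"
        using elim(1) z by (intro mult_left_mono \<Theta>_nonneg) blast
      ultimately show "(- C) * (\<Theta> z * rb z) \<le> ?f z" by (simp add: mult.left_commute)
    qed
  qed
  have rbt: "hQ (\<lambda>z. \<Theta> z * rb z) (IQ (\<lambda>z. \<Theta> z * rb z))"
    by (rule hQ_rb[OF ess_bdd_\<Theta>])
  have low: "(- C) * IQ (\<lambda>z. \<Theta> z * rb z) \<le> (\<Sum>i\<in>UNIV. a2 i) - (\<Sum>i\<in>UNIV. \<Sum>j\<in>UNIV. a3 i j) + (\<Sum>i\<in>UNIV. \<Sum>j\<in>UNIV. b2 i j) - (\<Sum>i\<in>UNIV. \<Sum>j\<in>UNIV. b3 i j) - k2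
     + (\<Sum>i\<in>UNIV. \<Sum>j\<in>UNIV. d i j)"
    by (rule hQ_le[OF hI_cmult[OF rbt] f fq])
  define a0 a1 b0 b1 where "a0 i = I0 (\<lambda>x. V (x, 0) $ i * v0 x $ i)" and "a1 i = IQ (\<lambda>z. (\<Theta>t z * V z $ i) * vb i z)"
    and "b0 i j = I0 (\<lambda>x. S (x, 0) $ i $ j * F0 x $ i $ j)" and "b1 i j = IQ (\<lambda>z. (\<Theta>t z * S z $ i $ j) * Fb i j z)" for i j :: 3
  have A: "\<theta> 0 * (\<Sum>i\<in>UNIV. a0 i) + (\<Sum>i\<in>UNIV. a1 i) + (\<Sum>i\<in>UNIV. a2 i) = (\<Sum>i\<in>UNIV. \<Sum>j\<in>UNIV. a3 i j)"
    unfolding sum_distrib_left sum.distrib[symmetric] a0_def a1_def a2_def a3_def by (intro sum.cong refl momentum_weight)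
  have B: "\<theta> 0 * (\<Sum>i\<in>UNIV. \<Sum>j\<in>UNIV. b0 i j) + (\<Sum>i\<in>UNIV. \<Sum>j\<in>UNIV. b1 i j) + (\<Sum>i\<in>UNIV. \<Sum>j\<in>UNIV. b2 i j) = (\<Sum>i\<in>UNIV. \<Sum>j\<in>UNIV. b3 i j)"
    unfolding sum_distrib_left sum.distrib[symmetric] b0_def b1_def b2_def b3_def by (intro sum.cong refl compatibility_weight)
  have D: "(\<Sum>i\<in>UNIV. \<Sum>j\<in>UNIV. d i j) = 0"
    unfolding d_def flux_weight by simp
  have rb': "IQ (\<lambda>z. \<Theta>t z * rb z) = IQ (\<lambda>z. \<Theta>t z * eb z) - (\<Sum>i\<in>UNIV. a1 i) - (\<Sum>i\<in>UNIV. \<Sum>j\<in>UNIV. b1 i j) + IQ (\<lambda>z. \<Theta>t z * Kf z)"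
    unfolding a1_def b1_def by (rule hQ_IQ[OF rb_weight_hQ[OF ess_bdd_\<Theta>t]])
  have R: "\<theta> 0 * R0 = \<theta> 0 * I0 (\<lambda>x. eta G (v0 x) (F0 x)) - \<theta> 0 * (\<Sum>i\<in>UNIV. a0 i) - \<theta> 0 * (\<Sum>i\<in>UNIV. \<Sum>j\<in>UNIV. b0 i j) + \<theta> 0 * I0 (\<lambda>x. Kf (x, 0))"
    unfolding R0_expand a0_def b0_def by (simp add: distrib_left right_diff_distrib)
  show ?thesis
    using low A B D rb' R energy_weight Kf_weight[folded k2_def] by linarith
qed

end

section \<open>Stability and uniqueness\<close>

text \<open>The lower limit -1 lies strictly inside the region where \<open>f\<close> vanishes. Thus
  every \<open>t \<ge> 0\<close> is interior to the interval of integration, while for negative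
  \<open>t\<close> the integral is locally constant.\<close>

lemma global_antiderivative:
  fixes f :: "real \<Rightarrow> real"
  assumes f: "continuous_on UNIV f" and zero: "\<And>t. t \<le> 0 \<Longrightarrow> f t = 0"
  shows "((\<lambda>t. integral {-1..t} f) has_real_derivative f t) (at t)"
proof (cases "t < 0")
  case True
  have "((\<lambda>t. 0 :: real) has_real_derivative f t) (at t)" using zero[of t] True by simp
  then show ?thesis
  proof (rule has_field_derivative_transform_within_open)
    show "open {..<0 :: real}" "t \<in> {..<0}" using True by auto
    show "0 = integral {-1..s} f" if "s \<in> {..<0}" for s
    proof -
      have "integral {-1..s} f = integral {-1..s} (\<lambda>_. 0)"
        using that by (intro Henstock_Kurzweil_Integration.integral_cong zero) auto
      then show ?thesis by simp
    qed
  qed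
next
  case False
  have "((\<lambda>t. integral {-1..t} f) has_real_derivative f t) (at t within {-1..t + 1})"
    using False by (intro integral_has_real_derivative continuous_on_subset[OF f]) auto
  moreover have "at t within {-1..t + 1} = at t"
    using False by (intro at_within_interior) auto
  ultimately show ?thesis by simp
qed

text \<open>Tonelli for a Borel null set containing the exceptional set; the exceptional set itself
  need not be measurable.\<close>

lemma AE_time_slices:
  fixes P :: "vec3 \<times> real \<Rightarrow> bool"
  assumes "AE z in lborel. P z"
  shows "AE t in lborel. AE x in lborel. P (x, t)"
proof -
  obtain N where N: "N \<in> null_sets lborel" "{z. \<not> P z} \<subseteq> N"
    using assms unfolding eventually_ae_filter by auto
  have [measurable]: "N \<in> sets borel" using N by (auto simp: null_sets_def)
  have [measurable]: "N \<in> sets (borel \<Otimes>\<^sub>M borel)" using \<open>N \<in> sets borel\<close> by (simp only: borel_prod)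
  have Np: "(\<lambda>z. indicator N z :: ennreal) \<in> borel_measurable (lborel \<Otimes>\<^sub>M lborel)" by measurable
  have "(\<integral>\<^sup>+ t. (\<integral>\<^sup>+ x. indicator N (x, t) \<partial>lborel) \<partial>lborel) = (\<integral>\<^sup>+ z. indicator N z \<partial>(lborel \<Otimes>\<^sub>M lborel))"
    by (rule lborel_pair.nn_integral_snd[OF Np])
  also have "\<dots> = 0" using N by (simp add: lborel_prod null_sets_def)
  finally have 0: "(\<integral>\<^sup>+ t. (\<integral>\<^sup>+ x. indicator N (x, t) \<partial>lborel) \<partial>lborel) = 0" .
  have "(\<lambda>(t, x). indicator N (x, t) :: ennreal) \<in> borel_measurable (borel \<Otimes>\<^sub>M lborel)" by measurable
  from lborel.borel_measurable_nn_integral[OF this]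
  have m: "(\<lambda>t. \<integral>\<^sup>+ x. indicator N (x, t) \<partial>lborel) \<in> borel_measurable lborel" by simp
  have "AE t in lborel. (\<integral>\<^sup>+ x. indicator N (x, t) \<partial>lborel) = 0"
    using 0 nn_integral_0_iff_AE[OF m] by simp
  then show ?thesis
  proof eventually_elim
    case (elim t)
    have "(\<lambda>x. indicator N (x, t) :: ennreal) \<in> borel_measurable lborel" by measurable
    from elim nn_integral_0_iff_AE[OF this] have "AE x in lborel. indicator N (x, t) = (0 :: ennreal)" by simp
    then show ?case
      by eventually_elim (use N(2) in \<open>auto simp: indicator_def split: if_splits\<close>)
  qed
qed

text \<open>The inequality is carried by outer regularity to the very set \<open>A\<close> on which
  it fails pointwise. As \<open>g\<close> is bounded, enlarging \<open>A\<close> to an open set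
  costs little, and the integral of \<open>g\<close> over \<open>A\<close> is finite, so it may be
  subtracted; the non-negative difference then integrates to zero.\<close>

lemma AE_le_from_open_sets:
  fixes g h :: "real \<Rightarrow> ennreal"
  assumes [measurable]: "g \<in> borel_measurable borel" "h \<in> borel_measurable borel"
    and B: "\<And>t. t \<in> {0<..<T} \<Longrightarrow> g t \<le> ennreal B"
    and le: "\<And>U. open U \<Longrightarrow> U \<subseteq> {0<..<T} \<Longrightarrow> (\<integral>\<^sup>+ t. indicator U t * h t \<partial>lborel) \<le> (\<integral>\<^sup>+ t. indicator U t * g t \<partial>lborel)"
  shows "AE t in lborel. t \<in> {0<..<T} \<longrightarrow> h t \<le> g t"
proof -
  define A where "A = {t \<in> {0<..<T}. g t < h t}"
  have [measurable]: "A \<in> sets borel"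
  proof -
    have "A = {0<..<T} \<inter> {t \<in> space borel. g t < h t}" by (auto simp: A_def)
    also have "\<dots> \<in> sets borel" by measurable
    finally show ?thesis .
  qed
  have fin: "(\<integral>\<^sup>+ t. indicator A t * g t \<partial>lborel) < \<infinity>"
  proof -
    have "(\<integral>\<^sup>+ t. indicator A t * g t \<partial>lborel) \<le> (\<integral>\<^sup>+ t. ennreal B * indicator {0<..<T} t \<partial>lborel)"
      using B by (intro nn_integral_mono) (auto simp: A_def indicator_def)
    also have "\<dots> = ennreal B * emeasure lborel {0<..<T}" by (simp add: nn_integral_cmult)
    also have "\<dots> < \<infinity>"
      using emeasure_bounded_finite[of "{0<..<T}"] by (simp add: ennreal_mult_less_top)
    finally show ?thesis .
  qed
  have leA: "(\<integral>\<^sup>+ t. indicator A t * h t \<partial>lborel) \<le> (\<integral>\<^sup>+ t. indicator A t * g t \<partial>lborel)"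
  proof (rule ennreal_le_epsilon)
    fix e :: real assume e: "0 < e"
    define d where "d = e / (\<bar>B\<bar> + 1)"
    have d: "0 < d" "\<bar>B\<bar> * d \<le> e" using e by (auto simp: d_def field_simps)
    obtain U where U: "open U" "A \<subseteq> U" "emeasure lborel (U - A) < d"
      using outer_regular_lborel[OF _ d(1), of A] by auto
    have [measurable]: "U \<in> sets borel" using U by simp
    let ?U = "U \<inter> {0<..<T}"
    have "(\<integral>\<^sup>+ t. indicator A t * h t \<partial>lborel) \<le> (\<integral>\<^sup>+ t. indicator ?U t * h t \<partial>lborel)"
      using U(2) by (intro nn_integral_mono) (auto simp: A_def indicator_def)
    also have "\<dots> \<le> (\<integral>\<^sup>+ t. indicator ?U t * g t \<partial>lborel)"
      using U(1) by (intro le) auto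
    also have "\<dots> \<le> (\<integral>\<^sup>+ t. indicator A t * g t + ennreal \<bar>B\<bar> * indicator (U - A) t \<partial>lborel)"
    proof (intro nn_integral_mono)
      fix t
      have "t \<in> {0<..<T} \<Longrightarrow> g t \<le> ennreal \<bar>B\<bar>"
        using order_trans[OF B ennreal_leI[OF abs_ge_self]] .
      then show "indicator ?U t * g t \<le> indicator A t * g t + ennreal \<bar>B\<bar> * indicator (U - A) t"
        by (auto simp: indicator_def)
    qed
    also have "\<dots> = (\<integral>\<^sup>+ t. indicator A t * g t \<partial>lborel) + ennreal \<bar>B\<bar> * emeasure lborel (U - A)"
      by (subst nn_integral_add) (simp_all add: nn_integral_cmult)
    also have "ennreal \<bar>B\<bar> * emeasure lborel (U - A) \<le> ennreal \<bar>B\<bar> * ennreal d"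
      using U(3) by (intro mult_left_mono) auto
    also have "\<dots> \<le> ennreal e"
      using d by (simp add: ennreal_mult[symmetric] ennreal_leI)
    finally show "(\<integral>\<^sup>+ t. indicator A t * h t \<partial>lborel) \<le> (\<integral>\<^sup>+ t. indicator A t * g t \<partial>lborel) + ennreal e"
      by (simp add: add_left_mono)
  qed
  have "(\<integral>\<^sup>+ t. indicator A t * h t - indicator A t * g t \<partial>lborel)
      = (\<integral>\<^sup>+ t. indicator A t * h t \<partial>lborel) - (\<integral>\<^sup>+ t. indicator A t * g t \<partial>lborel)"
    using fin by (intro nn_integral_diff) (auto simp: A_def indicator_def less_imp_le)
  also have "\<dots> = 0" using leA fin by (simp add: diff_eq_0_iff_ennreal)
  finally have 0: "(\<integral>\<^sup>+ t. indicator A t * h t - indicator A t * g t \<partial>lborel) = 0" .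
  have m: "(\<lambda>t. indicator A t * h t - indicator A t * g t) \<in> borel_measurable lborel" by measurable
  have "AE t in lborel. indicator A t * h t - indicator A t * g t = 0"
    using 0 nn_integral_0_iff_AE[OF m] by simp
  then show ?thesis
  proof eventually_elim
    case (elim t)
    show ?case
    proof (intro impI, rule ccontr)
      assume t: "t \<in> {0<..<T}" "\<not> h t \<le> g t"
      then have tA: "t \<in> A" by (simp add: A_def not_le)
      have "g t < \<infinity>" using B[OF t(1)] by (auto intro: le_less_trans)
      moreover have "h t - g t = 0" using elim tA by simp
      ultimately show False using t(2) by (simp add: diff_eq_0_iff_ennreal)
    qed
  qed
qed

section \<open>From the inequality to an exponential bound at almost every time\<close>

context dissipative_setting
begin

text \<open>The weight solves the adjoint problem - \<theta>' = C \<theta> + \<rho> backwards from a time where \<rho> has vanished, so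
  that the integrated inequality yields the exponential bound tested against \<rho> without Gronwall's lemma.\<close>

lemma rb_test_bound:
  assumes C: "0 \<le> C" "AE z in lborel. z \<in> QO T \<longrightarrow> qb z \<le> C * rb z"
    and \<rho>: "continuous_on UNIV \<rho>" "\<And>t. 0 \<le> \<rho> t" "\<And>t. t \<le> 0 \<Longrightarrow> \<rho> t = 0" and \<tau>: "\<tau> < T" "\<And>t. \<tau> \<le> t \<Longrightarrow> \<rho> t = 0"
  shows "hQ (\<lambda>z. \<rho> (snd z) * rb z) (IQ (\<lambda>z. \<rho> (snd z) * rb z))"
    and "integrable lborel (\<lambda>s. exp (C * s) * \<rho> s)"
    and "IQ (\<lambda>z. \<rho> (snd z) * rb z) \<le> R0 * (LINT s|lborel. exp (C * s) * \<rho> s)"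
proof -
  define f where "f s = exp (C * s) * \<rho> s" for s
  define P where "P t = integral {-1..t} f" for t
  \<comment> \<open>\<tau> may be negative; \<sigma> is a non-negative time below \<open>T\<close>
    from which on \<rho> vanishes.\<close>
  define \<sigma> where "\<sigma> = max \<tau> 0"
  have \<sigma>: "0 \<le> \<sigma>" "\<tau> \<le> \<sigma>" by (auto simp: \<sigma>_def)
  have f: "continuous_on UNIV f" "\<And>t. 0 \<le> f t" "\<And>t. t \<le> 0 \<Longrightarrow> f t = 0" "\<And>t. \<sigma> \<le> t \<Longrightarrow> f t = 0"
    unfolding f_def using \<rho> \<tau>(2) \<sigma>(2) by (auto intro!: continuous_intros)
  have P: "(P has_real_derivative f t) (at t)" for t
    unfolding P_def by (rule global_antiderivative[OF f(1,3)])
  have mono: "P s \<le> P t" if "s \<le> t" for s t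
    using DERIV_nonneg_imp_nondecreasing[OF that, of P] P f(2) by blast
  have const: "P t = P \<sigma>" if "\<sigma> \<le> t" for t
  proof (cases "\<sigma> = t")
    case False
    then have "\<sigma> < t" using that by simp
    then have "\<exists>u>\<sigma>. u < t \<and> P t - P \<sigma> = (t - \<sigma>) * f u" by (rule MVT2) (rule P)
    then obtain u where "\<sigma> < u" "P t - P \<sigma> = (t - \<sigma>) * f u" by blast
    then show ?thesis using f(4)[of u] by simp
  qed simp
  have P0: "P 0 = 0"
  proof -
    have "integral {-1..0} f = integral {-1..0} (\<lambda>_ :: real. 0)"
      by (rule Henstock_Kurzweil_Integration.integral_cong) (simp add: f(3))
    then show ?thesis by (simp add: P_def)
  qed
  have fi: "integrable lborel f" and Pint: "P \<sigma> = (LINT s|lborel. f s)"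
  proof -
    have z: "f y = 0" if "y \<notin> cbox (-1) \<sigma>" for y
      using that f(3)[of y] f(4)[of y] by (cases "y \<le> \<sigma>") auto
    show "integrable lborel f" by (rule integral_local_support_eq(2)[OF f(1) z])
    show "P \<sigma> = (LINT s|lborel. f s)"
      using integral_local_support_eq(1)[OF f(1) z] by (simp add: P_def)
  qed
  show "integrable lborel (\<lambda>s. exp (C * s) * \<rho> s)" using fi by (simp add: f_def[abs_def])
  \<comment> \<open>Variation of constants for the adjoint equation with terminal value 0 at
    \<sigma>: an exponential times the integral of \<open>f\<close> from \<open>t\<close> to
    \<sigma>. Its value at 0 is the weighted integral in the claim.\<close>
  define \<theta> where "\<theta> t = exp (- C * t) * (P \<sigma> - P t)" for t
  define \<theta>' where "\<theta>' t = - C * \<theta> t - \<rho> t" for t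
  have d: "(\<theta> has_real_derivative \<theta>' t) (at t)" for t
  proof -
    have "(\<theta> has_real_derivative (exp (- C * t) * (- C)) * (P \<sigma> - P t) + (0 - f t) * exp (- C * t)) (at t)"
      unfolding \<theta>_def
      by (intro DERIV_mult DERIV_diff DERIV_const P) (auto intro!: derivative_eq_intros)
    moreover have "exp (- C * t) * exp (C * t) = 1" by (simp flip: exp_add)
    then have "(exp (- C * t) * (- C)) * (P \<sigma> - P t) + (0 - f t) * exp (- C * t) = \<theta>' t"
      unfolding \<theta>'_def \<theta>_def f_def by (simp add: algebra_simps)
    ultimately show ?thesis by simp
  qed
  have \<theta>n: "0 \<le> \<theta> t" for t
    using mono[of t \<sigma>] const[of t] by (cases "t \<le> \<sigma>") (auto simp: \<theta>_def)
  have c: "continuous_on UNIV \<theta>'"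
    unfolding \<theta>'_def using d by (intro continuous_intros \<rho>(1) continuous_at_imp_continuous_on) (blast intro: DERIV_isCont)
  have sT: "\<sigma> < T" using \<tau>(1) T_pos by (simp add: \<sigma>_def)
  interpret W: test_weight G DG D2G D3G m M T v0 F0 v F \<nu> \<gamma> vh Fh \<theta> \<theta>' \<sigma>
  proof unfold_locales
    show "(\<theta> has_real_derivative \<theta>' t) (at t)" for t by (rule d)
    show "continuous_on UNIV \<theta>'" by (rule c)
    show "0 \<le> \<theta> t" for t by (rule \<theta>n)
    show "\<sigma> < T" by (rule sT)
    show "\<theta> t = 0" if "\<sigma> \<le> t" for t using const[OF that] by (simp add: \<theta>_def)
  qed
  have r: "ess_bdd (\<lambda>z. \<rho> (snd z))"
  proof -
    have "compact (\<rho> ` {0..T})" by (intro compact_continuous_image continuous_on_subset[OF \<rho>(1)] compact_Icc) simp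
    then have "bounded (\<rho> ` {0..T})" by (rule compact_imp_bounded)
    then obtain B where B: "\<forall>y\<in>\<rho> ` {0..T}. norm y \<le> B" unfolding bounded_iff by blast
    have "AE z in lborel. z \<in> QO T \<longrightarrow> \<bar>\<rho> (snd z)\<bar> \<le> B"
    proof (intro AE_I2 impI)
      fix z assume "z \<in> QO T"
      then have "snd z \<in> {0..T}" by (simp add: QO_def)
      then show "\<bar>\<rho> (snd z)\<bar> \<le> B" using B by (metis imageI real_norm_def)
    qed
    moreover have "(\<lambda>z::vec3 \<times> real. \<rho> (snd z)) \<in> borel_measurable borel"
      using borel_measurable_continuous_onI[OF \<rho>(1)] by measurable
    ultimately show ?thesis unfolding ess_bdd_def by blast
  qed
  show hr: "hQ (\<lambda>z. \<rho> (snd z) * rb z) (IQ (\<lambda>z. \<rho> (snd z) * rb z))" by (rule hQ_rb[OF r])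
  have "hQ (\<lambda>z. W.\<Theta>t z * rb z + C * (W.\<Theta> z * rb z)) (IQ (\<lambda>z. W.\<Theta>t z * rb z) + C * IQ (\<lambda>z. W.\<Theta> z * rb z))"
    by (intro hI_add hI_cmult hQ_rb W.ess_bdd_\<Theta> W.ess_bdd_\<Theta>t)
  moreover have "hQ (\<lambda>z. (- 1) * (\<rho> (snd z) * rb z)) ((- 1) * IQ (\<lambda>z. \<rho> (snd z) * rb z))"
    by (intro hI_cmult hr)
  ultimately have e: "IQ (\<lambda>z. W.\<Theta>t z * rb z) + C * IQ (\<lambda>z. W.\<Theta> z * rb z) = (- 1) * IQ (\<lambda>z. \<rho> (snd z) * rb z)"
    by (rule hQ_unique) (intro AE_I2 impI, simp add: W.\<Theta>t_def W.\<Theta>_QO \<theta>'_def algebra_simps)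
  \<comment> \<open>The sign of the integrand decides; were it not integrable, the integral would be
    0 by convention and the inequality still true.\<close>
  have "(LINT z:QT T|\<gamma>. \<theta>' (snd z)) \<le> 0"
  proof -
    have "\<theta>' t \<le> 0" for t
      using \<rho>(2)[of t] mult_nonneg_nonneg[OF C(1) \<theta>n[of t]] unfolding \<theta>'_def by linarith
    then have "0 \<le> (LINT z|\<gamma>. - (indicator (QT T) z *\<^sub>R \<theta>' (snd z)))"
      by (intro Bochner_Integration.integral_nonneg) (auto simp: indicator_def)
    then show ?thesis by (simp add: set_lebesgue_integral_def)
  qed
  with W.relative_entropy_inequality[OF C] e
  have "IQ (\<lambda>z. \<rho> (snd z) * rb z) \<le> \<theta> 0 * R0" by linarith
  also have "\<theta> 0 = (LINT s|lborel. exp (C * s) * \<rho> s)"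
    using Pint P0 by (simp add: \<theta>_def f_def)
  finally show "IQ (\<lambda>z. \<rho> (snd z) * rb z) \<le> R0 * (LINT s|lborel. exp (C * s) * \<rho> s)" by (simp add: mult.commute)
qed

end

context dissipative_setting
begin

lemma R0_nonneg: "0 \<le> R0"
  unfolding R0_def I0_def by (intro Bochner_Integration.integral_nonneg mult_nonneg_nonneg rel_nonneg) simp

text \<open>Extended values make the slice defined and measurable in \<open>t\<close> without
  integrability. Converting to \<open>ennreal\<close> cuts off negative values of \<open>rb\<close>,
  which occur in the interior of the cylinder only on a null set.\<close>

definition slice :: "real \<Rightarrow> ennreal" where
  "slice t = (\<integral>\<^sup>+ x. indicator Qcell x * ennreal (rb (x, t)) \<partial>lborel)"

lemma slice_measurable:
  assumes [measurable]: "(f :: vec3 \<times> real \<Rightarrow> ennreal) \<in> borel_measurable borel"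
  shows "(\<lambda>t. \<integral>\<^sup>+ x. indicator Qcell x * f (x, t) \<partial>lborel) \<in> borel_measurable borel"
proof -
  have "f \<in> borel_measurable (borel \<Otimes>\<^sub>M borel)" using assms by (simp only: borel_prod)
  note [measurable] = this
  have "(\<lambda>(t, x). indicator Qcell x * f (x, t)) \<in> borel_measurable (borel \<Otimes>\<^sub>M lborel)" by measurable
  from lborel.borel_measurable_nn_integral[OF this] show ?thesis by simp
qed

lemma rb_ennreal_borel: "(\<lambda>z. ennreal (rb z)) \<in> borel_measurable borel"
  by measurable

text \<open>The bound tested with continuous \<rho> is transferred to indicators of open sets by
  increasing approximation and from there to almost every time.\<close>

lemma slice_bound:
  assumes C: "0 \<le> C" "AE z in lborel. z \<in> QO T \<longrightarrow> qb z \<le> C * rb z"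
  shows "AE t in lborel. t \<in> {0<..<T} \<longrightarrow> slice t \<le> ennreal (R0 * exp (C * t))"
proof (rule AE_le_from_open_sets)
  show "(\<lambda>t. ennreal (R0 * exp (C * t))) \<in> borel_measurable borel" by measurable
  show sm: "slice \<in> borel_measurable borel"
    unfolding slice_def[abs_def] by (rule slice_measurable[OF rb_ennreal_borel])
  note [measurable] = sm rb_ennreal_borel
  show "ennreal (R0 * exp (C * t)) \<le> ennreal (R0 * exp (C * T))" if "t \<in> {0<..<T}" for t
    using that C(1) R0_nonneg by (intro ennreal_leI mult_left_mono) (auto intro: mult_left_mono)
  fix U assume U: "open U" "U \<subseteq> {0<..<T}"
  \<comment> \<open>Subtracting 1 makes \<open>\<rho> k\<close> vanish where the distance to the
    complement of \<open>U\<close> is at most \<open>1 / k\<close>. Since \<open>T\<close> lies in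
    the complement, \<open>\<rho> k\<close> is zero near \<open>T\<close>; the cut-off uses
    \<open>k + 1\<close> to include \<open>k = 0\<close>.\<close>
  define \<rho> where "\<rho> k t = min 1 (max 0 (real k * infdist t (- U) - 1))" for k :: nat and t
  have ne: "- U \<noteq> {}" "0 \<in> - U" "T \<in> - U" using U(2) by auto
  have \<rho>: "continuous_on UNIV (\<rho> k)" "0 \<le> \<rho> k t" "\<rho> k t \<le> 1" for k t
    unfolding \<rho>_def by (auto intro!: continuous_intros)
  have \<rho>U: "\<rho> k t = 0" if "t \<notin> U" for k t
    using that by (simp add: \<rho>_def)
  have \<rho>0: "\<rho> k t = 0" if "t \<le> 0" for k t
    using that U(2) by (intro \<rho>U) auto
  have \<rho>T: "\<rho> k t = 0" if "T - 1 / real (Suc k) \<le> t" for k t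
  proof (cases "t < T")
    case True
    have "infdist t (- U) \<le> T - t" using infdist_le[OF ne(3), of t] True by (simp add: dist_real_def)
    also have "\<dots> \<le> 1 / real (Suc k)" using that by linarith
    finally have "real (Suc k) * infdist t (- U) \<le> 1" by (simp add: field_simps)
    moreover have "real k * infdist t (- U) \<le> real (Suc k) * infdist t (- U)"
      by (intro mult_right_mono infdist_nonneg) simp
    ultimately show ?thesis by (simp add: \<rho>_def)
  next
    case False
    then show ?thesis using U(2) by (intro \<rho>U) auto
  qed
  have \<rho>m[measurable]: "\<rho> k \<in> borel_measurable borel" for k by (intro borel_measurable_continuous_onI \<rho>)
  have inc: "\<rho> k t \<le> \<rho> l t" if "k \<le> l" for k l t
  proof -
    have "real k * infdist t (- U) \<le> real l * infdist t (- U)"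
      using that by (intro mult_right_mono infdist_nonneg) simp
    then show ?thesis unfolding \<rho>_def by (intro min.mono max.mono order_refl) linarith
  qed
  have lim: "(SUP k. ennreal (\<rho> k t)) = indicator U t" for t
  proof (rule antisym)
    show "(SUP k. ennreal (\<rho> k t)) \<le> indicator U t"
      by (intro SUP_least) (auto simp: indicator_def \<rho>U \<rho>(3) ennreal_le_1)
    show "indicator U t \<le> (SUP k. ennreal (\<rho> k t))"
    proof (cases "t \<in> U")
      case True
      have "t \<notin> closure (- U)" using U(1) True by (simp add: closure_closed open_closed)
      then have d: "0 < infdist t (- U)"
        using in_closure_iff_infdist_zero[OF ne(1), of t] infdist_nonneg[of t "- U"] by (auto simp: less_le)
      obtain n where n: "2 < real n * infdist t (- U)" using reals_Archimedean3[OF d] by blast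
      then have "\<rho> n t = 1" by (simp add: \<rho>_def)
      then show ?thesis using True SUP_upper[of n UNIV "\<lambda>k. ennreal (\<rho> k t)"] by simp
    qed simp
  qed
  have k: "(\<integral>\<^sup>+ t. ennreal (\<rho> k t) * slice t \<partial>lborel) \<le> (\<integral>\<^sup>+ t. indicator U t * ennreal (R0 * exp (C * t)) \<partial>lborel)" for k
  proof -
    have lt: "T - 1 / real (Suc k) < T" by simp
    note b = rb_test_bound[OF C \<rho>(1)[of k] \<rho>(2)[of k] \<rho>0[of _ k] lt \<rho>T[of k]]
    have [measurable]: "(\<lambda>z :: vec3 \<times> real. ennreal (\<rho> k (snd z)) * ennreal (rb z)) \<in> borel_measurable borel" by measurable
    have "(\<integral>\<^sup>+ t. ennreal (\<rho> k t) * slice t \<partial>lborel)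
        = (\<integral>\<^sup>+ t. indicator {0..T} t * (\<integral>\<^sup>+ x. indicator Qcell x * (ennreal (\<rho> k t) * ennreal (rb (x, t))) \<partial>lborel) \<partial>lborel)"
    proof (intro nn_integral_cong)
      fix t :: real
      have m: "(\<lambda>x. indicator Qcell x * ennreal (rb (x, t))) \<in> borel_measurable lborel" by measurable
      have "(\<integral>\<^sup>+ x. indicator Qcell x * (ennreal (\<rho> k t) * ennreal (rb (x, t))) \<partial>lborel) = ennreal (\<rho> k t) * slice t"
        unfolding slice_def nn_integral_cmult[OF m, symmetric] by (intro nn_integral_cong) (simp add: mult.left_commute)
      moreover have "\<rho> k t = 0" if "t \<notin> {0..T}"
        using that U(2) by (intro \<rho>U) auto
      ultimately show "ennreal (\<rho> k t) * slice t = indicator {0..T} t * (\<integral>\<^sup>+ x. indicator Qcell x * (ennreal (\<rho> k t) * ennreal (rb (x, t))) \<partial>lborel)"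
        by (cases "t \<in> {0..T}") simp_all
    qed
    also have "\<dots> = (\<integral>\<^sup>+ z. indicator (QTbar T) z * (ennreal (\<rho> k (snd z)) * ennreal (rb z)) \<partial>lborel)"
      by (subst nn_integral_QTbar) (simp_all only: snd_conv, measurable)
    also have "\<dots> = (\<integral>\<^sup>+ z. ennreal (indicator (QT T) z * (\<rho> k (snd z) * rb z)) \<partial>lborel)"
    proof (rule nn_integral_cong_AE)
      show "AE z in lborel. indicator (QTbar T) z * (ennreal (\<rho> k (snd z)) * ennreal (rb z)) = ennreal (indicator (QT T) z * (\<rho> k (snd z) * rb z))"
        using AE_QTbar_QT[of T] by eventually_elim (simp add: indicator_def ennreal_mult' \<rho>(2))
    qed
    also have "\<dots> = ennreal (IQ (\<lambda>z. \<rho> k (snd z) * rb z))"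
      unfolding IQ_def
    proof (rule nn_integral_eq_integral)
      show "integrable lborel (\<lambda>z. indicator (QT T) z * (\<rho> k (snd z) * rb z))"
        using b(1) unfolding hI_def by (rule integrable.intros)
      show "AE z in lborel. 0 \<le> indicator (QT T) z * (\<rho> k (snd z) * rb z)"
        using rb_nonneg AE_QT_QO[of T] by eventually_elim (auto simp: indicator_def \<rho>(2))
    qed
    also have "\<dots> \<le> ennreal (R0 * (LINT s|lborel. exp (C * s) * \<rho> k s))" by (rule ennreal_leI[OF b(3)])
    also have "\<dots> = ennreal (LINT s|lborel. R0 * (exp (C * s) * \<rho> k s))" by simp
    also have "\<dots> = (\<integral>\<^sup>+ s. ennreal (R0 * (exp (C * s) * \<rho> k s)) \<partial>lborel)"
      using b(2) R0_nonneg \<rho>(2) by (intro nn_integral_eq_integral[symmetric] AE_I2 integrable_mult_right) auto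
    also have "\<dots> \<le> (\<integral>\<^sup>+ t. indicator U t * ennreal (R0 * exp (C * t)) \<partial>lborel)"
    proof (intro nn_integral_mono)
      fix t
      have "R0 * (exp (C * t) * \<rho> k t) \<le> R0 * (exp (C * t) * 1)"
        using \<rho>(3) R0_nonneg by (intro mult_left_mono) auto
      then show "ennreal (R0 * (exp (C * t) * \<rho> k t)) \<le> indicator U t * ennreal (R0 * exp (C * t))"
        using \<rho>U[of t k] by (cases "t \<in> U") (auto intro: ennreal_leI)
    qed
    finally show ?thesis .
  qed
  have "(\<integral>\<^sup>+ t. indicator U t * slice t \<partial>lborel) = (\<integral>\<^sup>+ t. (SUP k. ennreal (\<rho> k t) * slice t) \<partial>lborel)"
    by (simp only: lim[symmetric] SUP_mult_right_ennreal)
  also have "\<dots> = (SUP k. \<integral>\<^sup>+ t. ennreal (\<rho> k t) * slice t \<partial>lborel)"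
  proof (rule nn_integral_monotone_convergence_SUP)
    show "incseq (\<lambda>k t. ennreal (\<rho> k t) * slice t)"
      unfolding incseq_def le_fun_def by (intro allI impI mult_right_mono ennreal_leI inc) auto
  qed measurable
  also have "\<dots> \<le> (\<integral>\<^sup>+ t. indicator U t * ennreal (R0 * exp (C * t)) \<partial>lborel)" by (intro SUP_least k)
  finally show "(\<integral>\<^sup>+ t. indicator U t * slice t \<partial>lborel) \<le> (\<integral>\<^sup>+ t. indicator U t * ennreal (R0 * exp (C * t)) \<partial>lborel)" .
qed

definition dsq :: "vec3 \<times> mat3 \<Rightarrow> vec3 \<times> real \<Rightarrow> real" where
  "dsq w z = (norm (fst w - V z))\<^sup>2 + (norm (snd w - W z))\<^sup>2"

definition J0 :: real where "J0 = I0 (\<lambda>x. dsq (v0 x, F0 x) (x, 0))"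

lemma dsq_nonneg: "0 \<le> dsq w z" by (simp add: dsq_def)

lemma VW_borel [measurable]: "V \<in> borel_measurable borel" "W \<in> borel_measurable borel"
  using hat_lipschitz lipschitz_borel by blast+

text \<open>Pointwise this is the upper bound for \<open>rel\<close>. What has to be added is
  integrability of the squared initial distance, without which its integral would be 0 by convention
  and could not dominate anything.\<close>

lemma R0_le_J0: "R0 \<le> max 1 M / 2 * J0"
proof -
  obtain B where B: "\<And>z. norm (V z) \<le> B" using hat_bounded(1) by blast
  obtain D where D: "\<And>z. norm (W z) \<le> D" using hat_bounded(2) by blast
  have sq2: "(norm (a - b))\<^sup>2 \<le> 2 * (norm b)\<^sup>2 + 2 * (norm a)\<^sup>2" for a b :: "'c::real_inner"
  proof -
    have "(norm (a - b))\<^sup>2 \<le> (norm a + norm b)\<^sup>2" by (intro power_mono norm_triangle_ineq4) simp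
    also have "\<dots> \<le> 2 * (norm b)\<^sup>2 + 2 * (norm a)\<^sup>2"
      using sum_squares_bound[of "norm a" "norm b"] by (simp add: power2_sum)
    finally show ?thesis .
  qed
  have 1: "integrable lborel (\<lambda>x. indicator Qcell x * (norm (v0 x - V (x, 0)))\<^sup>2)"
  proof (rule integrable_Qcell_square_component[OF v0_meas _ v0_sq, of _ "2 * B\<^sup>2" 2])
    show "\<bar>(norm (v0 x - V (x, 0)))\<^sup>2\<bar> \<le> 2 * B\<^sup>2 + 2 * (norm (v0 x))\<^sup>2" for x
      using sq2[of "v0 x" "V (x, 0)"] power_mono[OF B norm_ge_zero, of "(x, 0)" 2] by simp
  qed measurable
  have 2: "integrable lborel (\<lambda>x. indicator Qcell x * (norm (F0 x - W (x, 0)))\<^sup>2)"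
  proof (rule integrable_Qcell_square_component[OF F0_meas _ F0_sq, of _ "2 * D\<^sup>2" 2])
    show "\<bar>(norm (F0 x - W (x, 0)))\<^sup>2\<bar> \<le> 2 * D\<^sup>2 + 2 * (norm (F0 x))\<^sup>2" for x
      using sq2[of "F0 x" "W (x, 0)"] power_mono[OF D norm_ge_zero, of "(x, 0)" 2] by simp
  qed measurable
  have i: "integrable lborel (\<lambda>x. indicator Qcell x * dsq (v0 x, F0 x) (x, 0))"
    unfolding dsq_def fst_conv snd_conv distrib_left by (rule Bochner_Integration.integrable_add[OF 1 2])
  have "R0 \<le> (LINT x|lborel. max 1 M / 2 * (indicator Qcell x * dsq (v0 x, F0 x) (x, 0)))"
    unfolding R0_def I0_def
  proof (rule integral_mono)
    show "integrable lborel (\<lambda>x. indicator Qcell x * rel (v0 x, F0 x) (x, 0))"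
      using h0_R0 unfolding hI_def by (rule integrable.intros)
    show "integrable lborel (\<lambda>x. max 1 M / 2 * (indicator Qcell x * dsq (v0 x, F0 x) (x, 0)))"
      by (intro integrable_mult_right i)
    show "indicator Qcell x * rel (v0 x, F0 x) (x, 0) \<le> max 1 M / 2 * (indicator Qcell x * dsq (v0 x, F0 x) (x, 0))" for x
      using rel_upper[of "(v0 x, F0 x)" "(x, 0)"] by (cases "x \<in> Qcell") (simp_all add: dsq_def)
  qed
  then show ?thesis by (simp add: J0_def I0_def)
qed

text \<open>The constant inverts the lower bound \<open>min 1 m / 2\<close> for \<open>rel\<close>.
  The inequality is obtained almost everywhere in space-time and then restricted to time
  slices.\<close>

lemma dsq_slice_le:
  "AE t in lborel. t \<in> {0<..<T} \<longrightarrow>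
     (\<integral>\<^sup>+ x. indicator Qcell x * (\<integral>\<^sup>+ w. ennreal (dsq w (x, t)) \<partial>K (x, t)) \<partial>lborel) \<le> ennreal (2 / min 1 m) * slice t"
proof -
  have c: "0 < 2 / min 1 m" using m_pos by simp
  have "AE z in lborel. z \<in> QTbar T \<longrightarrow> (\<integral>\<^sup>+ w. ennreal (dsq w z) \<partial>K z) \<le> ennreal (2 / min 1 m) * ennreal (rb z)"
    using rb_mean
  proof eventually_elim
    case (elim z)
    show ?case
    proof
      assume "z \<in> QTbar T"
      then have r: "integrable (K z) (\<lambda>w. rel w z)" "rb z = (LINT w|K z. rel w z)" using elim by blast+
      have "(\<integral>\<^sup>+ w. ennreal (dsq w z) \<partial>K z) \<le> (\<integral>\<^sup>+ w. ennreal (2 / min 1 m * rel w z) \<partial>K z)"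
      proof (intro nn_integral_mono ennreal_leI)
        fix w
        have "dsq w z = 2 / min 1 m * (min 1 m / 2 * dsq w z)" using m_pos by (simp add: field_simps)
        also have "\<dots> \<le> 2 / min 1 m * rel w z"
          using rel_lower[of w z] c by (intro mult_left_mono) (auto simp: dsq_def)
        finally show "dsq w z \<le> 2 / min 1 m * rel w z" .
      qed
      also have "\<dots> = ennreal (LINT w|K z. 2 / min 1 m * rel w z)"
        using r(1) c rel_nonneg[of _ z] by (intro nn_integral_eq_integral AE_I2 integrable_mult_right mult_nonneg_nonneg) auto
      also have "\<dots> = ennreal (2 / min 1 m) * ennreal (rb z)"
        unfolding integral_mult_right_zero r(2)[symmetric] by (rule ennreal_mult'[OF less_imp_le[OF c]])
      finally show "(\<integral>\<^sup>+ w. ennreal (dsq w z) \<partial>K z) \<le> ennreal (2 / min 1 m) * ennreal (rb z)" .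
    qed
  qed
  from AE_time_slices[OF this] show ?thesis
  proof eventually_elim
    case (elim t)
    show ?case
    proof
      assume t: "t \<in> {0<..<T}"
      have m: "(\<lambda>x. indicator Qcell x * ennreal (rb (x, t))) \<in> borel_measurable lborel" by measurable
      have "(\<integral>\<^sup>+ x. indicator Qcell x * (\<integral>\<^sup>+ w. ennreal (dsq w (x, t)) \<partial>K (x, t)) \<partial>lborel)
          \<le> (\<integral>\<^sup>+ x. ennreal (2 / min 1 m) * (indicator Qcell x * ennreal (rb (x, t))) \<partial>lborel)"
      proof (rule nn_integral_mono_AE)
        show "AE x in lborel. indicator Qcell x * (\<integral>\<^sup>+ w. ennreal (dsq w (x, t)) \<partial>K (x, t))
            \<le> ennreal (2 / min 1 m) * (indicator Qcell x * ennreal (rb (x, t)))"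
          using elim
        proof eventually_elim
          case (elim x)
          then show ?case using t by (cases "x \<in> Qcell") (simp_all add: QTbar_def)
        qed
      qed
      also have "\<dots> = ennreal (2 / min 1 m) * slice t"
        unfolding slice_def by (rule nn_integral_cmult[OF m])
      finally show "(\<integral>\<^sup>+ x. indicator Qcell x * (\<integral>\<^sup>+ w. ennreal (dsq w (x, t)) \<partial>K (x, t)) \<partial>lborel) \<le> ennreal (2 / min 1 m) * slice t" .
    qed
  qed
qed

text \<open>The constant is the product of \<open>2 / min 1 m\<close>, from distance to entropy at
  time \<open>t\<close>, and of \<open>max 1 M / 2\<close>, from entropy to distance at time 0. The
  endpoints of the time interval are a null set.\<close>

lemma dsq_slice_bound:
  assumes C: "0 \<le> C" "AE z in lborel. z \<in> QO T \<longrightarrow> qb z \<le> C * rb z"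
  shows "AE t in lborel. t \<in> {0..T} \<longrightarrow>
     (\<integral>\<^sup>+ x. indicator Qcell x * (\<integral>\<^sup>+ w. ennreal (dsq w (x, t)) \<partial>K (x, t)) \<partial>lborel)
     \<le> ennreal (max 1 M / min 1 m * J0 * exp (C * t))"
proof -
  have "AE t in lborel. t \<noteq> 0 \<and> t \<noteq> T"
    using AE_lborel_singleton[of 0] AE_lborel_singleton[of T] by eventually_elim simp
  then show ?thesis
    using dsq_slice_le slice_bound[OF C]
  proof eventually_elim
    case (elim t)
    show ?case
    proof
      assume "t \<in> {0..T}"
      then have t: "t \<in> {0<..<T}" using elim(1) by auto
      then have "(\<integral>\<^sup>+ x. indicator Qcell x * (\<integral>\<^sup>+ w. ennreal (dsq w (x, t)) \<partial>K (x, t)) \<partial>lborel) \<le> ennreal (2 / min 1 m) * slice t"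
        using elim(2) by blast
      also have "\<dots> \<le> ennreal (2 / min 1 m) * ennreal (R0 * exp (C * t))"
        using elim(3) t by (intro mult_left_mono) auto
      also have "\<dots> = ennreal (2 / min 1 m * R0 * exp (C * t))"
        using m_pos by (simp add: ennreal_mult'[symmetric] mult.assoc)
      also have "\<dots> \<le> ennreal (max 1 M / min 1 m * J0 * exp (C * t))"
      proof (intro ennreal_leI mult_right_mono)
        have "2 / min 1 m * R0 \<le> 2 / min 1 m * (max 1 M / 2 * J0)"
          using R0_le_J0 m_pos by (intro mult_left_mono) auto
        then show "2 / min 1 m * R0 \<le> max 1 M / min 1 m * J0" by simp
      qed simp
      finally show "(\<integral>\<^sup>+ x. indicator Qcell x * (\<integral>\<^sup>+ w. ennreal (dsq w (x, t)) \<partial>K (x, t)) \<partial>lborel)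
         \<le> ennreal (max 1 M / min 1 m * J0 * exp (C * t))" .
    qed
  qed
qed

end

section \<open>Stability estimate, Dirac property and absence of concentration\<close>

context dissipative_setting
begin

lemma hat_values: "0 \<le> t \<Longrightarrow> t \<le> T \<Longrightarrow> V (x, t) = vh x t" "0 \<le> t \<Longrightarrow> t \<le> T \<Longrightarrow> W (x, t) = Fh x t"
  by (simp_all add: V_def W_def tclamp_def clampT_id)

lemma stability:
  "\<exists>c1 c2. 0 < c1 \<and> 0 < c2 \<and>
    (AE t in lborel. t \<in> {0..T} \<longrightarrow>
      (\<integral>\<^sup>+x. indicator Qcell x *
          (\<integral>\<^sup>+w. ennreal ((norm (fst w - vh x t))^2 + (norm (snd w - Fh x t))^2) \<partial>\<nu> x t)
        \<partial>lborel)
      \<le> ennreal (c1 * (LINT x:Qcell|lborel.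
             (norm (v0 x - vh x 0))^2 + (norm (F0 x - Fh x 0))^2) * exp (c2 * t)))"
proof -
  obtain C where C: "0 \<le> C" "AE z in lborel. z \<in> QO T \<longrightarrow> qb z \<le> C * rb z"
    using qb_bound by blast
  have J: "J0 = (LINT x:Qcell|lborel. (norm (v0 x - vh x 0))^2 + (norm (F0 x - Fh x 0))^2)"
    using T_pos by (simp add: J0_def I0_def set_lebesgue_integral_def dsq_def hat_values)
  have J0: "0 \<le> J0" unfolding J0_def I0_def by (intro Bochner_Integration.integral_nonneg mult_nonneg_nonneg dsq_nonneg) simp
  have c1: "0 < max 1 M / min 1 m" using m_pos M_pos by simp
  \<comment> \<open>\<open>C\<close> may be 0 whereas a positive rate is claimed, so it is enlarged
    by 1; this is harmless as \<open>t\<close> and the prefactor are non-negative.\<close>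
  have "AE t in lborel. t \<in> {0..T} \<longrightarrow>
      (\<integral>\<^sup>+x. indicator Qcell x *
          (\<integral>\<^sup>+w. ennreal ((norm (fst w - vh x t))^2 + (norm (snd w - Fh x t))^2) \<partial>\<nu> x t)
        \<partial>lborel) \<le> ennreal (max 1 M / min 1 m * J0 * exp ((C + 1) * t))"
    using dsq_slice_bound[OF C]
  proof eventually_elim
    case (elim t)
    show ?case
    proof
      assume t: "t \<in> {0..T}"
      have "(\<integral>\<^sup>+x. indicator Qcell x *
          (\<integral>\<^sup>+w. ennreal ((norm (fst w - vh x t))^2 + (norm (snd w - Fh x t))^2) \<partial>\<nu> x t) \<partial>lborel)
         = (\<integral>\<^sup>+ x. indicator Qcell x * (\<integral>\<^sup>+ w. ennreal (dsq w (x, t)) \<partial>K (x, t)) \<partial>lborel)"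
      proof (intro nn_integral_cong)
        fix x
        show "indicator Qcell x * (\<integral>\<^sup>+w. ennreal ((norm (fst w - vh x t))^2 + (norm (snd w - Fh x t))^2) \<partial>\<nu> x t)
          = indicator Qcell x * (\<integral>\<^sup>+ w. ennreal (dsq w (x, t)) \<partial>K (x, t))"
          using t by (cases "x \<in> Qcell") (simp_all add: dsq_def hat_values K_def QTbar_def)
      qed
      also have "\<dots> \<le> ennreal (max 1 M / min 1 m * J0 * exp (C * t))" using elim t by blast
      also have "\<dots> \<le> ennreal (max 1 M / min 1 m * J0 * exp ((C + 1) * t))"
        using J0 c1 t C(1) by (intro ennreal_leI mult_left_mono mult_nonneg_nonneg) (auto intro: mult_right_mono)
      finally show "(\<integral>\<^sup>+x. indicator Qcell x *
          (\<integral>\<^sup>+w. ennreal ((norm (fst w - vh x t))^2 + (norm (snd w - Fh x t))^2) \<partial>\<nu> x t)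
        \<partial>lborel) \<le> ennreal (max 1 M / min 1 m * J0 * exp ((C + 1) * t))" .
    qed
  qed
  then show ?thesis
    using c1 C(1) unfolding J by (intro exI[of _ "max 1 M / min 1 m"] exI[of _ "C + 1"] conjI) auto
qed

lemma dsq_kernel_measurable: "(\<lambda>z. \<integral>\<^sup>+ w. ennreal (dsq w z) \<partial>K z) \<in> borel_measurable borel"
proof (rule nn_mean_measurable)
  have [measurable]: "fst \<in> borel_measurable (borel :: (vec3 \<times> mat3) measure)" "snd \<in> borel_measurable (borel :: (vec3 \<times> mat3) measure)"
    by (intro borel_measurable_continuous_onI continuous_on_fst continuous_on_snd continuous_on_id)+
  show "(\<lambda>(z, w). ennreal (dsq w z)) \<in> borel_measurable (borel \<Otimes>\<^sub>M borel)"
    unfolding dsq_def by measurable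
qed

text \<open>Equal initial data make \<open>J0\<close> and with it \<open>R0\<close> vanish, so the
  squared distance has mean 0 under almost every \<open>K z\<close>: a probability measure
  concentrated at one point is a Dirac mass, and its barycentre is that point. The mean relative
  entropy then vanishes, too, and the relative entropy inequality reduces to a statement about
  \<gamma>.\<close>

lemma uniqueness:
  assumes init: "AE x in lborel. x \<in> Qcell \<longrightarrow> v0 x = vh x 0 \<and> F0 x = Fh x 0"
  shows "AE z in lborel. z \<in> QT T \<longrightarrow>
               v (fst z) (snd z) = vh (fst z) (snd z) \<and>
               F (fst z) (snd z) = Fh (fst z) (snd z) \<and>
               \<nu> (fst z) (snd z) = return borel (vh (fst z) (snd z), Fh (fst z) (snd z))"
    and "emeasure \<gamma> (QT T) = 0"
proof -
  obtain C where C: "0 \<le> C" "AE z in lborel. z \<in> QO T \<longrightarrow> qb z \<le> C * rb z"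
    using qb_bound by blast
  have "J0 = (LINT x::vec3|lborel. 0)"
    unfolding J0_def I0_def
  proof (rule integral_cong_AE)
    show "AE x in lborel. indicator Qcell x * dsq (v0 x, F0 x) (x, 0) = 0"
      using init by eventually_elim (use T_pos in \<open>simp add: indicator_def dsq_def hat_values\<close>)
    show "(\<lambda>x. indicator Qcell x * dsq (v0 x, F0 x) (x, 0)) \<in> borel_measurable lborel"
      unfolding dsq_def fst_conv snd_conv by measurable
  qed simp
  then have J0: "J0 = 0" by simp
  then have R0: "R0 = 0" using R0_le_J0 R0_nonneg by simp
  note [measurable] = dsq_kernel_measurable
  have "AE t in lborel. indicator {0..T} t * (\<integral>\<^sup>+ x. indicator Qcell x * (\<integral>\<^sup>+ w. ennreal (dsq w (x, t)) \<partial>K (x, t)) \<partial>lborel) = 0"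
    using dsq_slice_bound[OF C] by eventually_elim (simp add: J0 indicator_def)
  then have "(\<integral>\<^sup>+ t. indicator {0..T} t * (\<integral>\<^sup>+ x. indicator Qcell x * (\<integral>\<^sup>+ w. ennreal (dsq w (x, t)) \<partial>K (x, t)) \<partial>lborel) \<partial>lborel) = (\<integral>\<^sup>+ t. 0 \<partial>(lborel :: real measure))"
    by (rule nn_integral_cong_AE)
  then have "(\<integral>\<^sup>+ z. indicator (QTbar T) z * (\<integral>\<^sup>+ w. ennreal (dsq w z) \<partial>K z) \<partial>lborel) = 0"
    using nn_integral_QTbar[OF dsq_kernel_measurable, of T] by simp
  moreover have "(\<lambda>z. indicator (QTbar T) z * (\<integral>\<^sup>+ w. ennreal (dsq w z) \<partial>K z)) \<in> borel_measurable lborel" by measurable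
  ultimately have "AE z in lborel. indicator (QTbar T) z * (\<integral>\<^sup>+ w. ennreal (dsq w z) \<partial>K z) = 0"
    using nn_integral_0_iff_AE by blast
  then have dirac: "AE z in lborel. z \<in> QTbar T \<longrightarrow> K z = return borel (V z, W z)"
  proof eventually_elim
    case (elim z)
    show ?case
    proof
      assume "z \<in> QTbar T"
      then have 0: "(\<integral>\<^sup>+ w. ennreal (dsq w z) \<partial>K z) = 0" using elim by simp
      interpret prob_space "K z" by (rule prob_space_K)
      have "continuous_on UNIV (\<lambda>w. dsq w z)" unfolding dsq_def by (intro continuous_intros)
      then have "(\<lambda>w. dsq w z) \<in> borel_measurable borel" by (rule borel_measurable_continuous_onI)
      then have m: "(\<lambda>w. ennreal (dsq w z)) \<in> borel_measurable (K z)" by measurable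
      have "AE w in K z. ennreal (dsq w z) = 0" using 0 nn_integral_0_iff_AE[OF m] by simp
      then have "AE w in K z. w = (V z, W z)"
      proof eventually_elim
        case (elim w)
        then have "dsq w z = 0" using dsq_nonneg[of w z] by simp
        then have "norm (fst w - V z) = 0" "norm (snd w - W z) = 0"
          unfolding dsq_def by (simp_all add: add_nonneg_eq_0_iff)
        then show ?case by (simp add: prod_eq_iff)
      qed
      from AE_eq_constD(1)[OF this] have "K z = return (K z) (V z, W z)" .
      also have "\<dots> = return borel (V z, W z)" by (rule return_cong[OF sets_K])
      finally show "K z = return borel (V z, W z)" .
    qed
  qed
  show "AE z in lborel. z \<in> QT T \<longrightarrow>
               v (fst z) (snd z) = vh (fst z) (snd z) \<and>
               F (fst z) (snd z) = Fh (fst z) (snd z) \<and>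
               \<nu> (fst z) (snd z) = return borel (vh (fst z) (snd z), Fh (fst z) (snd z))"
    using dirac barycentre
  proof eventually_elim
    case (elim z)
    show ?case
    proof
      assume z: "z \<in> QT T"
      then have zb: "z \<in> QTbar T" using QT_subset_QTbar by blast
      have h: "V z = vh (fst z) (snd z)" "W z = Fh (fst z) (snd z)"
        using z hat_values[of "snd z" "fst z"] by (auto simp: QT_def)
      have n: "\<nu> (fst z) (snd z) = return borel (V z, W z)" using elim(1) zb by (simp add: K_def)
      have "ymean \<nu> (fst z) (snd z) fst = V z" "ymean \<nu> (fst z) (snd z) snd = W z"
        unfolding ymean_def n by (subst integral_return; simp add: borel_measurable_fst_borel borel_measurable_snd_borel)+
      then show "v (fst z) (snd z) = vh (fst z) (snd z) \<and> F (fst z) (snd z) = Fh (fst z) (snd z) \<and>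
         \<nu> (fst z) (snd z) = return borel (vh (fst z) (snd z), Fh (fst z) (snd z))"
        using elim(2) zb n h by simp
    qed
  qed
  have rb0: "AE z in lborel. z \<in> QO T \<longrightarrow> rb z = 0"
    using dirac rb_mean
  proof eventually_elim
    case (elim z)
    show ?case
    proof
      assume "z \<in> QO T"
      then have zb: "z \<in> QTbar T" using QO_subset_QT QT_subset_QTbar by blast
      have c: "continuous_on UNIV (\<lambda>w. rel w z)"
        unfolding rel_def G_rel_def
        by (intro continuous_intros continuous_on_compose2[OF continuous_on_G[of UNIV]]) auto
      have "rb z = (LINT w|return borel (V z, W z). rel w z)" using elim zb by simp
      also have "\<dots> = rel (V z, W z) z"
        by (rule integral_return) (simp_all add: borel_measurable_continuous_onI[OF c])
      also have "\<dots> = 0" by (simp add: rel_def G_rel_def)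
      finally show "rb z = 0" .
    qed
  qed
  have null: "emeasure \<gamma> (Qcell \<times> {0..<s}) = 0" if s: "0 < s" "s < T" for s
  proof -
    \<comment> \<open>A continuously differentiable non-negative weight that ends at
      \<open>s < T\<close> and whose derivative is strictly negative on [0, s).\<close>
    define \<theta> where "\<theta> t = (max 0 (s - t))\<^sup>2" for t
    define \<theta>' where "\<theta>' t = - (2 * max 0 (s - t))" for t
    interpret W: test_weight G DG D2G D3G m M T v0 F0 v F \<nu> \<gamma> vh Fh \<theta> \<theta>' s
    proof unfold_locales
      show "(\<theta> has_real_derivative \<theta>' t) (at t)" for t
      proof -
        have "((\<lambda>t. s - t) has_real_derivative -1) (at t)" by (auto intro!: derivative_eq_intros)
        from DERIV_chain2[OF has_real_derivative_pos_part_square this]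
        show ?thesis unfolding \<theta>_def \<theta>'_def by simp
      qed
      show "continuous_on UNIV \<theta>'" unfolding \<theta>'_def by (intro continuous_intros)
      show "0 \<le> \<theta> t" for t by (simp add: \<theta>_def)
      show "s < T" by (rule s)
      show "\<theta> t = 0" if "s \<le> t" for t using that by (simp add: \<theta>_def)
    qed
    have z: "IQ (\<lambda>z. g z * rb z) = 0" if "ess_bdd g" for g
    proof -
      have "hQ (\<lambda>z. 0) 0" by (simp add: hI_def has_bochner_integral_zero)
      then show ?thesis
        by (rule hQ_unique[OF hQ_rb[OF that]]) (use rb0 in eventually_elim, simp)
    qed
    have "0 \<le> (LINT z:QT T|\<gamma>. \<theta>' (snd z))"
      using W.relative_entropy_inequality[OF C] by (simp add: z W.ess_bdd_\<Theta> W.ess_bdd_\<Theta>t R0)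
    note nn = this
    have [measurable_cong]: "sets \<gamma> = sets borel" by (rule \<gamma>_sets)
    define g where "g z = indicator (QT T) z * (2 * max 0 (s - snd z))" for z :: "vec3 \<times> real"
    have g0: "0 \<le> g z" for z by (simp add: g_def)
    have gm[measurable]: "g \<in> borel_measurable \<gamma>" unfolding g_def[abs_def] by measurable
    have fin: "emeasure \<gamma> (Qcell \<times> {0..s}) < \<infinity>" using s by (intro \<gamma>_finite) auto
    have Qs[measurable]: "Qcell \<times> {0..s} \<in> sets borel" "Qcell \<times> {0..<s} \<in> sets borel" by (intro Times_borel; simp)+
    \<comment> \<open>Integrability is needed for a vanishing integral to force a null function; it
      comes from the finiteness of \<gamma> up to the time \<open>s < T\<close>.\<close>
    have gi: "integrable \<gamma> g"
    proof (rule integrable_bounded_finite_support[OF gm _ fin])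
      show "Qcell \<times> {0..s} \<in> sets \<gamma>" by (simp add: \<gamma>_sets)
      show "AE z in \<gamma>. \<bar>g z\<bar> \<le> 2 * s"
        using s by (intro AE_I2) (auto simp: g_def indicator_def QT_def)
      show "AE z in \<gamma>. z \<notin> Qcell \<times> {0..s} \<longrightarrow> g z = 0"
        by (intro AE_I2) (auto simp: g_def indicator_def QT_def)
    qed
    have "(LINT z|\<gamma>. g z) = - (LINT z:QT T|\<gamma>. \<theta>' (snd z))"
      by (simp add: set_lebesgue_integral_def g_def \<theta>'_def)
    then have "(LINT z|\<gamma>. g z) = 0"
      using nn Bochner_Integration.integral_nonneg[of \<gamma> g] g0 by simp
    then have "AE z in \<gamma>. g z = 0"
      using integral_nonneg_eq_0_iff_AE[OF gi] g0 by simp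
    then have "AE z in \<gamma>. z \<notin> Qcell \<times> {0..<s}"
      by eventually_elim (use s in \<open>auto simp: g_def QT_def\<close>)
    then show ?thesis
      using AE_iff_measurable[of "Qcell \<times> {0..<s}" \<gamma> "\<lambda>z. z \<notin> Qcell \<times> {0..<s}"] Qs sets_eq_imp_space_eq[OF \<gamma>_sets]
      by (simp add: \<gamma>_sets)
  qed
  \<comment> \<open>The shift by 2 keeps every upper end point strictly between 0 and
    \<open>T\<close>: the smallest one is \<open>T / 2\<close>.\<close>
  have "QT T = (\<Union>n. Qcell \<times> {0..<T - T / real (n + 2)})"
  proof (intro equalityI subsetI)
    fix z assume z: "z \<in> QT T"
    then have d: "0 < T - snd z" by (auto simp: QT_def)
    obtain n where "T < real n * (T - snd z)" using reals_Archimedean3[OF d] by blast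
    also have "\<dots> \<le> real (n + 2) * (T - snd z)" using d by (intro mult_right_mono) auto
    finally have "T / real (n + 2) < T - snd z" by (simp add: field_simps)
    then show "z \<in> (\<Union>n. Qcell \<times> {0..<T - T / real (n + 2)})"
      using z by (intro UN_I[of n]) (auto simp: QT_def)
  next
    fix z assume "z \<in> (\<Union>n. Qcell \<times> {0..<T - T / real (n + 2)})"
    then obtain n where n: "z \<in> Qcell \<times> {0..<T - T / real (n + 2)}" by blast
    have "T - T / real (n + 2) \<le> T" using T_pos by simp
    then show "z \<in> QT T" using n by (auto simp: QT_def)
  qed
  moreover have "emeasure \<gamma> (\<Union>n. Qcell \<times> {0..<T - T / real (n + 2)}) = 0"
  proof (rule emeasure_UN_eq_0)
    fix n
    show "emeasure \<gamma> (Qcell \<times> {0..<T - T / real (n + 2)}) = 0"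
    proof (rule null)
      have "T / real (n + 2) < T / 1" using T_pos by (intro divide_strict_left_mono) auto
      then show "0 < T - T / real (n + 2)" by simp
      show "T - T / real (n + 2) < T" using T_pos by simp
    qed
  next
    show "range (\<lambda>n. Qcell \<times> {0..<T - T / real (n + 2)}) \<subseteq> sets \<gamma>"
      unfolding \<gamma>_sets by (auto intro!: Times_borel)
  qed
  ultimately show "emeasure \<gamma> (QT T) = 0" by simp
qed

end

theorem theorem2p5:
  fixes G :: "mat3 \<Rightarrow> real" and DG :: "mat3 \<Rightarrow> mat3"
    and D2G :: "mat3 \<Rightarrow> mat3 \<Rightarrow> mat3 \<Rightarrow> real"
    and D3G :: "mat3 \<Rightarrow> mat3 \<Rightarrow> mat3 \<Rightarrow> mat3 \<Rightarrow> real"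
    and m M T :: real
    and v0 :: "vec3 \<Rightarrow> vec3" and F0 :: "vec3 \<Rightarrow> mat3"
    and v :: "vec3 \<Rightarrow> real \<Rightarrow> vec3" and F :: "vec3 \<Rightarrow> real \<Rightarrow> mat3"
    and \<nu> :: "vec3 \<Rightarrow> real \<Rightarrow> (vec3 \<times> mat3) measure"
    and \<gamma> :: "(vec3 \<times> real) measure"
    and vh :: "vec3 \<Rightarrow> real \<Rightarrow> vec3" and Fh :: "vec3 \<Rightarrow> real \<Rightarrow> mat3"
  assumes "0 < T"
    and "G_hyp G DG D2G D3G m M"
    and "dmv_solution G DG T v0 F0 v F \<nu> \<gamma>"
    and "lipschitz_solution DG T vh Fh"
  shows "(\<exists>c1 c2. 0 < c1 \<and> 0 < c2 \<and>
            (AE t in lborel. t \<in> {0..T} \<longrightarrow>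
              (\<integral>\<^sup>+x. indicator Qcell x *
                  (\<integral>\<^sup>+w. ennreal ((norm (fst w - vh x t))^2 + (norm (snd w - Fh x t))^2) \<partial>\<nu> x t)
                \<partial>lborel)
              \<le> ennreal (c1 * (LINT x:Qcell|lborel.
                     (norm (v0 x - vh x 0))^2 + (norm (F0 x - Fh x 0))^2) * exp (c2 * t))))
       \<and> ((AE x in lborel. x \<in> Qcell \<longrightarrow> v0 x = vh x 0 \<and> F0 x = Fh x 0) \<longrightarrow>
            (AE z in lborel. z \<in> QT T \<longrightarrow>
               v (fst z) (snd z) = vh (fst z) (snd z) \<and>
               F (fst z) (snd z) = Fh (fst z) (snd z) \<and>
               \<nu> (fst z) (snd z) = return borel (vh (fst z) (snd z), Fh (fst z) (snd z)))
            \<and> emeasure \<gamma> (QT T) = 0)"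
proof -
  interpret dissipative_setting G DG D2G D3G m M T v0 F0 v F \<nu> \<gamma> vh Fh
    using assms by unfold_locales
  show ?thesis
    using stability uniqueness by blast
qed

end
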